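(* Let $p\ge 0$ be an integer, let $q=2m+1\geq 3$ be an odd integer, and let $D\subseteq\mathbb{R}^{p+2}$ be a domain invariant under the reflection $(\boldsymbol{x}_p,r)\mapsto(\boldsymbol{x}_p,-r)$, with partially symmetric completion $\Omega_D\subseteq\mathbb{R}^{p+q+1}$. (1) If $f:\Omega_D\to\mathbb{R}_{p+q}$ is a generalized partial-slice regular function, then there exist two unique $\mathbb{R}_{p+q}$-valued functions $A$ and $B$ on $\Omega_D$, polyharmonic of degree $m$ in $\Omega_D$ and symmetric with respect to the real space $\mathbb{R}^{p+1}$, such that $$f(\boldsymbol{x})=A(\boldsymbol{x})-\overline{\boldsymbol{x}}\,B(\boldsymbol{x}),\qquad \boldsymbol{x}\in\Omega_D .$$ (2) Conversely, if $A$ and $B$ are $\mathbb{R}_{p+q}$-valued functions of class $C^{1}$ in $\Omega_D$, symmetric with respect to the real space $\mathbb{R}^{p+1}$, then the function $g(\boldsymbol{x}):=A(\boldsymbol{x})-\overline{\boldsymbol{x}}B(\boldsymbol{x})$ is a generalized partial-slice function on $\Omega_D$. Furthermore, $g$ is generalized partial-slice regular if and only if $A$ and $B$ satisfy, for all $\boldsymbol{x}'=(\boldsymbol{x}_p,r)\in D$, the system $$\begin{cases} D_{\boldsymbol{x}_p}A(\boldsymbol{x}')-\sum_{i=0}^{p}e_i\,\overline{\boldsymbol{x}}_p\,\partial_{x_i}B(\boldsymbol{x}')-r\,\partial_rB(\boldsymbol{x}')=(p+2)B(\boldsymbol{x}'),\\[2pt] \partial_rA(\boldsymbol{x}')-\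overline{\boldsymbol{x}}_p\,\partial_rB(\boldsymbol{x}')+r\,\overline{D}_{\boldsymbol{x}_p}B(\boldsymbol{x}')=0.\end{cases}$$
   Context: Clifford algebra. For $n=p+q$, $\mathbb{R}_{n}$ is the real Clifford algebra generated by $e_1,\dots,e_n$ with $e_ie_j+e_je_i=-2\delta_{ij}$, and $e_0=1$. Clifford conjugation is the real-linear map with $\overline{e_0}=e_0$, $\overline{e_j}=-e_j$ ($1\le j\le n$) and $\overline{ab}=\overline{b}\,\overline{a}$. $\mathbb{R}^{n+1}$ is identified with the paravectors $\sum_{i=0}^n x_ie_i\in\mathbb{R}_n$. Splitting. Each $\boldsymbol{x}\in\mathbb{R}^{p+q+1}$ is written $\boldsymbol{x}=\boldsymbol{x}_p+\underline{\boldsymbol{x}}_q$, with $\boldsymbol{x}_p=\sum_{i=0}^p x_ie_i\in\mathbb{R}^{p+1}$ and $\underline{\boldsymbol{x}}_q=\sum_{i=p+1}^{p+q}x_ie_i\in\mathbb{R}^q$. $\mathbb{S}=\{\underline{\boldsymbol{x}}_q:\ \underline{\boldsymbol{x}}_q^2=-1\}$ is the unit sphere of $\mathbb{R}^q$; write $\underline{\boldsymbol{x}}_q=r\underline{\omega}$ with $r=|\underline{\boldsymbol{x}}_q|\ge 0$, $\underline{\omega}\in\mathbb{S}$. Operators: $D_{\boldsymbol{x}_p}=\sum_{i=0}^pe_i\partial_{x_i}$, $\overline{D}_{\boldsymbol{x}_p}=\partial_{x_0}-\sum_{i=1}^pe_i\partial_{x_i}$ (acting from the left), and $\Delta_{\boldsymbol{x}}=\sum_{i=0}^{p+q}\partial_{x_i}^2$.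 Domains. For $D\subseteq\mathbb{R}^{p+2}$ a domain with $\boldsymbol{x}'=(\boldsymbol{x}_p,r)\in D\Rightarrow \boldsymbol{x}'_\diamond=(\boldsymbol{x}_p,-r)\in D$, the partially symmetric completion is $\Omega_D=\{\boldsymbol{x}_p+r\underline{\omega}:\ \underline{\omega}\in\mathbb{S},\ r\ge0,\ (\boldsymbol{x}_p,r)\in D\}\subseteq\mathbb{R}^{p+q+1}$. Generalized partial-slice functions. $f:\Omega_D\to\mathbb{R}_{p+q}$ is a generalized partial-slice function if $f(\boldsymbol{x})=F_1(\boldsymbol{x}')+\underline{\omega}F_2(\boldsymbol{x}')$ for $\boldsymbol{x}=\boldsymbol{x}_p+r\underline{\omega}\in\Omega_D$, $\boldsymbol{x}'=(\boldsymbol{x}_p,r)$, where $F_1,F_2:D\to\mathbb{R}_{p+q}$ satisfy $F_1(\boldsymbol{x}'_\diamond)=F_1(\boldsymbol{x}')$ and $F_2(\boldsymbol{x}'_\diamond)=-F_2(\boldsymbol{x}')$. It is generalized partial-slice regular if moreover $F_1,F_2\in C^1(D)$ and on $D$: $D_{\boldsymbol{x}_p}F_1-\partial_rF_2=0$ and $\overline{D}_{\boldsymbol{x}_p}F_2+\partial_rF_1=0$. Symmetry. A function $h$ on $\Omega_D$ is symmetric with respect to the real space $\mathbb{R}^{p+1}$ if $h(\boldsymbol{x}_p+|\underline{\boldsymbol{x}}_q|I)=h(\boldsymbol{x}_p+|\underline{\boldsymbol{x}}_q|J)$ for all $I,J\in\mathbb{S}$; then $h$ is regarded as a function of $\boldsymbol{x}'=(\boldsymbol{x}_p,r)\in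 D$, even in $r$, by $h(\boldsymbol{x}')=h(\boldsymbol{x}_p+r\underline{\omega})$ for any $\underline{\omega}\in\mathbb{S}$. A function $h$ is polyharmonic of degree $m$ if it is $C^{2m}$ and $\Delta_{\boldsymbol{x}}^mh=0$. *)

theory Defs
  imports "HOL-Analysis.Analysis"
begin

section \<open>The real Clifford algebra\<close>

text \<open>
  \<open>'n clifford\<close> is the real Clifford algebra on \<open>n = CARD('n)\<close> generators; only the cardinality
  of \<open>'n\<close> matters. An element is the family of its real coefficients with respect to the blades
  \<open>e\<^sub>A\<close>, the products of the generators \<open>e\<^sub>a\<close> (\<open>a \<in> A \<subseteq> {1..n}\<close>) in increasing order.
\<close>

typedef 'n clifford = "{c :: nat set \<Rightarrow> real. \<forall>A. \<not> A \<subseteq> {1..CARD('n)} \<longrightarrow> c A = 0}"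
  morphisms coef Clifford
  by (rule exI[of _ "\<lambda>_. 0"]) simp

setup_lifting type_definition_clifford

lemma coef_outside: "\<not> A \<subseteq> {1..CARD('n)} \<Longrightarrow> coef (x :: 'n clifford) A = 0"
  using coef[of x] by blast

lemma clifford_eqI: "(\<And>A. A \<subseteq> {1..CARD('n)} \<Longrightarrow> coef x A = coef y A) \<Longrightarrow> x = (y :: 'n clifford)"
  by (metis coef_inject coef_outside ext)

text \<open>
  \<open>e\<^sub>A e\<^sub>B = blade_sign A B e\<^sub>C\<close>, where \<open>C\<close> is the symmetric difference of \<open>A\<close> and \<open>B\<close>: sorting the
  product costs one sign for every pair \<open>b < a\<close> (anticommutation) and one for every pair \<open>b = a\<close>
  (from \<open>e\<^sub>a\<^sup>2 = -1\<close>).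
\<close>

definition blade_sign :: "nat set \<Rightarrow> nat set \<Rightarrow> real" where
  "blade_sign A B = (\<Prod>a\<in>A. \<Prod>b\<in>B. if b \<le> a then -1 else 1)"

subsection \<open>Algebra structure\<close>

instantiation clifford :: (type) real_vector
begin

lift_definition zero_clifford :: "'a clifford" is "\<lambda>_. 0" by simp
lift_definition plus_clifford :: "'a clifford \<Rightarrow> 'a clifford \<Rightarrow> 'a clifford"
  is "\<lambda>x y A. x A + y A" by simp
lift_definition minus_clifford :: "'a clifford \<Rightarrow> 'a clifford \<Rightarrow> 'a clifford"
  is "\<lambda>x y A. x A - y A" by simp
lift_definition uminus_clifford :: "'a clifford \<Rightarrow> 'a clifford" is "\<lambda>x A. - x A" by simp
lift_definition scaleR_clifford :: "real \<Rightarrow> 'a clifford \<Rightarrow> 'a clifford"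
  is "\<lambda>c x A. c * x A" by simp

instance
  by (standard; transfer; simp add: fun_eq_iff algebra_simps)

end

lemma sym_diff_outside:
  assumes "\<not> C \<subseteq> I" "A \<subseteq> I" shows "\<not> sym_diff A C \<subseteq> I"
  using assms by blast

instantiation clifford :: (type) "{one, times}"
begin

lift_definition one_clifford :: "'a clifford" is "\<lambda>A. if A = {} then 1 else 0" by auto

text \<open>The coefficient of \<open>e\<^sub>C\<close> in a product collects the pairs of blades \<open>e\<^sub>A, e\<^sub>B\<close> such that
  the symmetric difference of \<open>A\<close> and \<open>B\<close> is \<open>C\<close>, that is, \<open>B = sym_diff A C\<close>.\<close>

lift_definition times_clifford :: "'a clifford \<Rightarrow> 'a clifford \<Rightarrow> 'a clifford"
  is "\<lambda>x y C. \<Sum>A\<in>Pow {1..CARD('a)}. blade_sign A (sym_diff A C) * x A * y (sym_diff A C)"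
  subgoal premises y for x y C
    by (rule sum.neutral) (metis PowD mult_zero_right sym_diff_outside y(2,3))
  done

instance ..

end

lemma prod_sym_diff_sign:
  fixes f :: "'b \<Rightarrow> real"
  assumes "finite A" "finite B" "\<And>x. f x * f x = 1"
  shows "prod f (sym_diff A B) = prod f A * prod f B"
proof -
  have A: "prod f A = prod f (A - B) * prod f (A \<inter> B)"
    using assms by (subst prod.union_disjoint[symmetric]) (auto intro: prod.cong)
  have B: "prod f B = prod f (B - A) * prod f (A \<inter> B)"
    using assms by (subst prod.union_disjoint[symmetric]) (auto intro: prod.cong)
  have 1: "prod f (A \<inter> B) * prod f (A \<inter> B) = 1"
    using assms(3) by (simp flip: prod.distrib)
  have "prod f (sym_diff A B) = prod f (A - B) * prod f (B - A)"
    using assms by (intro prod.union_disjoint) auto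
  also have "\<dots> = prod f (A - B) * prod f (B - A) * (prod f (A \<inter> B) * prod f (A \<inter> B))"
    by (simp add: 1)
  finally show ?thesis by (simp add: A B mult_ac)
qed

lemma blade_sign_sym_diff_left:
  assumes "finite A" "finite B"
  shows "blade_sign (sym_diff A B) C = blade_sign A C * blade_sign B C"
  unfolding blade_sign_def using assms
  by (intro prod_sym_diff_sign) (auto simp flip: prod.distrib intro!: prod.neutral)

lemma blade_sign_sym_diff_right:
  assumes "finite B" "finite C"
  shows "blade_sign A (sym_diff B C) = blade_sign A B * blade_sign A C"
proof -
  have "(\<Prod>b\<in>sym_diff B C. if b \<le> a then - 1 else (1::real)) =
    (\<Prod>b\<in>B. if b \<le> a then - 1 else 1) * (\<Prod>b\<in>C. if b \<le> a then - 1 else 1)" for a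
    using assms by (intro prod_sym_diff_sign) auto
  then show ?thesis unfolding blade_sign_def by (simp flip: prod.distrib)
qed

lemma blade_sign_square: "blade_sign A B * blade_sign A B = 1"
  unfolding blade_sign_def by (auto simp flip: prod.distrib intro!: prod.neutral)

lemma blade_sign_empty [simp]: "blade_sign {} B = 1" "blade_sign A {} = 1"
  by (simp_all add: blade_sign_def)

lemma bij_betw_sym_diff:
  assumes "A \<subseteq> I" shows "bij_betw (sym_diff A) (Pow I) (Pow I)"
  by (rule bij_betw_byWitness[where f' = "sym_diff A"]; use assms in blast)

lemma clifford_mult_assoc: "(x * y) * z = x * (y * z :: 'n clifford)"
proof (rule clifford_eqI)
  fix D assume D: "D \<subseteq> {1..CARD('n)}"
  define P where "P = Pow {1..CARD('n)}"
  let ?s = blade_sign and ?X = "coef x" and ?Y = "coef y" and ?Z = "coef z"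
  have "coef (x * y * z) D = (\<Sum>C\<in>P. ?s C (sym_diff C D) *
      (\<Sum>A\<in>P. ?s A (sym_diff A C) * ?X A * ?Y (sym_diff A C)) * ?Z (sym_diff C D))"
    by (simp add: times_clifford.rep_eq P_def)
  also have "\<dots> = (\<Sum>A\<in>P. \<Sum>C\<in>P. ?s C (sym_diff C D) *
      (?s A (sym_diff A C) * ?X A * ?Y (sym_diff A C)) * ?Z (sym_diff C D))"
    by (subst sum.swap) (simp add: sum_distrib_left sum_distrib_right)
  also have "\<dots> = (\<Sum>A\<in>P. \<Sum>B\<in>P. ?s A (sym_diff A D) * ?X A *
      (?s B (sym_diff B (sym_diff A D)) * ?Y B * ?Z (sym_diff B (sym_diff A D))))"
  proof (rule sum.cong[OF refl])
    fix A assume A: "A \<in> P"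
    have fin: "finite B" if "B \<in> P" for B
      using that finite_subset unfolding P_def by blast
    have "(\<Sum>C\<in>P. ?s C (sym_diff C D) *
        (?s A (sym_diff A C) * ?X A * ?Y (sym_diff A C)) * ?Z (sym_diff C D)) =
      (\<Sum>B\<in>P. ?s (sym_diff A B) (sym_diff (sym_diff A B) D) *
        (?s A (sym_diff A (sym_diff A B)) * ?X A * ?Y (sym_diff A (sym_diff A B))) *
        ?Z (sym_diff (sym_diff A B) D))"
      unfolding P_def using A
      by (intro sum.reindex_bij_betw[symmetric] bij_betw_sym_diff) (simp add: P_def)
    also have "\<dots> = (\<Sum>B\<in>P. ?s A (sym_diff A D) * ?X A *
      (?s B (sym_diff B (sym_diff A D)) * ?Y B * ?Z (sym_diff B (sym_diff A D))))"
    proof (rule sum.cong[OF refl])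
      fix B assume B: "B \<in> P"
      define E where "E = sym_diff (sym_diff A B) D"
      have E: "sym_diff B (sym_diff A D) = E" "sym_diff A D = sym_diff B E"
        "sym_diff A (sym_diff A B) = B"
        unfolding E_def by blast+
      have "finite E"
        using fin[OF A] fin[OF B] D finite_subset unfolding E_def by blast
      then have "?s (sym_diff A B) E * ?s A B = ?s A (sym_diff B E) * ?s B E"
        using fin[OF A] fin[OF B]
        by (simp add: blade_sign_sym_diff_left blade_sign_sym_diff_right)
      then have "(?s (sym_diff A B) E * ?s A B) * (?X A * ?Y B * ?Z E) =
        (?s A (sym_diff B E) * ?s B E) * (?X A * ?Y B * ?Z E)"
        by presburger
      then show "?s (sym_diff A B) (sym_diff (sym_diff A B) D) *
        (?s A (sym_diff A (sym_diff A B)) * ?X A * ?Y (sym_diff A (sym_diff A B))) *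
        ?Z (sym_diff (sym_diff A B) D) = ?s A (sym_diff A D) * ?X A *
      (?s B (sym_diff B (sym_diff A D)) * ?Y B * ?Z (sym_diff B (sym_diff A D)))"
        unfolding E(1,3) E_def[symmetric] unfolding E(2) by (simp only: mult_ac)
    qed
    finally show "(\<Sum>C\<in>P. ?s C (sym_diff C D) *
      (?s A (sym_diff A C) * ?X A * ?Y (sym_diff A C)) * ?Z (sym_diff C D)) =
      (\<Sum>B\<in>P. ?s A (sym_diff A D) * ?X A *
      (?s B (sym_diff B (sym_diff A D)) * ?Y B * ?Z (sym_diff B (sym_diff A D))))" .
  qed
  also have "\<dots> = coef (x * (y * z)) D"
    by (simp add: times_clifford.rep_eq P_def sum_distrib_left)
  finally show "coef (x * y * z) D = coef (x * (y * z)) D" .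
qed

instance clifford :: (type) real_algebra_1
proof
  fix a b c :: "'a clifford" and r :: real
  show "a * b * c = a * (b * c)" by (rule clifford_mult_assoc)
  show "1 * a = a"
  proof (rule clifford_eqI)
    fix C assume "C \<subseteq> {1..CARD('a)}"
    have "coef (1 * a) C = (\<Sum>A\<in>Pow {1..CARD('a)}. if A = {} then coef a C else 0)"
      unfolding times_clifford.rep_eq one_clifford.rep_eq by (intro sum.cong) auto
    then show "coef (1 * a) C = coef a C" by simp
  qed
  show "a * 1 = a"
  proof (rule clifford_eqI)
    fix C assume C: "C \<subseteq> {1..CARD('a)}"
    have "coef (a * 1) C = (\<Sum>A\<in>Pow {1..CARD('a)}. if A = C then coef a C else 0)"
      unfolding times_clifford.rep_eq one_clifford.rep_eq
      by (intro sum.cong) (auto simp: Un_Diff)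
    then show "coef (a * 1) C = coef a C" using C by simp
  qed
  show "(a + b) * c = a * c + b * c"
    by transfer (simp add: fun_eq_iff algebra_simps sum.distrib)
  show "a * (b + c) = a * b + a * c"
    by transfer (simp add: fun_eq_iff algebra_simps sum.distrib)
  show "(0 :: 'a clifford) \<noteq> 1"
    by transfer (auto simp: fun_eq_iff)
  show "(r *\<^sub>R a) * b = r *\<^sub>R (a * b)"
    by transfer (simp add: fun_eq_iff sum_distrib_left mult_ac)
  show "a * (r *\<^sub>R b) = r *\<^sub>R (a * b)"
    by transfer (simp add: fun_eq_iff sum_distrib_left mult_ac)
qed

subsection \<open>Blades and the Euclidean structure\<close>

lift_definition blade :: "nat set \<Rightarrow> 'n clifford"
  is "\<lambda>A B. if B = A \<and> A \<subseteq> {1..CARD('n)} then 1 else 0" by auto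

instantiation clifford :: (type) real_inner
begin

definition inner_clifford :: "'a clifford \<Rightarrow> 'a clifford \<Rightarrow> real" where
  "inner_clifford x y = (\<Sum>A\<in>Pow {1..CARD('a)}. coef x A * coef y A)"
definition norm_clifford :: "'a clifford \<Rightarrow> real" where
  "norm_clifford x = sqrt (inner x x)"
definition sgn_clifford :: "'a clifford \<Rightarrow> 'a clifford" where
  "sgn_clifford x = x /\<^sub>R norm x"
definition dist_clifford :: "'a clifford \<Rightarrow> 'a clifford \<Rightarrow> real" where
  "dist_clifford x y = norm (x - y)"
definition uniformity_clifford :: "('a clifford \<times> 'a clifford) filter" where
  "uniformity_clifford = (INF e\<in>{0<..}. principal {(x, y). dist x y < e})"
definition open_clifford :: "'a clifford set \<Rightarrow> bool" where
  "open_clifford U \<longleftrightarrow> (\<forall>x\<in>U. eventually (\<lambda>(x', y). x' = x \<longrightarrow> y \<in> U) uniformity)"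

instance
proof
  fix x y z :: "'a clifford" and r :: real
  show "dist x y = norm (x - y)" by (rule dist_clifford_def)
  show "sgn x = x /\<^sub>R norm x" by (rule sgn_clifford_def)
  show "(uniformity :: ('a clifford \<times> 'a clifford) filter) =
      (INF e\<in>{0<..}. principal {(x, y). dist x y < e})"
    by (rule uniformity_clifford_def)
  show "open U \<longleftrightarrow> (\<forall>x\<in>U. eventually (\<lambda>(x', y). x' = x \<longrightarrow> y \<in> U) uniformity)"
    for U :: "'a clifford set"
    by (rule open_clifford_def)
  show "inner x y = inner y x" by (simp add: inner_clifford_def mult.commute)
  show "inner (x + y) z = inner x z + inner y z"
    by (simp add: inner_clifford_def plus_clifford.rep_eq algebra_simps sum.distrib)
  show "inner (r *\<^sub>R x) y = r * inner x y"
    by (simp add: inner_clifford_def scaleR_clifford.rep_eq sum_distrib_left mult.assoc)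
  show "0 \<le> inner x x" by (simp add: inner_clifford_def sum_nonneg)
  show "inner x x = 0 \<longleftrightarrow> x = 0"
  proof
    assume "inner x x = 0"
    then have "coef x A = 0" if "A \<subseteq> {1..CARD('a)}" for A
      using that by (simp add: inner_clifford_def sum_nonneg_eq_0_iff)
    then show "x = 0" by (intro clifford_eqI) (simp add: zero_clifford.rep_eq)
  qed (simp add: inner_clifford_def zero_clifford.rep_eq)
  show "norm x = sqrt (inner x x)" by (rule norm_clifford_def)
qed

end

lemma inner_blade:
  assumes "A \<subseteq> {1..CARD('n)}"
  shows "inner x (blade A :: 'n clifford) = coef x A"
proof -
  have "inner x (blade A :: 'n clifford) =
      (\<Sum>B\<in>Pow {1..CARD('n)}. if B = A then coef x A else 0)"
    unfolding inner_clifford_def blade.rep_eq using assms by (intro sum.cong) auto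
  then show ?thesis using assms by simp
qed

instantiation clifford :: (type) euclidean_space
begin

definition Basis_clifford :: "'a clifford set" where
  "Basis_clifford = blade ` Pow {1..CARD('a)}"

instance
proof
  show "(Basis :: 'a clifford set) \<noteq> {}" "finite (Basis :: 'a clifford set)"
    by (auto simp: Basis_clifford_def)
  show "inner u v = (if u = v then 1 else 0)"
    if "u \<in> Basis" "v \<in> Basis" for u v :: "'a clifford"
  proof -
    obtain A B where "A \<subseteq> {1..CARD('a)}" "B \<subseteq> {1..CARD('a)}" "u = blade A" "v = blade B"
      using \<open>u \<in> Basis\<close> \<open>v \<in> Basis\<close> by (auto simp: Basis_clifford_def)
    then show ?thesis
      by (smt (verit) blade.rep_eq inner_blade)
  qed
  show "(\<forall>u\<in>Basis. inner x u = 0) \<longleftrightarrow> x = 0" for x :: "'a clifford"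
    by (auto simp: Basis_clifford_def inner_blade zero_clifford.rep_eq intro!: clifford_eqI)
qed

end

definition gen :: "nat \<Rightarrow> 'n clifford" where
  "gen i = (if i = 0 then 1 else blade {i})"

text \<open>Since \<open>e\<^sub>A\<close> times its conjugate is \<open>1\<close>, conjugation multiplies \<open>e\<^sub>A\<close> by the sign
  \<open>blade_sign A A\<close> of \<open>e\<^sub>A\<^sup>2\<close>. The lemmas \<open>cconj_gen\<close> and \<open>cconj_mult\<close> below are the usual
  defining properties.\<close>

lift_definition cconj :: "'n clifford \<Rightarrow> 'n clifford" is "\<lambda>x A. blade_sign A A * x A" by simp

lemma blade_mult_blade:
  assumes "A \<subseteq> {1..CARD('n)}" "B \<subseteq> {1..CARD('n)}"
  shows "blade A * blade B = blade_sign A B *\<^sub>R (blade (sym_diff A B) :: 'n clifford)"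
proof (rule clifford_eqI)
  fix C assume C: "C \<subseteq> {1..CARD('n)}"
  have "coef (blade A * blade B :: 'n clifford) C =
     (\<Sum>A'\<in>Pow {1..CARD('n)}. if A' = A then (if sym_diff A C = B then blade_sign A B else 0) else 0)"
    unfolding times_clifford.rep_eq blade.rep_eq using assms by (intro sum.cong) auto
  also have "\<dots> = (if C = sym_diff A B then blade_sign A B else 0)"
  proof -
    have "sym_diff A C = B \<longleftrightarrow> C = sym_diff A B" by blast
    then show ?thesis using assms by (subst sum.delta) auto
  qed
  also have "\<dots> = coef (blade_sign A B *\<^sub>R (blade (sym_diff A B) :: 'n clifford)) C"
    using assms C by (auto simp: scaleR_clifford.rep_eq blade.rep_eq)
  finally show "coef (blade A * blade B :: 'n clifford) C =
    coef (blade_sign A B *\<^sub>R (blade (sym_diff A B) :: 'n clifford)) C" .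
qed

lemma blade_empty: "blade {} = 1"
  by transfer auto

lemma blade_insert:
  assumes "insert a A \<subseteq> {1..CARD('n)}" "\<And>b. b \<in> A \<Longrightarrow> a < b"
  shows "blade (insert a A) = gen a * (blade A :: 'n clifford)"
proof -
  have "sym_diff {a} A = insert a A" "a \<noteq> 0" using assms by force+
  moreover have "blade_sign {a} A = 1"
    unfolding blade_sign_def using assms by (force intro!: prod.neutral)
  ultimately show ?thesis
    using assms by (simp add: gen_def blade_mult_blade)
qed

lemma gen_anticommute:
  assumes "i \<in> {1..CARD('n)}" "j \<in> {1..CARD('n)}"
  shows "gen i * gen j + gen j * gen i = (if i = j then - 2 else 0 :: 'n clifford)"
proof (cases "i = j")
  case True
  have "gen i * gen i = (- 1 :: 'n clifford)"
    using assms by (simp add: gen_def blade_mult_blade blade_sign_def blade_empty)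
  with True show ?thesis by simp
next
  case False
  then have "sym_diff {i} {j} = sym_diff {j} {i}" by blast
  then show ?thesis
    using assms False by (auto simp: gen_def blade_mult_blade blade_sign_def)
qed

lemma cconj_linear: "linear (cconj :: 'n clifford \<Rightarrow> 'n clifford)"
  by (rule linearI; transfer) (simp_all add: fun_eq_iff algebra_simps)

lemma cconj_gen:
  "cconj (gen 0) = (gen 0 :: 'n clifford)"
  "i \<noteq> 0 \<Longrightarrow> cconj (gen i) = - (gen i :: 'n clifford)"
  unfolding gen_def
  by (simp_all, (transfer, auto simp: fun_eq_iff blade_sign_def)+)

lemma cconj_mult: "cconj (x * y) = cconj y * cconj (x :: 'n clifford)"
proof (rule clifford_eqI)
  fix C assume C: "C \<subseteq> {1..CARD('n)}"
  let ?P = "Pow {1..CARD('n)}" and ?s = blade_sign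
  have "coef (cconj (x * y)) C =
      (\<Sum>A\<in>?P. ?s C C * (?s A (sym_diff A C) * coef x A * coef y (sym_diff A C)))"
    by (simp add: cconj.rep_eq times_clifford.rep_eq sum_distrib_left)
  also have "\<dots> = (\<Sum>B\<in>?P. ?s C C * (?s (sym_diff C B) (sym_diff (sym_diff C B) C) *
      coef x (sym_diff C B) * coef y (sym_diff (sym_diff C B) C)))"
    using C by (intro sum.reindex_bij_betw[symmetric] bij_betw_sym_diff)
  also have "\<dots> = (\<Sum>B\<in>?P. ?s B (sym_diff B C) * (?s B B * coef y B) *
      (?s (sym_diff B C) (sym_diff B C) * coef x (sym_diff B C)))"
  proof (rule sum.cong[OF refl])
    fix B assume B: "B \<in> ?P"
    define A where "A = sym_diff B C"
    have eqs: "sym_diff C B = A" "sym_diff A C = B" "C = sym_diff A B"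
      unfolding A_def by blast+
    have fin: "finite A" "finite B"
      using B C finite_subset unfolding A_def by blast+
    have "?s C C * ?s A B = ?s A A * ?s B B * ?s B A * (?s A B * ?s A B)"
      using fin by (simp add: eqs(3) blade_sign_sym_diff_left blade_sign_sym_diff_right mult_ac)
    then have sgn: "?s C C * ?s A B = ?s A A * ?s B B * ?s B A"
      by (simp add: blade_sign_square)
    have "?s C C * (?s A B * coef x A * coef y B) = (?s C C * ?s A B) * coef x A * coef y B"
      by (simp add: mult_ac)
    also have "\<dots> = ?s B A * (?s B B * coef y B) * (?s A A * coef x A)"
      unfolding sgn by (simp add: mult_ac)
    finally show "?s C C * (?s (sym_diff C B) (sym_diff (sym_diff C B) C) *
      coef x (sym_diff C B) * coef y (sym_diff (sym_diff C B) C)) =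
      ?s B (sym_diff B C) * (?s B B * coef y B) *
      (?s (sym_diff B C) (sym_diff B C) * coef x (sym_diff B C))"
      unfolding eqs(1,2) A_def[symmetric] .
  qed
  also have "\<dots> = coef (cconj y * cconj x) C"
    by (simp add: times_clifford.rep_eq cconj.rep_eq)
  finally show "coef (cconj (x * y)) C = coef (cconj y * cconj x) C" .
qed

section \<open>Partial derivatives\<close>

definition pdiff :: "'a \<Rightarrow> ('a :: real_normed_vector \<Rightarrow> 'b :: real_normed_vector) \<Rightarrow> 'a \<Rightarrow> 'b" where
  "pdiff v f x = vector_derivative (\<lambda>t. f (x + t *\<^sub>R v)) (at 0)"

text \<open>\<open>Ck_on V k U f\<close>: \<open>f\<close> is of class \<open>C\<^sup>k\<close> on \<open>U\<close>, where \<open>U\<close> is an open subset of the space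
  spanned by the finitely many coordinate directions \<open>V\<close>, that is, all partial derivatives of \<open>f\<close>
  of order at most \<open>k\<close> along \<open>V\<close> exist and are continuous on \<open>U\<close>.\<close>

fun Ck_on :: "'a set \<Rightarrow> nat \<Rightarrow> 'a set \<Rightarrow> ('a :: real_normed_vector \<Rightarrow> 'b :: real_normed_vector) \<Rightarrow> bool"
where
  "Ck_on V 0 U f \<longleftrightarrow> continuous_on U f"
| "Ck_on V (Suc k) U f \<longleftrightarrow> continuous_on U f \<and>
     (\<forall>v\<in>V. (\<forall>x\<in>U. (\<lambda>t::real. f (x + t *\<^sub>R v)) differentiable (at 0)) \<and> Ck_on V k U (pdiff v f))"

section \<open>Generalized partial-slice functions\<close>

text \<open>
  \<open>\<real>\<^sup>p\<^sup>+\<^sup>q\<^sup>+\<^sup>1\<close> is identified with the paravectors in \<open>'n clifford\<close>, where \<open>CARD('n) = p + q\<close>;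
  \<open>\<real>\<^sup>p\<^sup>+\<^sup>1\<close> and \<open>\<real>\<^sup>q\<close> are the subspaces \<open>pspace p\<close> and \<open>qspace p q\<close>, and a point
  \<open>x' = (x\<^sub>p, r)\<close> of \<open>\<real>\<^sup>p\<^sup>+\<^sup>2\<close> is an element of \<open>pspace p \<times> UNIV\<close>. Openness and partial derivatives
  are relative to these subspaces, and values of functions outside \<open>D\<close> or \<open>\<Omega>\<^sub>D\<close> are irrelevant.
\<close>

definition pspace :: "nat \<Rightarrow> 'n clifford set" where
  "pspace p = span (gen ` {0..p})"

definition qspace :: "nat \<Rightarrow> nat \<Rightarrow> 'n clifford set" where
  "qspace p q = span (gen ` {p+1..p+q})"

definition ppart :: "nat \<Rightarrow> 'n clifford \<Rightarrow> 'n clifford" where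
  "ppart p x = (\<Sum>i=0..p. inner x (gen i) *\<^sub>R gen i)"

definition qpart :: "nat \<Rightarrow> nat \<Rightarrow> 'n clifford \<Rightarrow> 'n clifford" where
  "qpart p q x = (\<Sum>i=p+1..p+q. inner x (gen i) *\<^sub>R gen i)"

definition unit_sphere :: "nat \<Rightarrow> nat \<Rightarrow> 'n clifford set" where
  "unit_sphere p q = {w \<in> qspace p q. w ^ 2 = - 1}"

definition domain_in_stem_space :: "nat \<Rightarrow> ('n clifford \<times> real) set \<Rightarrow> bool" where
  "domain_in_stem_space p D \<longleftrightarrow>
     openin (top_of_set (pspace p \<times> UNIV)) D \<and> connected D"

definition sym_completion :: "nat \<Rightarrow> nat \<Rightarrow> ('n clifford \<times> real) set \<Rightarrow> 'n clifford set" where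
  "sym_completion p q D = {xp + r *\<^sub>R w | xp r w. w \<in> unit_sphere p q \<and> r \<ge> 0 \<and> (xp, r) \<in> D}"

text \<open>Differential operators on functions of \<open>x' = (x\<^sub>p, r)\<close>, acting from the left.\<close>

abbreviation dx :: "nat \<Rightarrow> ('n clifford \<times> real \<Rightarrow> 'n clifford) \<Rightarrow> 'n clifford \<times> real \<Rightarrow> 'n clifford" where
  "dx i \<equiv> pdiff (gen i, 0)"

abbreviation dr :: "('n clifford \<times> real \<Rightarrow> 'n clifford) \<Rightarrow> 'n clifford \<times> real \<Rightarrow> 'n clifford" where
  "dr \<equiv> pdiff (0, 1)"

definition Dp :: "nat \<Rightarrow> ('n clifford \<times> real \<Rightarrow> 'n clifford) \<Rightarrow> 'n clifford \<times> real \<Rightarrow> 'n clifford" where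
  "Dp p F x' = (\<Sum>i=0..p. gen i * dx i F x')"

definition Dp_bar :: "nat \<Rightarrow> ('n clifford \<times> real \<Rightarrow> 'n clifford) \<Rightarrow> 'n clifford \<times> real \<Rightarrow> 'n clifford" where
  "Dp_bar p F x' = dx 0 F x' - (\<Sum>i=1..p. gen i * dx i F x')"

definition stem_dirs :: "nat \<Rightarrow> ('n clifford \<times> real) set" where
  "stem_dirs p = (\<lambda>i. (gen i, 0)) ` {0..p} \<union> {(0, 1)}"

definition parity_conditions ::
  "('n clifford \<times> real) set \<Rightarrow> ('n clifford \<times> real \<Rightarrow> 'n clifford) \<Rightarrow> ('n clifford \<times> real \<Rightarrow> 'n clifford) \<Rightarrow> bool"
where
  "parity_conditions D F1 F2 \<longleftrightarrow>
     (\<forall>(xp, r)\<in>D. F1 (xp, - r) = F1 (xp, r) \<and> F2 (xp, - r) = - F2 (xp, r))"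

definition induced_by ::
  "nat \<Rightarrow> nat \<Rightarrow> ('n clifford \<times> real) set \<Rightarrow> ('n clifford \<Rightarrow> 'n clifford) \<Rightarrow>
    ('n clifford \<times> real \<Rightarrow> 'n clifford) \<Rightarrow> ('n clifford \<times> real \<Rightarrow> 'n clifford) \<Rightarrow> bool"
where
  "induced_by p q D f F1 F2 \<longleftrightarrow>
     (\<forall>xp r w. (xp, r) \<in> D \<and> r \<ge> 0 \<and> w \<in> unit_sphere p q \<longrightarrow>
        f (xp + r *\<^sub>R w) = F1 (xp, r) + w * F2 (xp, r))"

definition gen_partial_slice ::
  "nat \<Rightarrow> nat \<Rightarrow> ('n clifford \<times> real) set \<Rightarrow> ('n clifford \<Rightarrow> 'n clifford) \<Rightarrow> bool"
where
  "gen_partial_slice p q D f \<longleftrightarrow>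
     (\<exists>F1 F2. parity_conditions D F1 F2 \<and> induced_by p q D f F1 F2)"

definition gen_partial_slice_regular ::
  "nat \<Rightarrow> nat \<Rightarrow> ('n clifford \<times> real) set \<Rightarrow> ('n clifford \<Rightarrow> 'n clifford) \<Rightarrow> bool"
where
  "gen_partial_slice_regular p q D f \<longleftrightarrow>
     (\<exists>F1 F2. parity_conditions D F1 F2 \<and> induced_by p q D f F1 F2 \<and>
        Ck_on (stem_dirs p) 1 D F1 \<and> Ck_on (stem_dirs p) 1 D F2 \<and>
        (\<forall>x'\<in>D. Dp p F1 x' - dr F2 x' = 0 \<and> Dp_bar p F2 x' + dr F1 x' = 0))"

section \<open>Symmetric and polyharmonic functions\<close>

definition symmetric_on ::
  "nat \<Rightarrow> nat \<Rightarrow> 'n clifford set \<Rightarrow> ('n clifford \<Rightarrow> 'n clifford) \<Rightarrow> bool"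
where
  "symmetric_on p q U h \<longleftrightarrow>
     (\<forall>x\<in>U. \<forall>I\<in>unit_sphere p q. \<forall>J\<in>unit_sphere p q.
        h (ppart p x + norm (qpart p q x) *\<^sub>R I) = h (ppart p x + norm (qpart p q x) *\<^sub>R J))"

text \<open>A symmetric function regarded as a function of \<open>x' = (x\<^sub>p, r)\<close>. The choice of \<open>w\<close> does not
  matter, also for \<open>r < 0\<close>, because \<open>r w = \<bar>r\<bar> (- w)\<close>.\<close>

definition stem_of :: "nat \<Rightarrow> nat \<Rightarrow> ('n clifford \<Rightarrow> 'n clifford) \<Rightarrow> 'n clifford \<times> real \<Rightarrow> 'n clifford" where
  "stem_of p q h = (\<lambda>(xp, r). h (xp + r *\<^sub>R (SOME w. w \<in> unit_sphere p q)))"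

definition C_class :: "nat \<Rightarrow> nat \<Rightarrow> nat \<Rightarrow> 'n clifford set \<Rightarrow> ('n clifford \<Rightarrow> 'n clifford) \<Rightarrow> bool" where
  "C_class p q k U h \<longleftrightarrow> Ck_on (gen ` {0..p+q}) k U h"

definition laplacian :: "nat \<Rightarrow> nat \<Rightarrow> ('n clifford \<Rightarrow> 'n clifford) \<Rightarrow> 'n clifford \<Rightarrow> 'n clifford" where
  "laplacian p q h x = (\<Sum>i=0..p+q. pdiff (gen i) (pdiff (gen i) h) x)"

definition polyharmonic_on ::
  "nat \<Rightarrow> nat \<Rightarrow> nat \<Rightarrow> 'n clifford set \<Rightarrow> ('n clifford \<Rightarrow> 'n clifford) \<Rightarrow> bool"
where
  "polyharmonic_on p q m U h \<longleftrightarrow>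
     C_class p q (2 * m) U h \<and> (\<forall>x\<in>U. (laplacian p q ^^ m) h x = 0)"

definition AB_system ::
  "nat \<Rightarrow> ('n clifford \<times> real) set \<Rightarrow> ('n clifford \<times> real \<Rightarrow> 'n clifford) \<Rightarrow> ('n clifford \<times> real \<Rightarrow> 'n clifford) \<Rightarrow> bool"
where
  "AB_system p D A B \<longleftrightarrow>
     (\<forall>(xp, r)\<in>D.
        Dp p A (xp, r) - (\<Sum>i=0..p. gen i * cconj xp * dx i B (xp, r)) - r *\<^sub>R dr B (xp, r)
          = real (p + 2) *\<^sub>R B (xp, r) \<and>
        dr A (xp, r) - cconj xp * dr B (xp, r) + r *\<^sub>R Dp_bar p B (xp, r) = 0)"

end

theory Submission
  imports Defs
begin

text \<open>
  The decomposition forces \<open>B = F\<^sub>2 / r\<close> and \<open>A = F\<^sub>1 + x\<^sub>p\<^sup>c B\<close>, where \<open>x\<^sub>p\<^sup>c\<close> is the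
  conjugate of \<open>x\<^sub>p\<close>; uniqueness follows by comparing the values at \<open>x\<^sub>p + r w\<close> and
  \<open>x\<^sub>p - r w\<close> for \<open>r > 0\<close>, and by continuity at \<open>r = 0\<close>.

  Regularity. Stem functions are extended constantly to the ambient Euclidean space. A \<open>C\<^sup>1\<close>
  solution of the Cauchy-Riemann system is weakly harmonic: against a scalar kernel, the
  coefficients \<open>e\<^sub>i e\<^sub>j\<close> with \<open>i \<noteq> j\<close> cancel by anticommutation. Testing with the Laplacian of
  \<open>max 0 (l - |z - x|\<^sup>2)\<^sup>N\<^sup>+\<^sup>1\<close> shows that \<open>g(l) = \<integral> max 0 (l - |z - x|\<^sup>2)\<^sup>N F(z) dz\<close> satisfies
  \<open>2 l g' = (2 N + n) g\<close>, in dimension \<open>n\<close>. The same equation holds for \<open>F = 1\<close>, so the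
  quotient is constant in \<open>l\<close> and equal to its limit \<open>F(x)\<close> at \<open>l = 0\<close>. Hence \<open>F\<close> is locally
  a convolution with a kernel of class \<open>C\<^sup>N\<^sup>-\<^sup>1\<close>, for every \<open>N\<close>.

  Polyharmonicity. Let \<open>L h = (\<partial>\<^sub>r h) / r\<close>, which maps smooth even functions to smooth even
  functions, let \<open>H\<^sub>k = L\<^sup>k F\<^sub>1\<close> and \<open>K\<^sub>k = L\<^sup>k (F\<^sub>2 / r)\<close>, and let \<open>\<Delta>'\<close> be the Laplacian in
  \<open>(x\<^sub>p, r)\<close>. Differentiating \<open>\<partial>\<^sub>r h = r L h\<close> and cancelling \<open>r\<close> gives
  \<open>\<Delta>' H\<^sub>k = - 2 k H\<^sub>k\<^sub>+\<^sub>1\<close>, \<open>\<Delta>' K\<^sub>k = - 2 (k + 1) K\<^sub>k\<^sub>+\<^sub>1\<close>, and that the conjugate Dirac operator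
  maps \<open>K\<^sub>k\<close> to \<open>- H\<^sub>k\<^sub>+\<^sub>1\<close>. Since the full Laplacian acts on partially radial functions as
  \<open>\<Delta>' + (q - 1) L\<close>, it maps \<open>K\<^sub>k\<close> to \<open>(q - 3 - 2 k) K\<^sub>k\<^sub>+\<^sub>1\<close> and \<open>H\<^sub>k + x\<^sub>p\<^sup>c K\<^sub>k\<close> to
  \<open>(q - 3 - 2 k) (H\<^sub>k\<^sub>+\<^sub>1 + x\<^sub>p\<^sup>c K\<^sub>k\<^sub>+\<^sub>1)\<close>; the factor vanishes for \<open>k = m - 1\<close>.
\<close>

section \<open>Directional derivatives\<close>

text \<open>\<open>pdiff\<close> is total and carries no information where the derivative does not
  exist. The relational form includes existence, so the calculus rules below need no separate
  differentiability premises.\<close>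

definition has_pdiff :: "'a \<Rightarrow> ('a :: real_normed_vector \<Rightarrow> 'b :: real_normed_vector) \<Rightarrow> 'a \<Rightarrow> 'b \<Rightarrow> bool" where
  "has_pdiff v f x d \<longleftrightarrow> ((\<lambda>t. f (x + t *\<^sub>R v)) has_vector_derivative d) (at 0)"

lemma has_pdiff_imp_pdiff: "has_pdiff v f x d \<Longrightarrow> pdiff v f x = d"
  unfolding has_pdiff_def pdiff_def by (rule vector_derivative_at)

lemma has_pdiff_unique: "has_pdiff v f x d \<Longrightarrow> has_pdiff v f x e \<Longrightarrow> d = e"
  by (auto dest!: has_pdiff_imp_pdiff)

lemma differentiable_iff_has_pdiff:
  "(\<lambda>t::real. f (x + t *\<^sub>R v)) differentiable (at 0) \<longleftrightarrow> has_pdiff v f x (pdiff v f x)"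
  unfolding has_pdiff_def pdiff_def by (metis differentiableI_vector vector_derivative_works)

lemma Ck_on_has_pdiff: "Ck_on V (Suc k) U f \<Longrightarrow> v \<in> V \<Longrightarrow> x \<in> U \<Longrightarrow> has_pdiff v f x (pdiff v f x)"
  using differentiable_iff_has_pdiff[of f x v] by auto

lemma Ck_on_pdiff: "Ck_on V (Suc k) U f \<Longrightarrow> v \<in> V \<Longrightarrow> Ck_on V k U (pdiff v f)"
  by simp

text \<open>Translating the parameter turns a derivative at a point of a line into a derivative of
  the line function at an arbitrary parameter, the form that the fundamental theorem and the Leibniz
  rule require.\<close>

lemma has_pdiff_shift:
  "has_pdiff v f (x + s *\<^sub>R v) d \<longleftrightarrow> ((\<lambda>t. f (x + t *\<^sub>R v)) has_vector_derivative d) (at s)"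
proof
  assume "has_pdiff v f (x + s *\<^sub>R v) d"
  then have "((\<lambda>t. f (x + s *\<^sub>R v + t *\<^sub>R v)) has_vector_derivative d) (at (s - s))"
    by (simp add: has_pdiff_def)
  from vector_diff_chain_at[where f = "\<lambda>t. t - s" and f' = 1, OF _ this]
  have "((\<lambda>t. t - s) has_vector_derivative 1) (at s) \<Longrightarrow> ((\<lambda>t. f (x + t *\<^sub>R v)) has_vector_derivative d) (at s)"
    by (simp add: o_def algebra_simps)
  moreover have "((\<lambda>t. t - s) has_vector_derivative 1) (at s)"
    by (auto intro!: derivative_eq_intros)
  ultimately show "((\<lambda>t. f (x + t *\<^sub>R v)) has_vector_derivative d) (at s)" by blast
next
  assume "((\<lambda>t. f (x + t *\<^sub>R v)) has_vector_derivative d) (at s)"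
  then have "((\<lambda>t. f (x + t *\<^sub>R v)) has_vector_derivative d) (at (0 + s))"
    by simp
  from vector_diff_chain_at[where f = "\<lambda>t. t + s" and f' = 1, OF _ this]
  have "((\<lambda>t. t + s) has_vector_derivative 1) (at 0) \<Longrightarrow> has_pdiff v f (x + s *\<^sub>R v) d"
    by (simp add: has_pdiff_def o_def algebra_simps)
  moreover have "((\<lambda>t. t + s) has_vector_derivative 1) (at 0)"
    by (auto intro!: derivative_eq_intros)
  ultimately show "has_pdiff v f (x + s *\<^sub>R v) d" by blast
qed

text \<open>A substitute for openness: the domains \<open>D\<close> are open only relative to a subspace.\<close>

definition dir_open :: "'a :: real_normed_vector set \<Rightarrow> 'a set \<Rightarrow> bool" where
  "dir_open V U \<longleftrightarrow> (\<forall>x\<in>U. \<forall>v\<in>V. \<forall>\<^sub>F t in nhds 0. x + t *\<^sub>R v \<in> U)"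

lemma dir_openD: "dir_open V U \<Longrightarrow> x \<in> U \<Longrightarrow> v \<in> V \<Longrightarrow> \<forall>\<^sub>F t in nhds 0. x + t *\<^sub>R v \<in> U"
  by (simp add: dir_open_def)

lemma open_dir_open: "open U \<Longrightarrow> dir_open V U"
  unfolding dir_open_def
proof (intro ballI)
  fix x v assume "open U" "x \<in> U"
  have "((\<lambda>t. x + t *\<^sub>R v) \<longlongrightarrow> x + 0 *\<^sub>R v) (nhds 0)"
    by (intro tendsto_intros) (simp add: filterlim_ident)
  then show "\<forall>\<^sub>F t in nhds 0. x + t *\<^sub>R v \<in> U"
    using \<open>open U\<close> \<open>x \<in> U\<close> by (simp add: topological_tendstoD)
qed

text \<open>Only the values on the line through \<open>x\<close> matter. The filter is
  \<open>nhds 0\<close> rather than \<open>at 0\<close> because a derivative at \<open>0\<close>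
  also depends on the value there.\<close>

lemma has_pdiff_transform:
  assumes "has_pdiff v f x d" "\<forall>\<^sub>F t in nhds 0. f (x + t *\<^sub>R v) = g (x + t *\<^sub>R v)"
  shows "has_pdiff v g x d"
proof -
  have "\<forall>\<^sub>F t in at 0. f (x + t *\<^sub>R v) = g (x + t *\<^sub>R v)"
    using assms(2) by (auto simp: eventually_at_filter elim: eventually_mono)
  moreover have "f (x + 0 *\<^sub>R v) = g (x + 0 *\<^sub>R v)"
    using eventually_nhds_x_imp_x[OF assms(2)] .
  ultimately show ?thesis
    using assms(1) unfolding has_pdiff_def has_vector_derivative_def
    by (elim has_derivative_transform_eventually[where x = "0::real" and s = UNIV]) auto
qed

lemma pdiff_cong_eventually:
  assumes "\<forall>\<^sub>F t in nhds 0. f (x + t *\<^sub>R v) = g (x + t *\<^sub>R v)"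
  shows "pdiff v f x = pdiff v g x"
proof -
  have "has_pdiff v f x d \<longleftrightarrow> has_pdiff v g x d" for d
  proof
    show "has_pdiff v f x d \<Longrightarrow> has_pdiff v g x d"
      by (rule has_pdiff_transform[OF _ assms])
    show "has_pdiff v g x d \<Longrightarrow> has_pdiff v f x d"
      by (erule has_pdiff_transform, rule eventually_mono[OF assms]) simp
  qed
  then show ?thesis unfolding pdiff_def vector_derivative_def has_pdiff_def by simp
qed

lemma pdiff_cong:
  assumes "dir_open V U" "v \<in> V" "x \<in> U" "\<And>y. y \<in> U \<Longrightarrow> f y = g y"
  shows "pdiff v f x = pdiff v g x"
  by (rule pdiff_cong_eventually, rule eventually_mono[OF dir_openD[OF assms(1,3,2)]])
    (use assms(4) in auto)

lemma has_pdiff_cong: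
  assumes "has_pdiff v f x d" "dir_open V U" "v \<in> V" "x \<in> U" "\<And>y. y \<in> U \<Longrightarrow> f y = g y"
  shows "has_pdiff v g x d"
  by (rule has_pdiff_transform[OF assms(1)], rule eventually_mono[OF dir_openD[OF assms(2,4,3)]])
    (use assms(5) in auto)

lemma has_pdiff_const: "has_pdiff v (\<lambda>_. c) x 0"
  by (simp add: has_pdiff_def)

lemma has_pdiff_add:
  "has_pdiff v f x d \<Longrightarrow> has_pdiff v g x e \<Longrightarrow> has_pdiff v (\<lambda>x. f x + g x) x (d + e)"
  unfolding has_pdiff_def by (rule has_vector_derivative_add)

lemma has_pdiff_linear:
  assumes "bounded_linear h" "has_pdiff v f x d"
  shows "has_pdiff v (\<lambda>x. h (f x)) x (h d)"
  using bounded_linear.has_vector_derivative[OF assms(1) assms(2)[unfolded has_pdiff_def]]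
  by (simp add: has_pdiff_def)

lemma has_pdiff_linear_fun:
  assumes "bounded_linear h"
  shows "has_pdiff v h x (h v)"
proof (rule has_pdiff_linear[OF assms])
  show "has_pdiff v (\<lambda>x. x) x v"
    unfolding has_pdiff_def by (auto intro!: derivative_eq_intros)
qed

lemma has_pdiff_bilinear:
  assumes "bounded_bilinear h" "has_pdiff v f x d" "has_pdiff v g x e"
  shows "has_pdiff v (\<lambda>x. h (f x) (g x)) x (h (f x) e + h d (g x))"
  using bounded_bilinear.has_vector_derivative[OF assms(1) assms(2,3)[unfolded has_pdiff_def]]
  by (simp add: has_pdiff_def)

lemma has_pdiff_diff:
  assumes "has_pdiff v f x d" "has_pdiff v g x e"
  shows "has_pdiff v (\<lambda>x. f x - g x) x (d - e)"
  using has_vector_derivative_diff[OF assms[unfolded has_pdiff_def]] by (simp add: has_pdiff_def)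

lemma has_pdiff_sum:
  "(\<And>i. i \<in> I \<Longrightarrow> has_pdiff v (f i) x (d i)) \<Longrightarrow> has_pdiff v (\<lambda>x. \<Sum>i\<in>I. f i x) x (\<Sum>i\<in>I. d i)"
  unfolding has_pdiff_def by (rule has_vector_derivative_sum)

section \<open>Functions with continuous iterated partial derivatives\<close>

lemma Ck_on_continuous: "Ck_on V k U f \<Longrightarrow> continuous_on U f"
  by (cases k) auto

lemma Ck_on_subset: "Ck_on V k U f \<Longrightarrow> W \<subseteq> U \<Longrightarrow> Ck_on V k W f"
  by (induction k arbitrary: f) (auto intro: continuous_on_subset)

lemma Ck_on_Suc_iff:
  "Ck_on V (Suc k) U f \<longleftrightarrow> continuous_on U f \<and>
    (\<forall>v\<in>V. (\<forall>x\<in>U. has_pdiff v f x (pdiff v f x)) \<and> Ck_on V k U (pdiff v f))"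
  by (simp add: differentiable_iff_has_pdiff)

text \<open>The induction passes from \<open>f\<close> to \<open>pdiff v f\<close>; on
  \<open>U\<close> the derivatives of \<open>f\<close> and \<open>g\<close> agree because
  \<open>dir_open\<close> keeps short segments in direction \<open>v\<close> inside
  \<open>U\<close>.\<close>

lemma Ck_on_cong:
  assumes "Ck_on V k U f" "dir_open V U" "\<And>x. x \<in> U \<Longrightarrow> f x = g x"
  shows "Ck_on V k U g"
  using assms(1,3)
proof (induction k arbitrary: f g)
  case 0
  then show ?case by (simp cong: continuous_on_cong_simp)
next
  case (Suc k)
  have "continuous_on U g"
    by (rule continuous_on_eq[OF Ck_on_continuous[OF Suc.prems(1)] Suc.prems(2)])
  moreover have "has_pdiff v g x (pdiff v g x)" if "v \<in> V" "x \<in> U" for v x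
  proof -
    have "has_pdiff v g x (pdiff v f x)"
      by (rule has_pdiff_cong[OF Ck_on_has_pdiff[OF Suc.prems(1) that] assms(2) that Suc.prems(2)])
    then show ?thesis by (simp add: has_pdiff_imp_pdiff[OF \<open>has_pdiff v g x (pdiff v f x)\<close>])
  qed
  moreover have "Ck_on V k U (pdiff v g)" if "v \<in> V" for v
    by (rule Suc.IH[of "pdiff v f"])
      (use Suc.prems(1) that in auto, rule pdiff_cong[OF assms(2) that _ Suc.prems(2)])
  ultimately show ?case unfolding Ck_on_Suc_iff by simp
qed

lemma Ck_on_SucI:
  assumes "dir_open V U" "continuous_on U f"
    "\<And>v x. v \<in> V \<Longrightarrow> x \<in> U \<Longrightarrow> has_pdiff v f x (g v x)"
    "\<And>v. v \<in> V \<Longrightarrow> Ck_on V k U (g v)"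
  shows "Ck_on V (Suc k) U f"
  unfolding Ck_on_Suc_iff
proof (intro conjI ballI assms(2))
  fix v assume v: "v \<in> V"
  show "has_pdiff v f x (pdiff v f x)" if "x \<in> U" for x
    using assms(3)[OF v that] has_pdiff_imp_pdiff[OF assms(3)[OF v that]] by simp
  show "Ck_on V k U (pdiff v f)"
    by (rule Ck_on_cong[OF assms(4)[OF v] assms(1)])
      (rule has_pdiff_imp_pdiff[OF assms(3)[OF v], symmetric])
qed

lemma Ck_on_Suc_imp: "Ck_on V (Suc k) U f \<Longrightarrow> Ck_on V k U f"
  by (induction k arbitrary: f) auto

lemma Ck_on_const: "dir_open V U \<Longrightarrow> Ck_on V k U (\<lambda>_. c)"
proof (induction k arbitrary: c)
  case (Suc k)
  show ?case
    by (rule Ck_on_SucI[where g = "\<lambda>_ _. 0"])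
      (use Suc has_pdiff_const in auto)
qed auto

lemma Ck_on_add:
  "dir_open V U \<Longrightarrow> Ck_on V k U f \<Longrightarrow> Ck_on V k U g \<Longrightarrow> Ck_on V k U (\<lambda>x. f x + g x)"
proof (induction k arbitrary: f g)
  case (Suc k)
  show ?case
    by (rule Ck_on_SucI[where g = "\<lambda>v x. pdiff v f x + pdiff v g x"])
      (use Suc Ck_on_has_pdiff[OF Suc.prems(2)] Ck_on_has_pdiff[OF Suc.prems(3)] in
        \<open>auto intro!: continuous_on_add has_pdiff_add\<close>)
qed (auto intro: continuous_on_add)

lemma Ck_on_linear:
  assumes "dir_open V U" "bounded_linear h"
  shows "Ck_on V k U f \<Longrightarrow> Ck_on V k U (\<lambda>x. h (f x))"
proof (induction k arbitrary: f)
  case 0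
  then show ?case using bounded_linear.continuous_on[OF assms(2)] by auto
next
  case (Suc k)
  show ?case
  proof (rule Ck_on_SucI[where g = "\<lambda>v x. h (pdiff v f x)", OF assms(1)])
    show "continuous_on U (\<lambda>x. h (f x))"
      by (rule bounded_linear.continuous_on[OF assms(2) Ck_on_continuous[OF Suc.prems]])
    show "has_pdiff v (\<lambda>x. h (f x)) x (h (pdiff v f x))" if "v \<in> V" "x \<in> U" for v x
      by (rule has_pdiff_linear[OF assms(2) Ck_on_has_pdiff[OF Suc.prems that]])
    show "Ck_on V k U (\<lambda>x. h (pdiff v f x))" if "v \<in> V" for v
      by (rule Suc.IH) (use Suc.prems that in auto)
  qed
qed

lemma Ck_on_bilinear:
  assumes "dir_open V U" "bounded_bilinear h"
  shows "Ck_on V k U f \<Longrightarrow> Ck_on V k U g \<Longrightarrow> Ck_on V k U (\<lambda>x. h (f x) (g x))"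
proof (induction k arbitrary: f g)
  case 0
  then show ?case using bounded_bilinear.continuous_on[OF assms(2)] by auto
next
  case (Suc k)
  show ?case
  proof (rule Ck_on_SucI[where g = "\<lambda>v x. h (f x) (pdiff v g x) + h (pdiff v f x) (g x)", OF assms(1)])
    show "continuous_on U (\<lambda>x. h (f x) (g x))"
      by (rule bounded_bilinear.continuous_on[OF assms(2)])
        (use Suc.prems Ck_on_continuous in blast)+
    show "has_pdiff v (\<lambda>x. h (f x) (g x)) x (h (f x) (pdiff v g x) + h (pdiff v f x) (g x))"
      if "v \<in> V" "x \<in> U" for v x
      by (rule has_pdiff_bilinear[OF assms(2) Ck_on_has_pdiff[OF Suc.prems(1) that]
            Ck_on_has_pdiff[OF Suc.prems(2) that]])
    show "Ck_on V k U (\<lambda>x. h (f x) (pdiff v g x) + h (pdiff v f x) (g x))" if "v \<in> V" for v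
      using Suc.prems that Ck_on_Suc_imp[OF Suc.prems(1)] Ck_on_Suc_imp[OF Suc.prems(2)]
      by (intro Ck_on_add assms(1) Suc.IH) auto
  qed
qed

lemma Ck_on_linear_fun:
  assumes "dir_open V U" "bounded_linear h"
  shows "Ck_on V k U h"
proof (cases k)
  case (Suc j)
  show ?thesis unfolding Suc
    by (rule Ck_on_SucI[where g = "\<lambda>v _. h v", OF assms(1)])
      (simp_all add: has_pdiff_linear_fun[OF assms(2)] Ck_on_const[OF assms(1)]
        linear_continuous_on[OF assms(2)])
qed (simp add: linear_continuous_on[OF assms(2)])

lemma Ck_on_diff:
  assumes "dir_open V U" "Ck_on V k U f" "Ck_on V k U g"
  shows "Ck_on V k U (\<lambda>x. f x - g x)"
  using Ck_on_add[OF assms(1,2) Ck_on_linear[OF assms(1) bounded_linear_minus[OF bounded_linear_ident] assms(3)]]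
  by simp

lemma Ck_on_sum:
  assumes "dir_open V U"
  shows "(\<And>i. i \<in> I \<Longrightarrow> Ck_on V k U (f i)) \<Longrightarrow> Ck_on V k U (\<lambda>x. \<Sum>i\<in>I. f i x)"
  by (induction I rule: infinite_finite_induct) (simp_all add: Ck_on_const[OF assms] Ck_on_add[OF assms])

text \<open>Continuity, existence of \<open>pdiff\<close> and its further regularity are local, and
  \<open>pdiff v f\<close> is one global function, so nothing has to be glued. This allows a
  different representation of \<open>f\<close> near each point.\<close>

lemma Ck_on_local:
  assumes "open U" "\<And>x. x \<in> U \<Longrightarrow> \<exists>W. open W \<and> x \<in> W \<and> Ck_on V k (W \<inter> U) f"
  shows "Ck_on V k U f"
  using assms(2)
proof (induction k arbitrary: f)
  case 0
  show ?case unfolding Ck_on.simps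
  proof (rule continuous_at_imp_continuous_on, rule ballI)
    fix x assume x: "x \<in> U"
    then obtain W where "open W" "x \<in> W" "continuous_on (W \<inter> U) f"
      using 0[OF x] by auto
    then show "isCont f x"
      using x assms(1) continuous_on_eq_continuous_at[of "W \<inter> U" f] by (simp add: open_Int)
  qed
next
  case (Suc k)
  have "Ck_on V 0 U f"
    unfolding Ck_on.simps
  proof (rule continuous_at_imp_continuous_on, rule ballI)
    fix x assume x: "x \<in> U"
    then obtain W where "open W" "x \<in> W" "continuous_on (W \<inter> U) f"
      using Suc.prems[OF x] by auto
    then show "isCont f x"
      using x assms(1) continuous_on_eq_continuous_at[of "W \<inter> U" f] by (simp add: open_Int)
  qed
  moreover have "has_pdiff v f x (pdiff v f x)" if xU: "x \<in> U" and v: "v \<in> V" for v x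
  proof -
    obtain W where "x \<in> W" "Ck_on V (Suc k) (W \<inter> U) f"
      using Suc.prems[OF xU] by (elim exE conjE) (rule that)
    then show ?thesis using Ck_on_has_pdiff[of V k "W \<inter> U" f v x] xU v by blast
  qed
  moreover have "Ck_on V k U (pdiff v f)" if v: "v \<in> V" for v
  proof (rule Suc.IH)
    fix x assume "x \<in> U"
    from Suc.prems[OF this] show "\<exists>W. open W \<and> x \<in> W \<and> Ck_on V k (W \<inter> U) (pdiff v f)"
      by (elim exE) (auto simp: v intro!: exI)
  qed
  ultimately show ?case unfolding Ck_on_Suc_iff by simp
qed

section \<open>Integrals depending on a parameter\<close>

text \<open>Restricting the parameter to a segment in direction \<open>v\<close> reduces the claim
  to the one-variable Leibniz rule on the open interval \<open>T\<close>.\<close>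

lemma has_pdiff_integral:
  fixes f :: "'a :: real_normed_vector \<Rightarrow> 'c :: euclidean_space \<Rightarrow> 'b :: banach"
  assumes U: "open U" "x \<in> U"
    and f: "\<And>y z. y \<in> U \<Longrightarrow> z \<in> cbox a b \<Longrightarrow> has_pdiff v (\<lambda>y. f y z) y (g y z)"
    and cf: "continuous_on (U \<times> cbox a b) (\<lambda>(y, z). f y z)"
    and cg: "continuous_on (U \<times> cbox a b) (\<lambda>(y, z). g y z)"
  shows "has_pdiff v (\<lambda>y. integral (cbox a b) (f y)) x (integral (cbox a b) (g x))"
proof -
  have "\<forall>\<^sub>F t in nhds 0. x + t *\<^sub>R v \<in> U"
    using dir_openD[OF open_dir_open[OF U(1)] U(2), of v UNIV] by simp
  then obtain e where e: "e > 0" "\<And>t. \<bar>t\<bar> < e \<Longrightarrow> x + t *\<^sub>R v \<in> U"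
    unfolding eventually_nhds_metric by (auto simp: dist_real_def)
  define T where "T = {-e<..<e}"
  have T: "open T" "0 \<in> T" "convex T" "\<And>t. t \<in> T \<Longrightarrow> x + t *\<^sub>R v \<in> U"
    using e by (auto simp: T_def)
  have c: "continuous_on (T \<times> cbox a b) (\<lambda>(t, z). h (x + t *\<^sub>R v) z)"
    if "continuous_on (U \<times> cbox a b) (\<lambda>(y, z). h y z)" for h :: "'a \<Rightarrow> 'c \<Rightarrow> 'b"
  proof -
    have "continuous_on (T \<times> cbox a b) (\<lambda>p. (x + fst p *\<^sub>R v, snd p))"
      by (intro continuous_intros)
    moreover have "(\<lambda>p. (x + fst p *\<^sub>R v, snd p)) ` (T \<times> cbox a b) \<subseteq> U \<times> cbox a b"
      using T(4) by auto
    ultimately show ?thesis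
      using continuous_on_compose2[OF that, of "T \<times> cbox a b" "\<lambda>p. (x + fst p *\<^sub>R v, snd p)"]
      by (simp add: split_beta)
  qed
  have "((\<lambda>t. integral (cbox a b) (f (x + t *\<^sub>R v))) has_vector_derivative
      integral (cbox a b) (g (x + 0 *\<^sub>R v))) (at 0 within T)"
  proof (rule leibniz_rule_vector_derivative[where f = "\<lambda>t. f (x + t *\<^sub>R v)"])
    show "((\<lambda>t. f (x + t *\<^sub>R v) z) has_vector_derivative g (x + t *\<^sub>R v) z) (at t within T)"
      if "t \<in> T" "z \<in> cbox a b" for t z
      using f[OF T(4)[OF that(1)] that(2)] has_pdiff_shift[of v "\<lambda>y. f y z" x t]
      by (auto intro: has_vector_derivative_at_within)
    show "f (x + t *\<^sub>R v) integrable_on cbox a b" if "t \<in> T" for t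
    proof (rule integrable_continuous)
      have "continuous_on (cbox a b) (\<lambda>z. (t, z))" by (intro continuous_intros)
      then show "continuous_on (cbox a b) (f (x + t *\<^sub>R v))"
        using continuous_on_compose2[OF c[OF cf], of "cbox a b" "\<lambda>z. (t, z)"] that by auto
    qed
  qed (rule c[OF cg] T)+
  then show ?thesis
    by (simp add: has_pdiff_def at_within_open[OF T(2,1)])
qed

text \<open>Differentiation changes the shape of the integrand, so the induction runs over a family:
  \<open>P k f\<close> collects the integrands with \<open>k\<close> derivatives left, and
  \<open>step\<close> says that differentiating leads from order \<open>Suc k\<close> to order
  \<open>k\<close>.\<close>

lemma Ck_on_integral:
  fixes f :: "'a :: real_normed_vector \<Rightarrow> 'c :: euclidean_space \<Rightarrow> 'b :: banach"
  assumes U: "open U" and "P k f"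
    and cont: "\<And>k f. P k f \<Longrightarrow> continuous_on (U \<times> cbox a b) (\<lambda>(y, z). f y z)"
    and step: "\<And>k f v. P (Suc k) f \<Longrightarrow> v \<in> V \<Longrightarrow>
      \<exists>g. P k g \<and> (\<forall>y\<in>U. \<forall>z\<in>cbox a b. has_pdiff v (\<lambda>y. f y z) y (g y z))"
  shows "Ck_on V k U (\<lambda>y. integral (cbox a b) (f y))"
  using assms(2)
proof (induction k arbitrary: f)
  case 0
  then show ?case using integral_continuous_on_param[OF cont] by simp
next
  case (Suc k)
  from step[OF Suc.prems] obtain g where g: "\<And>v. v \<in> V \<Longrightarrow> P k (g v)"
    "\<And>v y z. v \<in> V \<Longrightarrow> y \<in> U \<Longrightarrow> z \<in> cbox a b \<Longrightarrow> has_pdiff v (\<lambda>y. f y z) y (g v y z)"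
    by metis
  show ?case
  proof (rule Ck_on_SucI[where g = "\<lambda>v y. integral (cbox a b) (g v y)", OF open_dir_open[OF U]])
    show "continuous_on U (\<lambda>y. integral (cbox a b) (f y))"
      by (rule integral_continuous_on_param[OF cont[OF Suc.prems]])
    show "has_pdiff v (\<lambda>y. integral (cbox a b) (f y)) x (integral (cbox a b) (g v x))"
      if "v \<in> V" "x \<in> U" for v x
      by (rule has_pdiff_integral[OF U that(2) g(2)[OF that(1)] cont[OF Suc.prems] cont[OF g(1)[OF that(1)]]])
    show "Ck_on V k U (\<lambda>y. integral (cbox a b) (g v y))" if "v \<in> V" for v
      by (rule Suc.IH[OF g(1)[OF that]])
  qed
qed

text \<open>The increment of \<open>f\<close> in direction \<open>u\<close> is an integral of
  \<open>pdiff u f\<close>. Differentiating it in direction \<open>v\<close> under the integral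
  sign, and then in the upper limit at \<open>0\<close>, produces both orders of
  differentiation.\<close>

lemma pdiff_commute:
  fixes f :: "'a :: real_normed_vector \<Rightarrow> 'b :: banach"
  assumes U: "open U" "x \<in> U" and f: "Ck_on V 2 U f" and uv: "u \<in> V" "v \<in> V"
  shows "pdiff u (pdiff v f) x = pdiff v (pdiff u f) x"
proof -
  have f1: "Ck_on V (Suc (Suc 0)) U f" using f by (simp only: numeral_2_eq_2)
  note du = Ck_on_has_pdiff[OF f1 uv(1)] and dv = Ck_on_has_pdiff[OF f1 uv(2)]
  have Cu: "Ck_on V (Suc 0) U (pdiff u f)" and Cv: "Ck_on V (Suc 0) U (pdiff v f)"
    using f1 uv by simp_all
  note dvu = Ck_on_has_pdiff[OF Cu uv(2)] and duv = Ck_on_has_pdiff[OF Cv uv(1)]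
  have cu: "continuous_on U (pdiff u f)" using Ck_on_continuous[OF Cu] .
  have cvu: "continuous_on U (pdiff v (pdiff u f))" using Cu uv by simp
  \<comment> \<open>One \<open>e\<close> has to serve both parameters; it comes from the
    neighbourhoods of the origin in the parameter plane.\<close>
  obtain e where e: "e > 0" "\<And>s t. \<bar>s\<bar> < e \<Longrightarrow> \<bar>t\<bar> < e \<Longrightarrow> x + s *\<^sub>R u + t *\<^sub>R v \<in> U"
  proof -
    have "((\<lambda>p. x + fst p *\<^sub>R u + snd p *\<^sub>R v) \<longlongrightarrow> x + fst (0::real \<times> real) *\<^sub>R u + snd (0::real \<times> real) *\<^sub>R v) (nhds 0)"
      by (intro tendsto_intros) (auto simp: filterlim_ident)
    then have "\<forall>\<^sub>F p in nhds (0 :: real \<times> real). x + fst p *\<^sub>R u + snd p *\<^sub>R v \<in> U"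
      using U by (intro topological_tendstoD) auto
    then obtain S T where ST: "\<forall>\<^sub>F s in nhds 0. S s" "\<forall>\<^sub>F t in nhds 0. T t"
      "\<And>s t. S s \<Longrightarrow> T t \<Longrightarrow> x + s *\<^sub>R u + t *\<^sub>R v \<in> U"
      unfolding zero_prod_def nhds_prod eventually_prod_filter by auto
    obtain d1 where d1: "d1 > 0" "\<And>s. \<bar>s\<bar> < d1 \<Longrightarrow> S s"
      using ST(1) unfolding eventually_nhds_metric by (auto simp: dist_real_def)
    obtain d2 where d2: "d2 > 0" "\<And>s. \<bar>s\<bar> < d2 \<Longrightarrow> T s"
      using ST(2) unfolding eventually_nhds_metric by (auto simp: dist_real_def)
    show ?thesis
      by (rule that[of "min d1 d2"]) (use d1 d2 ST(3) in auto)
  qed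
  define T where "T = {-e<..<e}"
  have T: "open T" "convex T" "0 \<in> T" using e by (auto simp: T_def)
  have inU: "x + s *\<^sub>R u + t *\<^sub>R v \<in> U" if "s \<in> T" "t \<in> T" for s t
    using e that by (auto simp: T_def)
  have inU': "x + t *\<^sub>R v + s *\<^sub>R u \<in> U" if "s \<in> T" "t \<in> T" for s t
    using inU[OF that] by (simp add: algebra_simps)
  \<comment> \<open>Halving makes the closed interval \<open>{0..d}\<close> fit into the open
    interval \<open>T\<close>.\<close>
  define d where "d = e / 2"
  have d: "0 < d" "{0..d} \<subseteq> T" using e by (auto simp: d_def T_def)
  define I where "I = (\<lambda>s t. integral (cbox 0 s) (\<lambda>\<sigma>. pdiff u f (x + t *\<^sub>R v + \<sigma> *\<^sub>R u)))"
  have ftc: "f (x + t *\<^sub>R v + s *\<^sub>R u) - f (x + t *\<^sub>R v) = I s t" if "s \<in> {0..d}" "t \<in> T" for s t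
  proof -
    have "((\<lambda>\<sigma>. pdiff u f (x + t *\<^sub>R v + \<sigma> *\<^sub>R u)) has_integral
        f (x + t *\<^sub>R v + s *\<^sub>R u) - f (x + t *\<^sub>R v + 0 *\<^sub>R u)) {0..s}"
    proof (rule fundamental_theorem_of_calculus)
      show "((\<lambda>\<sigma>. f (x + t *\<^sub>R v + \<sigma> *\<^sub>R u)) has_vector_derivative
        pdiff u f (x + t *\<^sub>R v + \<sigma> *\<^sub>R u)) (at \<sigma> within {0..s})" if \<sigma>: "\<sigma> \<in> {0..s}" for \<sigma>
      proof -
        have "\<sigma> \<in> {0..d}" using \<sigma> \<open>s \<in> {0..d}\<close> by simp
        then have "\<sigma> \<in> T" using d(2) by blast
        from du[OF inU'[OF this \<open>t \<in> T\<close>]] show ?thesis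
          unfolding has_pdiff_shift by (rule has_vector_derivative_at_within)
      qed
    qed (use that in auto)
    then show ?thesis by (simp add: I_def integral_unique)
  qed
  have key: "pdiff v f (x + s *\<^sub>R u) - pdiff v f x =
      integral (cbox 0 s) (\<lambda>\<sigma>. pdiff v (pdiff u f) (x + \<sigma> *\<^sub>R u))" if s: "s \<in> {0..d}" for s
  proof -
    have sT: "s \<in> T" and \<sigma>T: "\<And>\<sigma>. \<sigma> \<in> cbox 0 s \<Longrightarrow> \<sigma> \<in> T" using s d by auto
    have c: "continuous_on (T \<times> cbox 0 s) (\<lambda>(t, \<sigma>). h (x + t *\<^sub>R v + \<sigma> *\<^sub>R u))"
      if "continuous_on U h" for h :: "'a \<Rightarrow> 'b"
    proof -
      have "continuous_on (T \<times> cbox 0 s) (\<lambda>p. x + fst p *\<^sub>R v + snd p *\<^sub>R u)"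
        by (intro continuous_intros)
      moreover have "(\<lambda>p. x + fst p *\<^sub>R v + snd p *\<^sub>R u) ` (T \<times> cbox 0 s) \<subseteq> U"
        using inU' \<sigma>T by auto
      ultimately show ?thesis
        using continuous_on_compose2[OF that, of "T \<times> cbox 0 s" "\<lambda>p. x + fst p *\<^sub>R v + snd p *\<^sub>R u"]
        by (simp add: split_beta)
    qed
    have "has_pdiff 1 (I s) 0 (integral (cbox 0 s) (\<lambda>\<sigma>. pdiff v (pdiff u f) (x + 0 *\<^sub>R v + \<sigma> *\<^sub>R u)))"
      unfolding I_def
    proof (rule has_pdiff_integral[OF T(1,3)])
      show "has_pdiff 1 (\<lambda>y. pdiff u f (x + y *\<^sub>R v + z *\<^sub>R u)) y (pdiff v (pdiff u f) (x + y *\<^sub>R v + z *\<^sub>R u))"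
        if "y \<in> T" "z \<in> cbox 0 s" for y z
        using dvu[OF inU'[OF \<sigma>T[OF that(2)] that(1)]]
        by (simp add: has_pdiff_def algebra_simps)
    qed (use c cu cvu in auto)
    moreover have "has_pdiff 1 (I s) 0 (pdiff v f (x + s *\<^sub>R u) - pdiff v f x)"
    proof (rule has_pdiff_cong[OF _ open_dir_open[OF T(1)] UNIV_I T(3) ftc[OF s]])
      show "has_pdiff 1 (\<lambda>t. f (x + t *\<^sub>R v + s *\<^sub>R u) - f (x + t *\<^sub>R v)) 0
        (pdiff v f (x + s *\<^sub>R u) - pdiff v f x)"
        using dv[OF inU[OF sT T(3)]] dv[OF U(2)]
        by (intro has_pdiff_diff) (simp_all add: has_pdiff_def algebra_simps)
    qed
    ultimately show ?thesis
      using has_pdiff_unique[of 1 "I s" 0] by simp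
  qed
  \<comment> \<open>The integral formula \<open>key\<close> is available only for nonnegative
    \<open>s\<close>, so both derivatives at \<open>0\<close> are taken within
    \<open>{0..d}\<close>, where a derivative is still unique.\<close>
  have "((\<lambda>s. pdiff v f (x + s *\<^sub>R u) - pdiff v f x) has_vector_derivative pdiff u (pdiff v f) x - 0)
      (at 0 within {0..d})"
    by (rule has_vector_derivative_at_within, rule has_vector_derivative_diff
        [OF duv[OF U(2), unfolded has_pdiff_def] has_vector_derivative_const])
  moreover have "((\<lambda>s. pdiff v f (x + s *\<^sub>R u) - pdiff v f x) has_vector_derivative pdiff v (pdiff u f) x)
      (at 0 within {0..d})"
  proof (rule has_vector_derivative_transform)
    show "((\<lambda>s. integral {0..s} (\<lambda>\<sigma>. pdiff v (pdiff u f) (x + \<sigma> *\<^sub>R u))) has_vector_derivative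
      pdiff v (pdiff u f) x) (at 0 within {0..d})"
    proof -
      have "continuous_on {0..d} (\<lambda>\<sigma>. pdiff v (pdiff u f) (x + \<sigma> *\<^sub>R u))"
        using inU[OF _ T(3)] d
        by (intro continuous_on_compose2[OF cvu] continuous_intros) auto
      from integral_has_vector_derivative[OF this, of 0] d show ?thesis by simp
    qed
  qed (use key d in auto)
  ultimately show ?thesis
    using vector_derivative_unique_within_closed_interval[of 0 d 0] d by simp
qed

section \<open>Integration by parts\<close>

text \<open>Small translations in direction \<open>v\<close> keep the support inside the box and so
  leave the integral of \<open>g\<close> unchanged; differentiating this constant under the integral
  sign gives the integral of \<open>g'\<close>. The gap between \<open>r\<close> and
  \<open>r'\<close> is the room for translating.\<close>

lemma integral_pdiff_eq_0:
  fixes g :: "'a :: euclidean_space \<Rightarrow> 'b :: banach"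
  assumes g: "\<And>z. has_pdiff v g z (g' z)" and c: "continuous_on UNIV g" "continuous_on UNIV g'"
    and supp: "\<And>z. z \<notin> cball x r \<Longrightarrow> g z = 0" and r: "r < r'" "cball x r' \<subseteq> cbox a b"
  shows "integral (cbox a b) g' = 0"
proof -
  have int: "g integrable_on cbox c d" for c d
    by (rule integrable_continuous) (rule continuous_on_subset[OF c(1)], simp)
  have U: "(g has_integral integral (cbox a b) g) UNIV"
    by (rule has_integral_on_superset[OF integrable_integral[OF int]]) (use supp r in force)+
  have eq: "integral (cbox a b) (\<lambda>z. g (z + w)) = integral (cbox a b) g" if w: "norm w < r' - r" for w
  proof -
    have out: "g z = 0" if "z \<notin> cbox (a + w) (b + w)" for z
    proof (rule supp, rule notI)
      assume "z \<in> cball x r"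
      then have "dist x (z - w) \<le> r'"
        using w norm_triangle_ineq[of "x - z" w] by (auto simp: dist_norm algebra_simps)
      then have "z - w \<in> cbox a b" using r by auto
      then have "z \<in> cbox (a + w) (b + w)" by (simp add: mem_box inner_simps algebra_simps)
      with that show False by blast
    qed
    have "(\<lambda>z. if z \<in> cbox (a + w) (b + w) then g z else 0) = g" using out by auto
    then have "((\<lambda>z. if z \<in> cbox (a + w) (b + w) then g z else 0) has_integral integral (cbox a b) g) UNIV"
      using U by simp
    then have "(g has_integral integral (cbox a b) g) (cbox (a + w) (b + w))"
      by (simp only: has_integral_restrict_UNIV)
    then show ?thesis
      using integral_shift_cbox_plus[of a b g w] by (simp add: integral_unique o_def add.commute)
  qed
  have "has_pdiff 1 (\<lambda>t. integral (cbox a b) (\<lambda>z. g (z + t *\<^sub>R v))) 0 (integral (cbox a b) (\<lambda>z. g' (z + 0 *\<^sub>R v)))"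
  proof (rule has_pdiff_integral[OF open_UNIV UNIV_I])
    show "has_pdiff 1 (\<lambda>y. g (z + y *\<^sub>R v)) y (g' (z + y *\<^sub>R v))" for y z
      using g[of "z + y *\<^sub>R v"] by (simp add: has_pdiff_def algebra_simps)
  qed (auto simp: split_beta intro!: continuous_on_compose2[OF c(1)] continuous_on_compose2[OF c(2)] continuous_intros)
  moreover have "has_pdiff 1 (\<lambda>t. integral (cbox a b) (\<lambda>z. g (z + t *\<^sub>R v))) 0 0"
  proof (rule has_pdiff_transform[OF has_pdiff_const])
    have "((\<lambda>t. norm (t *\<^sub>R v)) \<longlongrightarrow> norm (0 *\<^sub>R v)) (nhds 0)"
      by (intro tendsto_intros) (simp add: filterlim_ident)
    then have "\<forall>\<^sub>F t in nhds 0. norm (t *\<^sub>R v) < r' - r"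
      by (rule order_tendstoD) (use r in simp)
    then show "\<forall>\<^sub>F t in nhds 0. integral (cbox a b) g = integral (cbox a b) (\<lambda>z. g (z + (0 + t *\<^sub>R 1) *\<^sub>R v))"
      by eventually_elim (simp add: eq)
  qed
  ultimately show ?thesis
    using has_pdiff_unique by force
qed

text \<open>The product of \<open>\<phi>\<close> and \<open>F\<close> is differentiable on the whole
  space although \<open>F\<close> is controlled only on \<open>U\<close>, because
  \<open>\<phi>\<close> vanishes off a closed ball inside \<open>U\<close>. Then
  \<open>integral_pdiff_eq_0\<close> applies to the product rule.\<close>

lemma integral_by_parts_pdiff:
  fixes F :: "'a :: euclidean_space \<Rightarrow> 'b :: banach" and \<phi> :: "'a \<Rightarrow> real"
  assumes U: "open U" "cbox a b \<subseteq> U"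
    and F: "continuous_on U F" "continuous_on U F'" "\<And>z. z \<in> U \<Longrightarrow> has_pdiff v F z (F' z)"
    and \<phi>: "continuous_on UNIV \<phi>" "continuous_on UNIV \<phi>'" "\<And>z. has_pdiff v \<phi> z (\<phi>' z)"
    and supp: "\<And>z. z \<notin> cball x r \<Longrightarrow> \<phi> z = 0" "\<And>z. z \<notin> cball x r \<Longrightarrow> \<phi>' z = 0"
    and r: "r < r'" "cball x r' \<subseteq> cbox a b"
  shows "integral (cbox a b) (\<lambda>z. \<phi>' z *\<^sub>R F z) = - integral (cbox a b) (\<lambda>z. \<phi> z *\<^sub>R F' z)"
proof -
  define g g' where "g = (\<lambda>z. \<phi> z *\<^sub>R F z)" and "g' = (\<lambda>z. \<phi> z *\<^sub>R F' z + \<phi>' z *\<^sub>R F z)"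
  have sub: "cball x r \<subseteq> U" using r U by force
  \<comment> \<open>Two open sets cover the space: on \<open>U\<close> the product rule holds, and
    off the closed ball everything vanishes.\<close>
  have Un: "UNIV = U \<union> - cball x r" using sub by blast
  have cg: "continuous_on (U \<union> - cball x r) h"
    if "continuous_on U h" "\<And>z. z \<notin> cball x r \<Longrightarrow> h z = 0" for h :: "'a \<Rightarrow> 'b"
  proof (rule continuous_on_open_Un[OF U(1)])
    show "continuous_on (- cball x r) h"
      using that(2) by (intro continuous_on_eq[OF continuous_on_const[of _ 0]]) auto
  qed (use that in auto)
  have \<phi>U: "continuous_on U \<phi>" "continuous_on U \<phi>'" using \<phi> continuous_on_subset by blast+
  have "integral (cbox a b) g' = 0"
  proof (rule integral_pdiff_eq_0[OF _ _ _ _ r])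
    show "continuous_on UNIV g" "continuous_on UNIV g'"
      unfolding Un g_def g'_def
      by (rule cg; use F \<phi>U supp in \<open>auto intro!: continuous_on_add continuous_on_scaleR\<close>)+
    show "has_pdiff v g z (g' z)" for z
    proof (cases "z \<in> U")
      case True
      show ?thesis unfolding g_def g'_def
        using has_pdiff_bilinear[OF bounded_bilinear_scaleR \<phi>(3) F(3)[OF True]] .
    next
      case False
      then have z: "z \<in> - cball x r" using sub by blast
      have "has_pdiff v g z 0"
        by (rule has_pdiff_cong[OF has_pdiff_const open_dir_open[of "- cball x r"] UNIV_I z])
          (use supp in \<open>auto simp: g_def\<close>)
      then show ?thesis using z supp by (simp add: g'_def)
    qed
    show "g z = 0" if "z \<notin> cball x r" for z using supp that by (simp add: g_def)
  qed
  moreover have "(\<lambda>z. \<phi> z *\<^sub>R F' z) integrable_on cbox a b" "(\<lambda>z. \<phi>' z *\<^sub>R F z) integrable_on cbox a b"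
    using U \<phi>U F
    by (auto intro!: integrable_continuous continuous_on_scaleR intro: continuous_on_subset)
  ultimately show ?thesis
    unfolding g'_def by (simp add: integral_add eq_neg_iff_add_eq_0 add.commute)
qed

section \<open>Truncated powers of the squared norm\<close>

text \<open>The truncation stands inside the power: positive exponents give zero for
  \<open>s \<le> 0\<close>, but exponent \<open>0\<close> gives the constant
  \<open>1\<close>.\<close>

definition ppow :: "nat \<Rightarrow> real \<Rightarrow> real" where
  "ppow n s = max 0 s ^ n"

text \<open>For positive \<open>n\<close> and \<open>l\<close>, the parameter \<open>l\<close> is
  the squared radius of the support. It enters linearly, so differentiating in \<open>l\<close>
  lowers the exponent just as differentiating in \<open>z\<close> does.\<close>

definition kr :: "nat \<Rightarrow> real \<Rightarrow> 'a :: euclidean_space \<Rightarrow> real" where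
  "kr n l z = ppow n (l - (norm z)\<^sup>2)"

text \<open>Away from \<open>0\<close> the function is a power or identically zero. At the corner
  the difference quotient is bounded by \<open>\<bar>h\<bar> ^ (n + 1)\<close>, which tends to
  \<open>0\<close> because the exponent is positive.\<close>

lemma ppow_deriv: "(ppow (n + 2) has_real_derivative real (n + 2) * ppow (n + 1) s) (at s)"
proof -
  consider "s > 0" | "s < 0" | "s = 0" by linarith
  then show ?thesis
  proof cases
    case 1
    have "((\<lambda>s. s ^ (n + 2)) has_real_derivative real (n + 2) * s ^ (n + 1)) (at s)"
      using DERIV_pow[of "n + 2" s] by simp
    then have "(ppow (n + 2) has_real_derivative real (n + 2) * s ^ (n + 1)) (at s)"
      by (rule has_field_derivative_transform_within_open[where S = "{0<..}"])
        (use 1 in \<open>auto simp: ppow_def\<close>)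
    then show ?thesis using 1 by (simp add: ppow_def)
  next
    case 2
    have "((\<lambda>s. 0) has_real_derivative 0) (at s)" by simp
    then have "(ppow (n + 2) has_real_derivative 0) (at s)"
      by (rule has_field_derivative_transform_within_open[where S = "{..<0}"])
        (use 2 in \<open>auto simp: ppow_def\<close>)
    then show ?thesis using 2 by (simp add: ppow_def)
  next
    case 3
    have "((\<lambda>h. (ppow (n + 2) (0 + h) - ppow (n + 2) 0) / h) \<longlongrightarrow> 0) (at 0)"
    proof (rule Lim_null_comparison)
      show "\<forall>\<^sub>F h in at 0. norm ((ppow (n + 2) (0 + h) - ppow (n + 2) 0) / h) \<le> \<bar>h\<bar> ^ (n + 1)"
      proof (rule always_eventually, rule allI)
        fix h :: real
        show "norm ((ppow (n + 2) (0 + h) - ppow (n + 2) 0) / h) \<le> \<bar>h\<bar> ^ (n + 1)"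
        proof (cases "h > 0")
          case False
          then have "(ppow (n + 2) (0 + h) - ppow (n + 2) 0) / h = 0" by (simp add: ppow_def max_def)
          then show ?thesis by (simp only: norm_zero zero_le_power abs_ge_zero)
        qed (simp add: ppow_def max_def)
      qed
      have "((\<lambda>h::real. \<bar>h\<bar> ^ (n + 1)) \<longlongrightarrow> \<bar>0\<bar> ^ (n + 1)) (at 0)"
        by (intro tendsto_intros)
      then show "((\<lambda>h::real. \<bar>h\<bar> ^ (n + 1)) \<longlongrightarrow> 0) (at 0)" by simp
    qed
    then show ?thesis using 3 by (simp add: DERIV_def ppow_def)
  qed
qed

lemma continuous_on_kr [continuous_intros]:
  assumes "continuous_on S f" "continuous_on S g"
  shows "continuous_on S (\<lambda>x. kr n (f x) (g x))"
  unfolding kr_def ppow_def by (intro continuous_intros assms)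

lemma kr_nonneg: "kr n l z \<ge> 0"
  by (simp add: kr_def ppow_def)

lemma kr_minus: "kr n l (- z) = kr n l z"
  by (simp add: kr_def)

lemma kr_support: "0 < n \<Longrightarrow> l \<le> r\<^sup>2 \<Longrightarrow> 0 \<le> r \<Longrightarrow> norm z \<ge> r \<Longrightarrow> kr n l z = 0"
  unfolding kr_def ppow_def
  by (smt (verit) max_absorb1 power_mono zero_power)

text \<open>Writing the squared norm as \<open>l\<close> minus the base of the power trades the
  factor for a higher exponent; this later removes it from the Laplacian of the kernel. The exponent
  must be positive for this where the base is negative.\<close>

lemma kr_Suc: "(norm z)\<^sup>2 * kr (n + 1) l z = l * kr (n + 1) l z - kr (n + 2) l z"
proof -
  have "max 0 s * max 0 s ^ (n + 1) = s * max 0 s ^ (n + 1)" for s :: real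
    by (cases "s \<ge> 0") (auto simp: max_def)
  from this[of "l - (norm z)\<^sup>2"] show ?thesis
    by (simp add: kr_def ppow_def algebra_simps)
qed

lemma has_pdiff_kr:
  "has_pdiff v (kr (n + 2) l) z (- 2 * real (n + 2) * (z \<bullet> v) * kr (n + 1) l z)"
proof -
  have "((\<lambda>t. l - (norm (z + t *\<^sub>R v))\<^sup>2) has_real_derivative - 2 * (z \<bullet> v)) (at 0)"
    unfolding power2_norm_eq_inner inner_add_left inner_add_right inner_scaleR_left inner_scaleR_right
    by (auto intro!: derivative_eq_intros simp: inner_commute)
  from DERIV_chain2[OF ppow_deriv this]
  show ?thesis
    unfolding has_pdiff_def kr_def has_real_derivative_iff_has_vector_derivative
    by (simp add: algebra_simps)
qed

lemma kr_deriv: "((\<lambda>l. kr (n + 2) l z) has_real_derivative real (n + 2) * kr (n + 1) l z) (at l)"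
proof -
  have "((\<lambda>l. l - (norm z)\<^sup>2) has_real_derivative 1) (at l)"
    by (auto intro!: derivative_eq_intros)
  from DERIV_chain2[OF ppow_deriv this]
  show ?thesis unfolding kr_def by simp
qed

text \<open>Each differentiation lowers the exponent by one and contributes a linear factor, so
  \<open>k\<close> derivatives leave a positive exponent.\<close>

lemma Ck_on_kr: "Ck_on V k UNIV (kr (k + 1 + j) l :: 'a :: euclidean_space \<Rightarrow> real)"
proof (induction k arbitrary: j)
  case 0
  have "continuous_on UNIV (\<lambda>x::'a. kr (0 + 1 + j) l x)" by (intro continuous_intros)
  then show ?case by simp
next
  case (Suc k)
  have D: "dir_open V (UNIV :: 'a set)" by (rule open_dir_open) simp
  show ?case
  proof (rule Ck_on_SucI[OF D])
    show "continuous_on UNIV (kr (Suc k + 1 + j) l :: 'a \<Rightarrow> real)"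
      using continuous_on_kr[OF continuous_on_const continuous_on_id] by blast
    show "has_pdiff v (kr (Suc k + 1 + j) l) x ((- 2 * real (k + j + 2) * (x \<bullet> v)) * kr (k + 1 + j) l x)"
      for v x :: 'a
      using has_pdiff_kr[of v "k + j" l x] by (simp add: algebra_simps)
    show "Ck_on V k UNIV (\<lambda>x. (- 2 * real (k + j + 2) * (x \<bullet> v)) * kr (k + 1 + j) l x)" for v
      by (intro Ck_on_bilinear[OF D bounded_bilinear_mult] Suc.IH Ck_on_linear_fun[OF D]
          bounded_linear_intros)
  qed
qed

text \<open>All derivatives fall on the kernel, so continuity of \<open>F\<close> suffices. The
  integrands of the form kernel at \<open>x - z\<close> times \<open>F z\<close> are the family
  closed under differentiation that \<open>Ck_on_integral\<close> asks for.\<close>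

lemma Ck_on_convolution:
  fixes F :: "'a :: euclidean_space \<Rightarrow> 'b :: banach" and \<kappa> :: "'a \<Rightarrow> real"
  assumes F: "continuous_on (cbox a b) F" and \<kappa>: "Ck_on V k UNIV \<kappa>"
  shows "Ck_on V k UNIV (\<lambda>x. integral (cbox a b) (\<lambda>z. \<kappa> (x - z) *\<^sub>R F z))"
proof (rule Ck_on_integral[where P = "\<lambda>k f. \<exists>\<kappa>. Ck_on V k UNIV \<kappa> \<and> f = (\<lambda>x z. \<kappa> (x - z) *\<^sub>R F z)"])
  fix k and f :: "'a \<Rightarrow> 'a \<Rightarrow> 'b"
  assume "\<exists>\<kappa>. Ck_on V k UNIV \<kappa> \<and> f = (\<lambda>x z. \<kappa> (x - z) *\<^sub>R F z)"
  then obtain \<kappa> where \<kappa>: "Ck_on V k UNIV \<kappa>" and f: "f = (\<lambda>x z. \<kappa> (x - z) *\<^sub>R F z)" by blast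
  have "continuous_on (UNIV \<times> cbox a b) (\<lambda>p. \<kappa> (fst p - snd p))"
    by (rule continuous_on_compose2[OF Ck_on_continuous[OF \<kappa>]]) (intro continuous_intros, simp)
  moreover have "continuous_on (UNIV \<times> cbox a b) (\<lambda>p. F (snd p))"
    by (rule continuous_on_compose2[OF F]) (intro continuous_intros, auto)
  ultimately show "continuous_on (UNIV \<times> cbox a b) (\<lambda>(y, z). f y z)"
    unfolding f split_beta by (rule continuous_on_scaleR)
next
  fix k and f :: "'a \<Rightarrow> 'a \<Rightarrow> 'b" and v
  assume "\<exists>\<kappa>. Ck_on V (Suc k) UNIV \<kappa> \<and> f = (\<lambda>x z. \<kappa> (x - z) *\<^sub>R F z)" and v: "v \<in> V"
  then obtain \<kappa> where \<kappa>: "Ck_on V (Suc k) UNIV \<kappa>" and f: "f = (\<lambda>x z. \<kappa> (x - z) *\<^sub>R F z)" by blast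
  have "has_pdiff v (\<lambda>y. f y z) y (pdiff v \<kappa> (y - z) *\<^sub>R F z)" for y z
  proof -
    have "has_pdiff v (\<lambda>y. \<kappa> (y - z)) y (pdiff v \<kappa> (y - z))"
      using Ck_on_has_pdiff[OF \<kappa> v, of "y - z"] by (simp add: has_pdiff_def algebra_simps)
    from has_pdiff_linear[OF bounded_linear_scaleR_left this]
    show ?thesis by (simp add: f)
  qed
  moreover have "Ck_on V k UNIV (pdiff v \<kappa>)" using \<kappa> v by simp
  ultimately show "\<exists>g. (\<exists>\<kappa>. Ck_on V k UNIV \<kappa> \<and> g = (\<lambda>x z. \<kappa> (x - z) *\<^sub>R F z)) \<and>
    (\<forall>y\<in>UNIV. \<forall>z\<in>cbox a b. has_pdiff v (\<lambda>y. f y z) y (g y z))"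
    by (intro exI[of _ "\<lambda>x z. pdiff v \<kappa> (x - z) *\<^sub>R F z"]) blast
qed (use \<kappa> in auto)

section \<open>The mean value property\<close>

text \<open>The first and second partial derivatives of \<open>kr (n + 3) l\<close>.\<close>

definition kr_grad :: "nat \<Rightarrow> real \<Rightarrow> 'a :: euclidean_space \<Rightarrow> 'a \<Rightarrow> real" where
  "kr_grad n l c z = - 2 * real (n + 3) * (z \<bullet> c) * kr (n + 2) l z"

definition kr_hess :: "nat \<Rightarrow> real \<Rightarrow> 'a :: euclidean_space \<Rightarrow> 'a \<Rightarrow> 'a \<Rightarrow> real" where
  "kr_hess n l b c z = 4 * real (n + 3) * real (n + 2) * (z \<bullet> b) * (z \<bullet> c) * kr (n + 1) l z
    - 2 * real (n + 3) * (b \<bullet> c) * kr (n + 2) l z"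

lemma has_pdiff_kr_grad: "has_pdiff b (kr_grad n l c) z (kr_hess n l b c z)"
proof -
  have "has_pdiff b (\<lambda>z. - 2 * real (n + 3) * (z \<bullet> c)) z (- 2 * real (n + 3) * (b \<bullet> c))"
    by (rule has_pdiff_linear_fun) (intro bounded_linear_intros)
  from has_pdiff_bilinear[OF bounded_bilinear_mult this has_pdiff_kr[of b n l z]]
  show ?thesis unfolding kr_grad_def kr_hess_def by (simp add: algebra_simps)
qed

lemma kr_hess_commute: "kr_hess n l b c z = kr_hess n l c b z"
  by (simp add: kr_hess_def inner_commute mult_ac)

lemma continuous_on_kr_grad [continuous_intros]:
  assumes "continuous_on S f" shows "continuous_on S (\<lambda>x. kr_grad n l c (f x))"
  unfolding kr_grad_def by (intro continuous_intros assms)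

lemma continuous_on_kr_hess [continuous_intros]:
  assumes "continuous_on S f" shows "continuous_on S (\<lambda>x. kr_hess n l b c (f x))"
  unfolding kr_hess_def by (intro continuous_intros assms)

lemma kr_support':
  assumes "0 < l" "z \<notin> cball x (sqrt l)"
  shows "kr (n + 1) l (z - x) = 0" "kr_grad n l c (z - x) = 0" "kr_hess n l b c (z - x) = 0"
proof -
  have "kr (n + 1) l (z - x) = 0" for n
    by (rule kr_support[of _ _ "sqrt l"]) (use assms in \<open>auto simp: dist_norm norm_minus_commute\<close>)
  from this[of n] this[of "Suc n"]
  show "kr (n + 1) l (z - x) = 0" "kr_grad n l c (z - x) = 0" "kr_hess n l b c (z - x) = 0"
    by (simp_all add: kr_grad_def kr_hess_def)
qed

text \<open>The squared coordinates add up to the squared norm, which \<open>kr_Suc\<close> absorbs.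
  What remains has the exponents \<open>n + 2\<close> and \<open>n + 1\<close>, those of the
  integral in \<open>kr_integral_ode\<close> and of its derivative in \<open>l\<close>.\<close>

lemma kr_laplacian:
  "(\<Sum>b\<in>Basis. kr_hess n l b b (z :: 'a :: euclidean_space)) =
    real (n + 3) * (4 * real (n + 2) * l * kr (n + 1) l z - (4 * real (n + 2) + 2 * real DIM('a)) * kr (n + 2) l z)"
proof -
  have "(\<Sum>b\<in>Basis. kr_hess n l b b z) =
     4 * real (n + 3) * real (n + 2) * (\<Sum>b\<in>Basis. (z \<bullet> b) * (z \<bullet> b)) * kr (n + 1) l z
     - 2 * real (n + 3) * real DIM('a) * kr (n + 2) l z"
    unfolding kr_hess_def sum_subtractf
    by (simp add: sum_distrib_left sum_distrib_right mult_ac)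
  also have "(\<Sum>b\<in>Basis. (z \<bullet> b) * (z \<bullet> b)) = (norm z)\<^sup>2"
    by (simp only: power2_norm_eq_inner euclidean_inner[of z z])
  also have "4 * real (n + 3) * real (n + 2) * (norm z)\<^sup>2 * kr (n + 1) l z =
      4 * real (n + 3) * real (n + 2) * ((norm z)\<^sup>2 * kr (n + 1) l z)" by (simp only: mult_ac)
  finally show ?thesis unfolding kr_Suc by (simp add: algebra_simps)
qed

lemma has_pdiff_1_iff: "has_pdiff 1 h l d \<longleftrightarrow> (h has_vector_derivative d) (at l)"
  using has_pdiff_shift[of 1 h 0 l] by simp

text \<open>The Hessian kernel is a derivative of the gradient kernel. Only one derivative is moved,
  because \<open>F\<close> is only once differentiable.\<close>

lemma integral_hess_by_parts:
  fixes F :: "'a :: euclidean_space \<Rightarrow> 'b :: banach"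
  assumes U: "open U" "cbox a b \<subseteq> U"
    and F: "continuous_on U F" "continuous_on U F'" "\<And>z. z \<in> U \<Longrightarrow> has_pdiff u F z (F' z)"
    and r: "cball x r \<subseteq> cbox a b" "0 < l" "l < r\<^sup>2" "0 < r"
  shows "integral (cbox a b) (\<lambda>z. kr_hess n l u c (z - x) *\<^sub>R F z) =
    - integral (cbox a b) (\<lambda>z. kr_grad n l c (z - x) *\<^sub>R F' z)"
proof (rule integral_by_parts_pdiff[OF U F, where r = "sqrt l" and r' = r])
  show "has_pdiff u (\<lambda>z. kr_grad n l c (z - x)) z (kr_hess n l u c (z - x))" for z
    using has_pdiff_kr_grad[of u n l c "z - x"] by (simp add: has_pdiff_def algebra_simps)
  show "sqrt l < r" using r real_less_lsqrt by (simp add: real_sqrt_less_iff)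
qed (use r kr_support'[OF r(2)] in \<open>auto intro!: continuous_intros\<close>)

text \<open>Differentiating in \<open>l\<close> under the integral sign lowers the exponent to
  \<open>n + 1\<close>; the vanishing integral against the Laplacian of the kernel relates
  \<open>l\<close> times that integral to the one with exponent \<open>n + 2\<close>.\<close>

lemma kr_integral_ode:
  fixes F :: "'a :: euclidean_space \<Rightarrow> 'b :: banach"
  assumes F: "continuous_on (cbox a b) F"
    and weak: "(\<Sum>u\<in>Basis. integral (cbox a b) (\<lambda>z. kr_hess n l u u (z - x) *\<^sub>R F z)) = 0"
  defines "g \<equiv> (\<lambda>l. integral (cbox a b) (\<lambda>z. kr (n + 2) l (z - x) *\<^sub>R F z))"
  obtains g' where "(g has_vector_derivative g') (at l)"
    "(2 * l) *\<^sub>R g' = (2 * real (n + 2) + real DIM('a)) *\<^sub>R g l"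
proof
  let ?I = "\<lambda>n. integral (cbox a b) (\<lambda>z. kr n l (z - x) *\<^sub>R F z)"
  have int: "(\<lambda>z. kr n l (z - x) *\<^sub>R F z) integrable_on cbox a b"
    "(\<lambda>z. kr_hess n l u u (z - x) *\<^sub>R F z) integrable_on cbox a b" for n u
    by (rule integrable_continuous, intro continuous_intros F)+
  have cp: "continuous_on (UNIV \<times> cbox a b) (\<lambda>(m, z). kr n m (z - x) *\<^sub>R F z)" for n
  proof -
    have "continuous_on (UNIV \<times> cbox a b) (\<lambda>p. F (snd p))"
      by (rule continuous_on_compose2[OF F]) (intro continuous_intros, auto)
    then show ?thesis unfolding split_beta by (intro continuous_intros)
  qed
  have "has_pdiff 1 g l (integral (cbox a b) (\<lambda>z. real (n + 2) *\<^sub>R (kr (n + 1) l (z - x) *\<^sub>R F z)))"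
    unfolding g_def
  proof (rule has_pdiff_integral[OF open_UNIV UNIV_I])
    show "has_pdiff 1 (\<lambda>m. kr (n + 2) m (z - x) *\<^sub>R F z) m (real (n + 2) *\<^sub>R (kr (n + 1) m (z - x) *\<^sub>R F z))" for m z
    proof -
      have "has_pdiff 1 (\<lambda>m. kr (n + 2) m (z - x)) m (real (n + 2) * kr (n + 1) m (z - x))"
        using kr_deriv unfolding has_pdiff_1_iff has_real_derivative_iff_has_vector_derivative .
      from has_pdiff_linear[OF bounded_linear_scaleR_left this] show ?thesis by simp
    qed
    show "continuous_on (UNIV \<times> cbox a b) (\<lambda>(m, z). real (n + 2) *\<^sub>R (kr (n + 1) m (z - x) *\<^sub>R F z))"
      using continuous_on_scaleR[OF continuous_on_const cp] by (simp add: split_beta)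
  qed (rule cp)
  then show "(g has_vector_derivative real (n + 2) *\<^sub>R ?I (n + 1)) (at l)"
    unfolding has_pdiff_1_iff by (simp only: integral_cmul)
  have "0 = (\<Sum>u\<in>Basis. integral (cbox a b) (\<lambda>z. kr_hess n l u u (z - x) *\<^sub>R F z))"
    by (simp add: weak)
  also have "\<dots> = integral (cbox a b) (\<lambda>z. (\<Sum>u\<in>Basis. kr_hess n l u u (z - x)) *\<^sub>R F z)"
    unfolding scaleR_sum_left by (rule integral_sum[symmetric]) (use int in auto)
  also have "\<dots> = integral (cbox a b) (\<lambda>z. (4 * real (n + 3) * real (n + 2) * l) *\<^sub>R (kr (n + 1) l (z - x) *\<^sub>R F z)
      - (real (n + 3) * (4 * real (n + 2) + 2 * real DIM('a))) *\<^sub>R (kr (n + 2) l (z - x) *\<^sub>R F z))"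
    unfolding kr_laplacian by (simp add: algebra_simps)
  also have "\<dots> = (4 * real (n + 3) * real (n + 2) * l) *\<^sub>R ?I (n + 1)
      - (real (n + 3) * (4 * real (n + 2) + 2 * real DIM('a))) *\<^sub>R ?I (n + 2)"
    by (simp only: integral_diff[OF integrable_cmul[OF int(1)] integrable_cmul[OF int(1)]] integral_cmul)
  also have "\<dots> = (2 * real (n + 3)) *\<^sub>R ((2 * l) *\<^sub>R real (n + 2) *\<^sub>R ?I (n + 1) -
      (2 * real (n + 2) + real DIM('a)) *\<^sub>R ?I (n + 2))"
    unfolding scaleR_right_diff_distrib scaleR_scaleR by (simp add: algebra_simps)
  \<comment> \<open>The factor \<open>2 * real (n + 3)\<close>, left over from differentiating the
    exponent \<open>n + 3\<close>, is cancelled.\<close>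
  finally have "(2 * l) *\<^sub>R real (n + 2) *\<^sub>R ?I (n + 1) - (2 * real (n + 2) + real DIM('a)) *\<^sub>R ?I (n + 2) = 0"
    by (metis (no_types, lifting) add_eq_0_iff_both_eq_0 mult_eq_0_iff of_nat_eq_0_iff scaleR_eq_0_iff
        zero_neq_numeral)
  then show "(2 * l) *\<^sub>R real (n + 2) *\<^sub>R ?I (n + 1) = (2 * real (n + 2) + real DIM('a)) *\<^sub>R g l"
    by (simp add: g_def)
qed

text \<open>A continuous nonnegative integrand with integral zero would vanish throughout the box,
  but at the centre the kernel equals \<open>l ^ n\<close>.\<close>

lemma kr_integral_pos:
  fixes x :: "'a :: euclidean_space"
  assumes r: "cball x r \<subseteq> cbox a b" "0 < r" and l: "0 < l"
  shows "integral (cbox a b) (\<lambda>z. kr n l (z - x)) > 0"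
proof -
  have c: "continuous_on (cbox a b) (\<lambda>z. kr n l (z - x))" by (intro continuous_intros)
  then have int: "(\<lambda>z. kr n l (z - x)) integrable_on cbox a b" by (rule integrable_continuous)
  have "integral (cbox a b) (\<lambda>z. kr n l (z - x)) \<ge> 0"
    by (rule integral_nonneg[OF int]) (simp add: kr_nonneg)
  moreover have "integral (cbox a b) (\<lambda>z. kr n l (z - x)) \<noteq> 0"
  proof
    assume "integral (cbox a b) (\<lambda>z. kr n l (z - x)) = 0"
    then have 0: "((\<lambda>z. kr n l (z - x)) has_integral 0) (cbox a b)"
      using integrable_integral[OF int] by simp
    have "ball x r \<subseteq> interior (cbox a b)"
      by (rule interior_maximal) (use r in \<open>auto simp: subset_iff\<close>)
    then have ne: "box a b \<noteq> {}" using r(2) by (auto simp: interior_cbox)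
    have "kr n l (x - x) = 0"
      by (rule has_integral_0_cbox_imp_0[OF c _ 0 ne]) (use r kr_nonneg in auto)
    then show False using l by (simp add: kr_def ppow_def)
  qed
  ultimately show ?thesis by linarith
qed

lemma weakly_harmonic_mean_value:
  fixes F :: "'a :: euclidean_space \<Rightarrow> 'b :: banach"
  assumes F: "continuous_on (cbox a b) F"
    and r: "cball x r \<subseteq> cbox a b" "0 < r"
    and weak: "\<And>l. 0 < l \<Longrightarrow> l < r\<^sup>2 \<Longrightarrow>
      (\<Sum>u\<in>Basis. integral (cbox a b) (\<lambda>z. kr_hess n l u u (z - x) *\<^sub>R F z)) = 0"
    and l: "0 < l" "l < r\<^sup>2"
  shows "integral (cbox a b) (\<lambda>z. kr (n + 2) l (z - x) *\<^sub>R F z) =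
    integral (cbox a b) (\<lambda>z. kr (n + 2) l (z - x)) *\<^sub>R F x"
proof -
  define T where "T = {0<..<r\<^sup>2}"
  define C where "C = 2 * real (n + 2) + real DIM('a)"
  define g where "g = (\<lambda>l. integral (cbox a b) (\<lambda>z. kr (n + 2) l (z - x) *\<^sub>R F z))"
  \<comment> \<open>Multiplying by the real number \<open>1\<close> makes \<open>M\<close> the
    instance of \<open>g\<close> for a constant function, so that \<open>kr_integral_ode\<close>
    applies to both.\<close>
  define M where "M = (\<lambda>l. integral (cbox a b) (\<lambda>z. kr (n + 2) l (z - x) *\<^sub>R (1::real)))"
  have Mpos: "M l > 0" if "l \<in> T" for l
    using kr_integral_pos[OF r, of l "n + 2"] that by (simp add: M_def T_def)
  have "\<exists>g'. (g has_vector_derivative g') (at l) \<and> (2 * l) *\<^sub>R g' = C *\<^sub>R g l" if "l \<in> T" for l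
    using kr_integral_ode[OF F weak[of l]] that unfolding g_def C_def T_def
    by (metis (no_types, lifting) greaterThanLessThan_iff)
  then obtain g' where g': "\<And>l. l \<in> T \<Longrightarrow> (g has_vector_derivative g' l) (at l)"
    "\<And>l. l \<in> T \<Longrightarrow> (2 * l) *\<^sub>R g' l = C *\<^sub>R g l" by metis
  have weak1: "(\<Sum>u\<in>Basis. integral (cbox a b) (\<lambda>z. kr_hess n l u u (z - x) *\<^sub>R (1::real))) = 0" if "l \<in> T" for l
  proof (rule sum.neutral, rule ballI)
    fix u :: 'a
    have "integral (cbox a b) (\<lambda>z. kr_hess n l u u (z - x) *\<^sub>R (1::real)) =
      - integral (cbox a b) (\<lambda>z. kr_grad n l u (z - x) *\<^sub>R (0::real))"
      by (rule integral_hess_by_parts[of UNIV, OF _ _ _ _ has_pdiff_const r(1)])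
        (use that r in \<open>auto simp: T_def\<close>)
    then show "integral (cbox a b) (\<lambda>z. kr_hess n l u u (z - x) *\<^sub>R (1::real)) = 0" by simp
  qed
  have "\<exists>g'. (M has_vector_derivative g') (at l) \<and> (2 * l) *\<^sub>R g' = C *\<^sub>R M l" if "l \<in> T" for l
    using kr_integral_ode[OF continuous_on_const weak1[OF that]] unfolding M_def C_def
    by (metis (no_types, lifting))
  then obtain M' where M': "\<And>l. l \<in> T \<Longrightarrow> (M has_vector_derivative M' l) (at l)"
    "\<And>l. l \<in> T \<Longrightarrow> (2 * l) *\<^sub>R M' l = C *\<^sub>R M l" by metis
  \<comment> \<open>\<open>g\<close> and \<open>M\<close> solve the same linear equation of first
    order and \<open>M\<close> is positive, so the quotient has derivative zero.\<close>
  define h where "h = (\<lambda>l. inverse (M l) *\<^sub>R g l)"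
  have "(h has_vector_derivative 0) (at l within T)" if lT: "l \<in> T" for l
  proof (rule has_vector_derivative_at_within)
    have l: "l > 0" using lT by (simp add: T_def)
    have M0: "M l \<noteq> 0" using Mpos[OF lT] by simp
    have iM: "((\<lambda>l. inverse (M l)) has_real_derivative - (inverse (M l) * M' l * inverse (M l))) (at l)"
      using DERIV_inverse'[OF M'(1)[OF lT, folded has_real_derivative_iff_has_vector_derivative] M0] .
    have "g' l = (C / (2 * l)) *\<^sub>R g l" "M' l = (C / (2 * l)) * M l"
      using g'(2)[OF lT] M'(2)[OF lT] l
      by (auto simp: field_simps) (metis (no_types, opaque_lifting) l less_numeral_extra(3) mult.commute
          nonzero_divide_eq_eq mult_eq_0_iff real_vector_eq_affinity scaleR_left_imp_eq scaleR_scaleR times_divide_eq_left zero_neq_numeral)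
    then have "inverse (M l) *\<^sub>R g' l + (- (inverse (M l) * M' l * inverse (M l))) *\<^sub>R g l = 0"
      using M0 by (simp add: field_simps)
    then show "(h has_vector_derivative 0) (at l)"
      using has_vector_derivative_scaleR[OF iM g'(1)[OF lT]] by (simp add: h_def)
  qed
  then obtain c where c: "\<And>l. l \<in> T \<Longrightarrow> h l = c"
    using has_vector_derivative_zero_constant[of T h] by (auto simp: T_def)
  have xin: "x \<in> cbox a b" using r by auto
  \<comment> \<open>The constant is identified by small supports: with \<open>l = s\<^sup>2\<close>
    and \<open>s < d\<close>, the kernel sees only points where \<open>F\<close> is within
    \<open>e\<close> of \<open>F x\<close>.\<close>
  have "norm (c - F x) \<le> e" if e: "e > 0" for e
  proof -
    obtain d where d: "d > 0" "\<And>z. z \<in> cbox a b \<Longrightarrow> dist z x < d \<Longrightarrow> dist (F z) (F x) < e"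
      using F xin e unfolding continuous_on_iff by metis
    define s where "s = min d r / 2"
    define l where "l = s\<^sup>2"
    have s: "0 < s" "s < d" "s < r" using d(1) r(2) by (auto simp: s_def)
    have l: "l \<in> T" "0 < l" using s by (auto simp: l_def T_def power_strict_mono)
    have int: "(\<lambda>z. kr (n + 2) l (z - x) *\<^sub>R (F z - F x)) integrable_on cbox a b"
      "(\<lambda>z. kr (n + 2) l (z - x) *\<^sub>R F z) integrable_on cbox a b"
      "(\<lambda>z. kr (n + 2) l (z - x) *\<^sub>R F x) integrable_on cbox a b"
      "(\<lambda>z. kr (n + 2) l (z - x)) integrable_on cbox a b"
      "(\<lambda>z. kr (n + 2) l (z - x) * e) integrable_on cbox a b"
      by (rule integrable_continuous, intro continuous_intros F)+
    have bd: "norm (kr (n + 2) l (z - x) *\<^sub>R (F z - F x)) \<le> kr (n + 2) l (z - x) * e" if z: "z \<in> cbox a b" for z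
    proof (cases "norm (z - x) \<ge> s")
      case True
      then show ?thesis using kr_support[of "n + 2" l s "z - x"] s by (simp add: l_def)
    next
      case False
      then show ?thesis
        using d(2)[OF z] s kr_nonneg[of "n + 2" l "z - x"]
          mult_left_mono[of "norm (F z - F x)" e "kr (n + 2) l (z - x)"]
        by (simp add: dist_norm)
    qed
    have "g l - M l *\<^sub>R F x = integral (cbox a b) (\<lambda>z. kr (n + 2) l (z - x) *\<^sub>R (F z - F x))"
      unfolding scaleR_diff_right g_def M_def
      using integral_diff[OF int(2,3)] integral_linear[OF int(4) bounded_linear_scaleR_left[of "F x"]]
      by (simp add: o_def)
    also have "norm \<dots> \<le> integral (cbox a b) (\<lambda>z. kr (n + 2) l (z - x) * e)"
      by (rule integral_norm_bound_integral[OF int(1,5) bd])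
    also have "\<dots> = M l * e" by (simp add: M_def)
    finally have 1: "norm (g l - M l *\<^sub>R F x) \<le> M l * e" .
    have "g l = M l *\<^sub>R c" using c[OF l(1)] Mpos[OF l(1)] by (auto simp: h_def)
    then have "g l - M l *\<^sub>R F x = M l *\<^sub>R (c - F x)" by (simp add: algebra_simps)
    then show ?thesis using 1 Mpos[OF l(1)] by simp
  qed
  then have "norm (c - F x) \<le> 0" by (meson dense not_less)
  then have "c = F x" by simp
  have "l \<in> T" using l by (simp add: T_def)
  moreover have "g l = M l *\<^sub>R h l" using Mpos[OF \<open>l \<in> T\<close>] by (simp add: h_def)
  ultimately have "g l = M l *\<^sub>R F x" using c[of l] \<open>c = F x\<close> by simp
  then show ?thesis by (simp add: g_def M_def)
qed

text \<open>Translation moves the kernel to the origin, and the shifted box still contains its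
  support. Hence the mass depends neither on \<open>x\<close> nor on the box, and one normalising
  constant serves all \<open>x\<close> near a given point.\<close>

lemma kr_integral_eq:
  fixes x :: "'a :: euclidean_space"
  assumes r: "cball x r \<subseteq> cbox a b" "0 < r" "0 < l" "l < r\<^sup>2"
  shows "integral (cbox a b) (\<lambda>z. kr (n + 1) l (z - x)) = integral UNIV (kr (n + 1) l :: 'a \<Rightarrow> real)"
proof -
  have "integral (cbox a b) (\<lambda>z. kr (n + 1) l (z - x)) = integral (cbox (a - x) (b - x)) (kr (n + 1) l :: 'a \<Rightarrow> real)"
    using integral_shift_cbox_plus[of "a - x" "b - x" "\<lambda>z. kr (n + 1) l (z - x)" x] by (simp add: o_def)
  also have "\<dots> = integral UNIV (kr (n + 1) l :: 'a \<Rightarrow> real)"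
  proof (rule integral_unique[symmetric])
    have 1: "(kr (n + 1) l has_integral integral (cbox (a - x) (b - x)) (kr (n + 1) l)) (cbox (a - x) (b - x))"
      by (rule integrable_integral, rule integrable_continuous,
          rule continuous_on_kr[OF continuous_on_const continuous_on_id])
    have 2: "kr (n + 1) l z = 0" if "z \<notin> cbox (a - x) (b - x)" for z :: 'a
    proof (rule kr_support[of _ _ r])
      show "r \<le> norm z"
      proof (rule ccontr)
        assume "\<not> r \<le> norm z"
        then have "z + x \<in> cball x r" by (simp add: dist_norm)
        then have "z + x \<in> cbox a b" using r by blast
        with that show False by (simp add: mem_box inner_simps algebra_simps)
      qed
    qed (use r in auto)
    show "(kr (n + 1) l has_integral integral (cbox (a - x) (b - x)) (kr (n + 1) l)) (UNIV :: 'a set)"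
      by (rule has_integral_on_superset[OF 1 2]) auto
  qed
  finally show ?thesis .
qed

lemma weakly_harmonic_smooth:
  fixes F :: "'a :: euclidean_space \<Rightarrow> 'b :: banach"
  assumes U: "open U" and F: "continuous_on U F"
    and weak: "\<And>a b x r n l. cbox a b \<subseteq> U \<Longrightarrow> cball x r \<subseteq> cbox a b \<Longrightarrow> 0 < r \<Longrightarrow> 0 < l \<Longrightarrow> l < r\<^sup>2 \<Longrightarrow>
      (\<Sum>u\<in>Basis. integral (cbox a b) (\<lambda>z. kr_hess n l u u (z - x) *\<^sub>R F z)) = 0"
  shows "Ck_on V k U F"
proof (rule Ck_on_local[OF U])
  fix x0 assume "x0 \<in> U"
  then obtain a b where ab: "x0 \<in> box a b" "cbox a b \<subseteq> U"
    using open_contains_cbox[OF U] by metis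
  obtain r where r: "r > 0" "ball x0 r \<subseteq> box a b"
    using ab(1) open_box open_contains_ball by metis
  \<comment> \<open>With a third of \<open>r\<close>, every ball of radius \<open>s\<close> around a
    point of \<open>ball x0 s\<close> stays inside \<open>ball x0 r\<close>; one \<open>l\<close>
    below \<open>s\<^sup>2\<close> then serves all these points.\<close>
  define s where "s = r / 3"
  define l where "l = (s / 2)\<^sup>2"
  have s: "s > 0" "0 < l" "l < s\<^sup>2" using r by (auto simp: s_def l_def power_strict_mono)
  have sub: "cball x s \<subseteq> cbox a b" if "x \<in> ball x0 s" for x
  proof -
    have "cball x s \<subseteq> ball x0 r"
    proof
      fix y assume "y \<in> cball x s"
      then show "y \<in> ball x0 r"
        using that dist_triangle[of x0 y x] r by (auto simp: s_def)
    qed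
    then show ?thesis using r box_subset_cbox by blast
  qed
  define M where "M = integral UNIV (kr (k + 2) l :: 'a \<Rightarrow> real)"
  have Fc: "continuous_on (cbox a b) F" using F ab continuous_on_subset by blast
  have M: "integral (cbox a b) (\<lambda>z. kr (k + 2) l (z - x)) = M" "M > 0" if "x \<in> ball x0 s" for x
  proof -
    show "integral (cbox a b) (\<lambda>z. kr (k + 2) l (z - x)) = M"
      using kr_integral_eq[OF sub[OF that] s, of "k + 1"] by (simp add: M_def)
    then show "M > 0" using kr_integral_pos[OF sub[OF that] s(1,2)] by metis
  qed
  \<comment> \<open>By the mean value property and the evenness of the kernel, \<open>F\<close> is
    near \<open>x0\<close> a convolution with the kernel of exponent \<open>k + 2\<close>, which is
    of class \<open>k\<close>.\<close>
  have eq: "inverse M *\<^sub>R integral (cbox a b) (\<lambda>z. kr (k + 2) l (x - z) *\<^sub>R F z) = F x" if x: "x \<in> ball x0 s" for x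
  proof -
    have "integral (cbox a b) (\<lambda>z. kr (k + 2) l (z - x) *\<^sub>R F z) = M *\<^sub>R F x"
      using weakly_harmonic_mean_value[OF Fc sub[OF x] s(1) weak[OF ab(2) sub[OF x] s(1)] s(2,3)] M(1)[OF x]
      by simp
    moreover have "kr (k + 2) l (x - z) = kr (k + 2) l (z - x)" for z
      using kr_minus[of "k + 2" l "z - x"] by simp
    ultimately show ?thesis using M(2)[OF x] by simp
  qed
  have "Ck_on V k UNIV (\<lambda>x. inverse M *\<^sub>R integral (cbox a b) (\<lambda>z. kr (k + 2) l (x - z) *\<^sub>R F z))"
    using Ck_on_linear[OF open_dir_open[OF open_UNIV] bounded_linear_scaleR_right
        Ck_on_convolution[OF Fc Ck_on_kr[of V k 1 l]]] by simp
  then have "Ck_on V k (ball x0 s) (\<lambda>x. inverse M *\<^sub>R integral (cbox a b) (\<lambda>z. kr (k + 2) l (x - z) *\<^sub>R F z))"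
    by (rule Ck_on_subset) simp
  then have "Ck_on V k (ball x0 s) F"
    by (rule Ck_on_cong[OF _ open_dir_open[OF open_ball] eq])
  then have "Ck_on V k (ball x0 s \<inter> U) F" by (rule Ck_on_subset) simp
  then show "\<exists>W. open W \<and> x0 \<in> W \<and> Ck_on V k (W \<inter> U) F"
    using s by (intro exI[of _ "ball x0 s"]) auto
qed

section \<open>Generators of the Clifford algebra\<close>

lemma bounded_bilinear_clifford_mult: "bounded_bilinear ((*) :: 'n clifford \<Rightarrow> 'n clifford \<Rightarrow> 'n clifford)"
  unfolding bilinear_conv_bounded_bilinear[symmetric] bilinear_def
  by (auto intro!: linearI simp: algebra_simps)

lemma bounded_linear_clifford_mult_right: "bounded_linear (\<lambda>x. c * x :: 'n clifford)"
  by (rule bounded_bilinear.bounded_linear_right[OF bounded_bilinear_clifford_mult])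

lemma bounded_linear_cconj: "bounded_linear (cconj :: 'n clifford \<Rightarrow> 'n clifford)"
  using cconj_linear linear_conv_bounded_linear by blast

lemma gen_0: "gen 0 = 1"
  by (simp add: gen_def)

lemma cconj_one: "cconj (1 :: 'n clifford) = 1"
  using cconj_gen(1) by (simp add: gen_def)

lemma gen_eq_blade: "gen i = blade (if i = 0 then {} else {i})"
  by (simp add: gen_def blade_empty)

lemma gen_in_Basis: "i \<le> CARD('n) \<Longrightarrow> (gen i :: 'n clifford) \<in> Basis"
  unfolding gen_eq_blade Basis_clifford_def by auto

lemma inner_gen_gen:
  assumes "i \<le> CARD('n)" "j \<le> CARD('n)"
  shows "inner (gen i) (gen j :: 'n clifford) = (if i = j then 1 else 0)"
proof -
  have "inner (gen i) (gen j :: 'n clifford) = coef (gen i :: 'n clifford) (if j = 0 then {} else {j})"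
    unfolding gen_eq_blade[of j] by (rule inner_blade) (use assms in simp)
  also have "\<dots> = (if i = j then 1 else 0)"
  proof -
    have "(if i = 0 then {} else {i}) \<subseteq> {1..CARD('n)}"
      and "(if j = 0 then {} else {j}) = (if i = 0 then {} else {i}) \<longleftrightarrow> i = j"
      using assms(1) by auto
    then show ?thesis unfolding gen_eq_blade[of i] blade.rep_eq by presburger
  qed
  finally show ?thesis .
qed

lemma inj_gen: "inj_on (gen :: nat \<Rightarrow> 'n clifford) {0..CARD('n)}"
proof (rule inj_onI)
  fix i j assume "i \<in> {0..CARD('n)}" "j \<in> {0..CARD('n)}" "(gen i :: 'n clifford) = gen j"
  then show "i = j" using inner_gen_gen[where 'n = 'n, of i j] inner_gen_gen[where 'n = 'n, of j j]
    by (auto split: if_splits)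
qed

text \<open>These polarise the identity conj(x) x = x conj(x) = |x|^2 for paravectors. Index
  \<open>0\<close> stands for the unit and not for an anticommuting generator, so it is treated
  apart.\<close>

lemma cconj_gen_mult_gen:
  assumes "i \<le> CARD('n)" "j \<le> CARD('n)"
  shows "cconj (gen i) * gen j + cconj (gen j) * gen i = (if i = j then 2 else 0 :: 'n clifford)"
    and "gen i * cconj (gen j) + gen j * cconj (gen i) = (if i = j then 2 else 0 :: 'n clifford)"
proof -
  have "cconj (gen i) * gen j + cconj (gen j) * gen i = (if i = j then 2 else 0 :: 'n clifford) \<and>
    gen i * cconj (gen j) + gen j * cconj (gen i) = (if i = j then 2 else 0 :: 'n clifford)"
  proof (cases "i = 0 \<or> j = 0")
    case True
    then show ?thesis
      by (elim disjE; cases "i = j") (simp_all add: gen_0 cconj_one cconj_gen(2))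
  next
    case False
    then have "gen i * gen j + gen j * gen i = (if i = j then - 2 else 0 :: 'n clifford)"
      by (intro gen_anticommute) (use assms in simp_all)
    then have "- (gen i * gen j + gen j * gen i) = (if i = j then 2 else 0 :: 'n clifford)"
      by simp
    then have "- (gen i * gen j) - gen j * gen i = (if i = j then 2 else 0 :: 'n clifford)"
      by (simp only: minus_add_distrib diff_conv_add_uminus)
    then show ?thesis using False by (simp add: cconj_gen(2))
  qed
  then show "cconj (gen i) * gen j + cconj (gen j) * gen i = (if i = j then 2 else 0 :: 'n clifford)"
    and "gen i * cconj (gen j) + gen j * cconj (gen i) = (if i = j then 2 else 0 :: 'n clifford)"
    by blast+
qed

text \<open>A symmetric \<open>M\<close> meets only the symmetrised products of \<open>a\<close> and
  \<open>b\<close>, whose off-diagonal part vanishes. This is the factorisation of the Laplacian by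
  the Dirac operator and its conjugate, stated for arrays so that it also covers weak second
  derivatives.\<close>

lemma clifford_trace:
  fixes a b :: "nat \<Rightarrow> 'n clifford" and M :: "nat \<Rightarrow> nat \<Rightarrow> 'n clifford"
  assumes ab: "\<And>i j. i \<le> p \<Longrightarrow> j \<le> p \<Longrightarrow> a i * b j + a j * b i = (if i = j then 2 else 0)"
    and M: "\<And>i j. i \<le> p \<Longrightarrow> j \<le> p \<Longrightarrow> M i j = M j i"
  shows "(\<Sum>i=0..p. a i * (\<Sum>j=0..p. b j * M j i)) = (\<Sum>i=0..p. M i i)"
proof -
  let ?S = "\<Sum>i=0..p. a i * (\<Sum>j=0..p. b j * M j i)"
  have S: "?S = (\<Sum>i=0..p. \<Sum>j=0..p. a i * b j * M j i)"
    by (simp add: sum_distrib_left mult.assoc)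
  have S': "?S = (\<Sum>i=0..p. \<Sum>j=0..p. a j * b i * M i j)"
    unfolding S by (rule sum.swap)
  have "?S + ?S = (\<Sum>i=0..p. \<Sum>j=0..p. (a i * b j + a j * b i) * M j i)"
    by (subst S, subst S', simp only: sum.distrib[symmetric])
      (intro sum.cong refl, use M in \<open>simp add: distrib_right\<close>)
  also have "\<dots> = (\<Sum>i=0..p. \<Sum>j=0..p. if i = j then 2 * M i i else 0)"
    by (intro sum.cong refl) (use ab in auto)
  also have "\<dots> = (\<Sum>i=0..p. 2 * M i i)" by simp
  also have "\<dots> = (\<Sum>i=0..p. M i i) + (\<Sum>i=0..p. M i i)"
    by (simp add: mult_2 sum.distrib)
  finally have "2 *\<^sub>R ?S = 2 *\<^sub>R (\<Sum>i=0..p. M i i)" by (simp only: scaleR_2)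
  then show ?thesis by simp
qed

text \<open>\<open>W1\<close> and \<open>W2\<close> stand for the second derivatives of \<open>F\<^sub>1\<close> and \<open>F\<^sub>2\<close>, at a point or tested
  against a kernel, and the two hypotheses for a differentiated Cauchy-Riemann system.\<close>

lemma cauchy_riemann_trace:
  fixes W1 W2 :: "'n clifford \<times> real \<Rightarrow> 'n clifford \<times> real \<Rightarrow> 'n clifford"
  assumes p: "p \<le> CARD('n)"
    and sym: "\<And>b c. b \<in> stem_dirs p \<Longrightarrow> c \<in> stem_dirs p \<Longrightarrow> W1 b c = W1 c b"
      "\<And>b c. b \<in> stem_dirs p \<Longrightarrow> c \<in> stem_dirs p \<Longrightarrow> W2 b c = W2 c b"
    and CR: "\<And>c. c \<in> stem_dirs p \<Longrightarrow> (\<Sum>j=0..p. gen j * W1 (gen j, 0) c) = W2 (0, 1) c"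
      "\<And>c. c \<in> stem_dirs p \<Longrightarrow> (\<Sum>j=0..p. cconj (gen j) * W2 (gen j, 0) c) = - W1 (0, 1) c"
  shows "(\<Sum>i=0..p. W1 (gen i, 0) (gen i, 0)) + W1 (0, 1) (0, 1) = 0"
    and "(\<Sum>i=0..p. W2 (gen i, 0) (gen i, 0)) + W2 (0, 1) (0, 1) = 0"
proof -
  have e: "(gen i, 0) \<in> stem_dirs p" if "i \<le> p" for i using that by (auto simp: stem_dirs_def)
  have \<rho>: "(0, 1) \<in> stem_dirs p" by (simp add: stem_dirs_def)
  have "(\<Sum>i=0..p. W1 (gen i, 0) (gen i, 0)) =
      (\<Sum>i=0..p. cconj (gen i) * (\<Sum>j=0..p. gen j * W1 (gen j, 0) (gen i, 0)))"
    by (rule clifford_trace[symmetric]) (use p cconj_gen_mult_gen(1)[where 'n = 'n] sym(1)[OF e e] in simp_all)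
  also have "\<dots> = (\<Sum>i=0..p. cconj (gen i) * W2 (gen i, 0) (0, 1))"
    by (intro sum.cong refl) (simp add: CR(1)[OF e] sym(2)[OF \<rho> e])
  also have "\<dots> = - W1 (0, 1) (0, 1)" by (rule CR(2)[OF \<rho>])
  finally show "(\<Sum>i=0..p. W1 (gen i, 0) (gen i, 0)) + W1 (0, 1) (0, 1) = 0" by simp
  have "(\<Sum>i=0..p. W2 (gen i, 0) (gen i, 0)) =
      (\<Sum>i=0..p. gen i * (\<Sum>j=0..p. cconj (gen j) * W2 (gen j, 0) (gen i, 0)))"
    by (rule clifford_trace[symmetric]) (use p cconj_gen_mult_gen(2)[where 'n = 'n] sym(2)[OF e e] in simp_all)
  also have "\<dots> = (\<Sum>i=0..p. gen i * - W1 (gen i, 0) (0, 1))"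
    by (intro sum.cong refl) (simp add: CR(2)[OF e] sym(1)[OF \<rho> e])
  also have "\<dots> = - W2 (0, 1) (0, 1)" using CR(1)[OF \<rho>] by (simp add: sum_negf)
  finally show "(\<Sum>i=0..p. W2 (gen i, 0) (gen i, 0)) + W2 (0, 1) (0, 1) = 0" by simp
qed

text \<open>Conjugation carries the signs, so index \<open>0\<close> needs no separate term and the
  operator takes the form used in \<open>cauchy_riemann_trace\<close>.\<close>

lemma Dp_bar_eq: "Dp_bar p F x = (\<Sum>i=0..p. cconj (gen i) * dx i F x)"
proof -
  have "(\<Sum>i=0..p. cconj (gen i) * dx i F x) = cconj (gen 0) * dx 0 F x + (\<Sum>i=1..p. cconj (gen i) * dx i F x)"
    by (simp add: sum.atLeast_Suc_atMost)
  also have "(\<Sum>i=1..p. cconj (gen i) * dx i F x) = - (\<Sum>i=1..p. gen i * dx i F x)"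
    unfolding sum_negf[symmetric] by (intro sum.cong refl) (auto simp: cconj_gen(2))
  finally show ?thesis by (simp add: Dp_bar_def cconj_gen(1)[unfolded gen_0] gen_0)
qed

lemma cauchy_riemann_iff:
  "Dp p F1 x - dr F2 x = 0 \<and> Dp_bar p F2 x + dr F1 x = 0 \<longleftrightarrow>
    (\<Sum>i=0..p. gen i * dx i F1 x) = dr F2 x \<and> (\<Sum>i=0..p. cconj (gen i) * dx i F2 x) = - dr F1 x"
  by (simp add: Dp_def Dp_bar_eq eq_neg_iff_add_eq_0)

lemma stem_dirs_subset_Basis: "p \<le> CARD('n) \<Longrightarrow> (stem_dirs p :: ('n clifford \<times> real) set) \<subseteq> Basis"
  using gen_in_Basis[where 'n = 'n] by (force simp: stem_dirs_def Basis_prod_def)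

lemma sum_stem_dirs:
  fixes f :: "'n clifford \<times> real \<Rightarrow> 'b :: comm_monoid_add"
  assumes "p \<le> CARD('n)"
  shows "(\<Sum>v\<in>stem_dirs p. f v) = (\<Sum>i=0..p. f (gen i, 0)) + f (0, 1)"
proof -
  have "inj_on (\<lambda>i. (gen i :: 'n clifford, 0 :: real)) {0..p}"
    using assms by (auto intro!: inj_onI dest: inj_onD[OF inj_gen])
  then show ?thesis
    unfolding stem_dirs_def by (subst sum.union_disjoint) (auto simp: sum.reindex)
qed

section \<open>Solutions of the Cauchy-Riemann system are smooth and harmonic\<close>

text \<open>The integrals \<open>W F u c\<close> act as weak second derivatives. They are symmetric
  in \<open>u\<close> and \<open>c\<close> because the Hessian of the kernel is, and moving one
  derivative onto \<open>F\<close> lets the Cauchy-Riemann system act on them; then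
  \<open>cauchy_riemann_trace\<close> applies.\<close>

lemma cauchy_riemann_weakly_harmonic:
  fixes F1 F2 :: "'n clifford \<times> real \<Rightarrow> 'n clifford"
  assumes p: "p \<le> CARD('n)" and U: "open U"
    and C1: "Ck_on (stem_dirs p) 1 U F1" "Ck_on (stem_dirs p) 1 U F2"
    and triv: "\<And>b x. b \<in> Basis - stem_dirs p \<Longrightarrow> x \<in> U \<Longrightarrow> has_pdiff b F1 x 0 \<and> has_pdiff b F2 x 0"
    and CR: "\<And>x. x \<in> U \<Longrightarrow> Dp p F1 x - dr F2 x = 0 \<and> Dp_bar p F2 x + dr F1 x = 0"
    and ab: "cbox a b \<subseteq> U" "cball x r \<subseteq> cbox a b" "0 < r" "0 < l" "l < r\<^sup>2"
  shows "(\<Sum>u\<in>Basis. integral (cbox a b) (\<lambda>z. kr_hess n l u u (z - x) *\<^sub>R F1 z)) = 0"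
    and "(\<Sum>u\<in>Basis. integral (cbox a b) (\<lambda>z. kr_hess n l u u (z - x) *\<^sub>R F2 z)) = 0"
proof -
  let ?V = "stem_dirs p :: ('n clifford \<times> real) set"
  define W where "W = (\<lambda>F u c. integral (cbox a b) (\<lambda>z. kr_hess n l u c (z - x) *\<^sub>R (F z :: 'n clifford)))"
  have W: "W F u c = integral (cbox a b) (\<lambda>z. - kr_grad n l c (z - x) *\<^sub>R F' z)"
    if "continuous_on U F" "continuous_on U F'" "\<And>z. z \<in> U \<Longrightarrow> has_pdiff u F z (F' z)" for F F' u c
    using integral_hess_by_parts[OF U ab(1) that ab(2,4,5,3)] by (simp add: W_def)
  have e: "(gen i, 0) \<in> ?V" if "i \<le> p" for i using that by (auto simp: stem_dirs_def)
  have \<rho>: "(0, 1) \<in> ?V" by (simp add: stem_dirs_def)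
  have WV: "W F u c = integral (cbox a b) (\<lambda>z. - kr_grad n l c (z - x) *\<^sub>R pdiff u F z)"
    if "Ck_on ?V 1 U F" "u \<in> ?V" for F u c
    by (rule W) (use that Ck_on_has_pdiff[of ?V 0 U F u] in auto)
  have int: "(\<lambda>z. - kr_grad n l c (z - x) *\<^sub>R pdiff u F z) integrable_on cbox a b"
    if "Ck_on ?V 1 U F" "u \<in> ?V" for u c and F :: "'n clifford \<times> real \<Rightarrow> 'n clifford"
  proof -
    have c: "continuous_on (cbox a b) (pdiff u F)"
      using that ab(1) by (auto intro: continuous_on_subset)
    show ?thesis
      by (rule integrable_continuous, rule continuous_on_scaleR[OF _ c]) (intro continuous_intros)
  qed
  have mult: "(\<Sum>j=0..p. g j * W F (gen j, 0) c) =
      integral (cbox a b) (\<lambda>z. - kr_grad n l c (z - x) *\<^sub>R (\<Sum>j=0..p. g j * dx j F z))"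
    if F: "Ck_on ?V 1 U F" for F c and g :: "nat \<Rightarrow> 'n clifford"
  proof -
    have "g j * W F (gen j, 0) c = integral (cbox a b) (\<lambda>z. g j * (- kr_grad n l c (z - x) *\<^sub>R dx j F z))"
      and "(\<lambda>z. g j * (- kr_grad n l c (z - x) *\<^sub>R dx j F z)) integrable_on cbox a b"
      if "j \<in> {0..p}" for j
    proof -
      have j: "j \<le> p" using that by simp
      show "g j * W F (gen j, 0) c = integral (cbox a b) (\<lambda>z. g j * (- kr_grad n l c (z - x) *\<^sub>R dx j F z))"
        unfolding WV[OF F e[OF j]]
        using integral_linear[OF int[OF F e[OF j]] bounded_linear_clifford_mult_right[of "g j"]]
        by (simp add: o_def)
      show "(\<lambda>z. g j * (- kr_grad n l c (z - x) *\<^sub>R dx j F z)) integrable_on cbox a b"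
        using integrable_linear[OF int[OF F e[OF j]] bounded_linear_clifford_mult_right[of "g j"]]
        by (simp add: o_def)
    qed
    then have "(\<Sum>j=0..p. g j * W F (gen j, 0) c) =
        integral (cbox a b) (\<lambda>z. \<Sum>j=0..p. g j * (- kr_grad n l c (z - x) *\<^sub>R dx j F z))"
      by (subst integral_sum) auto
    also have "\<dots> = integral (cbox a b) (\<lambda>z. - kr_grad n l c (z - x) *\<^sub>R (\<Sum>j=0..p. g j * dx j F z))"
      by (simp add: scaleR_sum_right sum_negf)
    finally show ?thesis .
  qed
  have sym: "W F u c = W F c u" for F u c
    unfolding W_def kr_hess_commute[of n l u c] ..
  have CR1: "(\<Sum>j=0..p. gen j * W F1 (gen j, 0) c) = W F2 (0, 1) c" for c
    unfolding mult[OF C1(1)] WV[OF C1(2) \<rho>]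
    by (rule integral_cong) (simp only: CR[unfolded cauchy_riemann_iff, THEN conjunct1] subsetD[OF ab(1)])
  have CR2: "(\<Sum>j=0..p. cconj (gen j) * W F2 (gen j, 0) c) = - W F1 (0, 1) c" for c
  proof -
    have "(\<Sum>j=0..p. cconj (gen j) * W F2 (gen j, 0) c) =
        integral (cbox a b) (\<lambda>z. - (- kr_grad n l c (z - x) *\<^sub>R dr F1 z))"
      unfolding mult[OF C1(2)]
    proof (rule integral_cong)
      fix z assume "z \<in> cbox a b"
      then have "z \<in> U" using ab(1) by blast
      from CR[OF this, unfolded cauchy_riemann_iff, THEN conjunct2]
      show "- kr_grad n l c (z - x) *\<^sub>R (\<Sum>j=0..p. cconj (gen j) * dx j F2 z) = - (- kr_grad n l c (z - x) *\<^sub>R dr F1 z)"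
        by simp
    qed
    then show ?thesis unfolding WV[OF C1(1) \<rho>] by simp
  qed
  \<comment> \<open>Directions outside \<open>stem_dirs p\<close> contribute nothing, because the
    derivatives along them are zero; this reduces the sum over \<open>Basis\<close> to the stem
    directions.\<close>
  have WB: "W F u c = 0" if "Ck_on ?V 1 U F" "\<And>z. z \<in> U \<Longrightarrow> has_pdiff u F z 0" for F u c
    using W[of F "\<lambda>_. 0" u c] that Ck_on_continuous[OF that(1)] by simp
  have fin: "(\<Sum>u\<in>Basis. W F u u) = (\<Sum>i=0..p. W F (gen i, 0) (gen i, 0)) + W F (0, 1) (0, 1)"
    if "Ck_on ?V 1 U F" "\<And>b z. b \<in> Basis - ?V \<Longrightarrow> z \<in> U \<Longrightarrow> has_pdiff b F z 0" for F
  proof -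
    have "(\<Sum>u\<in>Basis. W F u u) = (\<Sum>u\<in>?V. W F u u)"
      by (rule sum.mono_neutral_right) (use stem_dirs_subset_Basis[OF p] WB[OF that(1) that(2)] in auto)
    then show ?thesis by (simp only: sum_stem_dirs[OF p])
  qed
  note tr = cauchy_riemann_trace[of p "W F1" "W F2", OF p sym sym CR1 CR2]
  show "(\<Sum>u\<in>Basis. integral (cbox a b) (\<lambda>z. kr_hess n l u u (z - x) *\<^sub>R F1 z)) = 0"
    using fin[OF C1(1)] triv tr(1) unfolding W_def by metis
  show "(\<Sum>u\<in>Basis. integral (cbox a b) (\<lambda>z. kr_hess n l u u (z - x) *\<^sub>R F2 z)) = 0"
    using fin[OF C1(2)] triv tr(2) unfolding W_def by metis
qed

lemma cauchy_riemann_smooth: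
  fixes F1 F2 :: "'n clifford \<times> real \<Rightarrow> 'n clifford"
  assumes p: "p \<le> CARD('n)" and U: "open U"
    and C1: "Ck_on (stem_dirs p) 1 U F1" "Ck_on (stem_dirs p) 1 U F2"
    and triv: "\<And>b x. b \<in> Basis - stem_dirs p \<Longrightarrow> x \<in> U \<Longrightarrow> has_pdiff b F1 x 0 \<and> has_pdiff b F2 x 0"
    and CR: "\<And>x. x \<in> U \<Longrightarrow> Dp p F1 x - dr F2 x = 0 \<and> Dp_bar p F2 x + dr F1 x = 0"
  shows "Ck_on V k U F1" "Ck_on V k U F2"
  by (rule weakly_harmonic_smooth[OF U Ck_on_continuous[OF C1(1)]]
      weakly_harmonic_smooth[OF U Ck_on_continuous[OF C1(2)]],
      rule cauchy_riemann_weakly_harmonic[OF p U C1 triv CR]; assumption)+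

lemma has_pdiff_sum_mult:
  fixes F :: "nat \<Rightarrow> 'a :: real_normed_vector \<Rightarrow> 'n clifford"
  assumes "\<And>j. j \<in> I \<Longrightarrow> has_pdiff v (F j) x (d j)"
  shows "has_pdiff v (\<lambda>x. \<Sum>j\<in>I. g j * F j x) x (\<Sum>j\<in>I. g j * d j)"
  by (rule has_pdiff_sum) (rule has_pdiff_linear[OF bounded_linear_clifford_mult_right assms])

text \<open>With two continuous derivatives the argument is pointwise: the differentiated system
  satisfies the hypotheses of \<open>cauchy_riemann_trace\<close>, since mixed partial derivatives
  commute.\<close>

lemma cauchy_riemann_harmonic:
  fixes F1 F2 :: "'n clifford \<times> real \<Rightarrow> 'n clifford"
  assumes p: "p \<le> CARD('n)" and U: "open U" and x: "x \<in> U"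
    and C2: "Ck_on (stem_dirs p) 2 U F1" "Ck_on (stem_dirs p) 2 U F2"
    and CR: "\<And>x. x \<in> U \<Longrightarrow> Dp p F1 x - dr F2 x = 0 \<and> Dp_bar p F2 x + dr F1 x = 0"
  shows "(\<Sum>i=0..p. dx i (dx i F1) x) + dr (dr F1) x = 0"
    and "(\<Sum>i=0..p. dx i (dx i F2) x) + dr (dr F2) x = 0"
proof -
  let ?V = "stem_dirs p :: ('n clifford \<times> real) set"
  have e: "(gen i, 0) \<in> ?V" if "i \<le> p" for i using that by (auto simp: stem_dirs_def)
  have \<rho>: "(0, 1) \<in> ?V" by (simp add: stem_dirs_def)
  have hp: "has_pdiff c (pdiff b F) x (pdiff c (pdiff b F) x)" if "Ck_on ?V 2 U F" "b \<in> ?V" "c \<in> ?V"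
    for b c and F :: "'n clifford \<times> real \<Rightarrow> 'n clifford"
    by (rule Ck_on_has_pdiff[of ?V 0 U]) (use that x in \<open>simp_all add: numeral_2_eq_2\<close>)
  have sym: "pdiff b (pdiff c F) x = pdiff c (pdiff b F) x" if "Ck_on ?V 2 U F" "b \<in> ?V" "c \<in> ?V"
    for b c and F :: "'n clifford \<times> real \<Rightarrow> 'n clifford"
    by (rule pdiff_commute[OF U x that])
  have 1: "(\<Sum>j=0..p. gen j * pdiff (gen j, 0) (pdiff c F1) x) = pdiff (0, 1) (pdiff c F2) x" if c: "c \<in> ?V" for c
  proof -
    have "has_pdiff c (\<lambda>x. \<Sum>j=0..p. gen j * dx j F1 x) x (\<Sum>j=0..p. gen j * pdiff c (dx j F1) x)"
      by (rule has_pdiff_sum_mult) (use hp[OF C2(1) e c] in auto)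
    then have "has_pdiff c (dr F2) x (\<Sum>j=0..p. gen j * pdiff c (dx j F1) x)"
      by (rule has_pdiff_cong[OF _ open_dir_open[OF U] UNIV_I x])
        (rule CR[unfolded cauchy_riemann_iff, THEN conjunct1])
    then have "(\<Sum>j=0..p. gen j * pdiff c (dx j F1) x) = pdiff c (dr F2) x"
      by (rule has_pdiff_imp_pdiff[symmetric])
    then show ?thesis using sym[OF C2(1) e c] sym[OF C2(2) \<rho> c] by simp
  qed
  have 2: "(\<Sum>j=0..p. cconj (gen j) * pdiff (gen j, 0) (pdiff c F2) x) = - pdiff (0, 1) (pdiff c F1) x" if c: "c \<in> ?V" for c
  proof -
    have "has_pdiff c (\<lambda>x. \<Sum>j=0..p. cconj (gen j) * dx j F2 x) x (\<Sum>j=0..p. cconj (gen j) * pdiff c (dx j F2) x)"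
      by (rule has_pdiff_sum_mult) (use hp[OF C2(2) e c] in auto)
    then have "has_pdiff c (\<lambda>x. - dr F1 x) x (\<Sum>j=0..p. cconj (gen j) * pdiff c (dx j F2) x)"
      by (rule has_pdiff_cong[OF _ open_dir_open[OF U] UNIV_I x])
        (rule CR[unfolded cauchy_riemann_iff, THEN conjunct2])
    moreover have "has_pdiff c (\<lambda>x. - dr F1 x) x (- pdiff c (dr F1) x)"
      by (rule has_pdiff_linear[OF bounded_linear_minus[OF bounded_linear_ident] hp[OF C2(1) \<rho> c]])
    ultimately have "(\<Sum>j=0..p. cconj (gen j) * pdiff c (dx j F2) x) = - pdiff c (dr F1) x"
      by (rule has_pdiff_unique)
    then show ?thesis using sym[OF C2(2) e c] sym[OF C2(1) \<rho> c] by simp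
  qed
  note tr = cauchy_riemann_trace[of p "\<lambda>b c. pdiff b (pdiff c F1) x" "\<lambda>b c. pdiff b (pdiff c F2) x",
      OF p sym[OF C2(1)] sym[OF C2(2)] 1 2]
  show "(\<Sum>i=0..p. dx i (dx i F1) x) + dr (dr F1) x = 0"
    "(\<Sum>i=0..p. dx i (dx i F2) x) + dr (dr F2) x = 0" using tr by auto
qed

section \<open>Extension to the ambient space\<close>

lemma pdiff_compose_affine:
  assumes "\<And>t. \<pi> (x + t *\<^sub>R v) = \<pi> x + t *\<^sub>R w"
  shows "pdiff v (\<lambda>x. F (\<pi> x)) x = pdiff w F (\<pi> x)"
    and "has_pdiff v (\<lambda>x. F (\<pi> x)) x d \<longleftrightarrow> has_pdiff w F (\<pi> x) d"
  by (simp_all add: pdiff_def has_pdiff_def assms)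

text \<open>Along directions in \<open>V\<close> the map \<open>\<pi>\<close> traces straight lines
  in directions from \<open>W\<close>, so \<open>pdiff\<close> passes through the composition. It
  serves both the extension of stem functions by a projection and the restriction of symmetric
  functions to a slice.\<close>

lemma Ck_on_compose_affine:
  assumes \<pi>: "continuous_on U' \<pi>" "\<pi> ` U' \<subseteq> U"
    and aff: "\<And>v x t. v \<in> V \<Longrightarrow> \<pi> (x + t *\<^sub>R v) = \<pi> x + t *\<^sub>R \<sigma> v" "\<And>v. v \<in> V \<Longrightarrow> \<sigma> v \<in> W"
  shows "Ck_on W k U F \<Longrightarrow> Ck_on V k U' (\<lambda>x. F (\<pi> x))"
proof (induction k arbitrary: F)
  case 0
  then show ?case using continuous_on_compose2[OF _ \<pi>] by simp
next
  case (Suc k)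
  have eq: "pdiff v (\<lambda>x. F (\<pi> x)) = (\<lambda>x. pdiff (\<sigma> v) F (\<pi> x))" if "v \<in> V" for v
    using pdiff_compose_affine(1)[OF aff(1)[OF that]] by blast
  show ?case
    unfolding Ck_on_Suc_iff
  proof (intro conjI ballI)
    show "continuous_on U' (\<lambda>x. F (\<pi> x))"
      by (rule continuous_on_compose2[OF Ck_on_continuous[OF Suc.prems] \<pi>])
    fix v assume v: "v \<in> V"
    show "has_pdiff v (\<lambda>x. F (\<pi> x)) x (pdiff v (\<lambda>x. F (\<pi> x)) x)" if "x \<in> U'" for x
      unfolding eq[OF v] pdiff_compose_affine(2)[OF aff(1)[OF v]]
      using Ck_on_has_pdiff[OF Suc.prems aff(2)[OF v]] \<pi>(2) that by blast
    show "Ck_on V k U' (pdiff v (\<lambda>x. F (\<pi> x)))"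
      unfolding eq[OF v] by (rule Suc.IH) (use Suc.prems aff(2)[OF v] in auto)
  qed
qed

lemma linear_ppart: "linear (ppart p)"
  unfolding ppart_def
  by (rule linearI) (simp_all add: inner_add_left scaleR_add_left sum.distrib scaleR_sum_right)

lemma linear_qpart: "linear (qpart p q)"
  unfolding qpart_def
  by (rule linearI) (simp_all add: inner_add_left scaleR_add_left sum.distrib scaleR_sum_right)

lemmas ppart_simps = linear_add[OF linear_ppart] linear_scale[OF linear_ppart] linear_0[OF linear_ppart]
lemmas qpart_simps = linear_add[OF linear_qpart] linear_scale[OF linear_qpart] linear_0[OF linear_qpart]

lemma continuous_on_ppart [continuous_intros]:
  "continuous_on S f \<Longrightarrow> continuous_on S (\<lambda>x. ppart p (f x :: 'n clifford))"
  unfolding ppart_def by (intro continuous_intros)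

lemma continuous_on_qpart [continuous_intros]:
  "continuous_on S f \<Longrightarrow> continuous_on S (\<lambda>x. qpart p q (f x :: 'n clifford))"
  unfolding qpart_def by (intro continuous_intros)

lemma ppart_in_pspace: "ppart p x \<in> pspace p"
  unfolding ppart_def pspace_def by (intro span_sum span_scale span_base) auto

lemma ppart_gen:
  assumes "p \<le> CARD('n)" "i \<le> CARD('n)"
  shows "ppart p (gen i) = (if i \<le> p then gen i else 0 :: 'n clifford)"
proof -
  have "ppart p (gen i) = (\<Sum>j=0..p. if j = i then gen i else 0 :: 'n clifford)"
    unfolding ppart_def by (intro sum.cong refl) (use assms in \<open>simp add: inner_gen_gen\<close>)
  then show ?thesis by simp
qed

lemma qpart_gen:
  assumes "p + q \<le> CARD('n)" "i \<le> CARD('n)"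
  shows "qpart p q (gen i) = (if p < i \<and> i \<le> p + q then gen i else 0 :: 'n clifford)"
proof -
  have "qpart p q (gen i) = (\<Sum>j=p+1..p+q. if j = i then gen i else 0 :: 'n clifford)"
    unfolding qpart_def by (intro sum.cong refl) (use assms in \<open>simp add: inner_gen_gen\<close>)
  then show ?thesis by auto
qed

lemma ppart_pspace:
  assumes "p \<le> CARD('n)" "x \<in> (pspace p :: 'n clifford set)"
  shows "ppart p x = x"
  using assms(2) unfolding pspace_def
proof (induction rule: span_induct_alt)
  case base
  show ?case by (simp add: ppart_simps)
next
  case (step c y z)
  then show ?case using ppart_gen[OF assms(1)] assms(1) by (auto simp: ppart_simps)
qed

lemma qpart_pspace:
  assumes "p + q \<le> CARD('n)" "x \<in> (pspace p :: 'n clifford set)"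
  shows "qpart p q x = 0"
  using assms(2) unfolding pspace_def
proof (induction rule: span_induct_alt)
  case base
  show ?case by (simp add: qpart_simps)
next
  case (step c y z)
  then show ?case using qpart_gen[OF assms(1)] assms(1) by (auto simp: qpart_simps)
qed

lemma ppart_qspace:
  assumes "p + q \<le> CARD('n)" "x \<in> (qspace p q :: 'n clifford set)"
  shows "ppart p x = 0"
  using assms(2) unfolding qspace_def
proof (induction rule: span_induct_alt)
  case base
  show ?case by (simp add: ppart_simps)
next
  case (step c y z)
  then show ?case using ppart_gen[where 'n = 'n, of p] assms(1) by (auto simp: ppart_simps)
qed

lemma qpart_qspace:
  assumes "p + q \<le> CARD('n)" "x \<in> (qspace p q :: 'n clifford set)"
  shows "qpart p q x = x"
  using assms(2) unfolding qspace_def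
proof (induction rule: span_induct_alt)
  case base
  show ?case by (simp add: qpart_simps)
next
  case (step c y z)
  then show ?case using qpart_gen[OF assms(1)] assms(1) by (auto simp: qpart_simps)
qed

section \<open>Even and odd smooth functions\<close>

lemma has_pdiff_scale_dir: "has_pdiff v f x d \<Longrightarrow> has_pdiff (c *\<^sub>R v) f x (c *\<^sub>R d)"
proof -
  assume "has_pdiff v f x d"
  then have "((\<lambda>t. f (x + t *\<^sub>R v)) has_vector_derivative d) (at (c * 0))"
    by (simp add: has_pdiff_def)
  moreover have "((\<lambda>t. c * t) has_vector_derivative c) (at 0)"
    by (auto intro!: derivative_eq_intros)
  ultimately have "(((\<lambda>t. f (x + t *\<^sub>R v)) \<circ> (\<lambda>t. c * t)) has_vector_derivative c *\<^sub>R d) (at 0)"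
    by (rule vector_diff_chain_at[rotated])
  then show ?thesis by (simp add: has_pdiff_def o_def mult.commute)
qed

text \<open>Differentiating a negative power of the radius gives a constant times the next one, so
  the induction ranges over all exponents \<open>Suc n\<close>.\<close>

lemma Ck_on_inverse_snd:
  fixes W :: "('n clifford \<times> real) set"
  assumes W: "open W" "\<And>y. y \<in> W \<Longrightarrow> snd y \<noteq> 0"
  shows "Ck_on (stem_dirs p) k W (\<lambda>y. inverse (snd y) ^ Suc n)"
proof (induction k arbitrary: n)
  case 0
  show ?case using W(2) by (auto intro!: continuous_intros)
next
  case (Suc k)
  define g :: "'n clifford \<times> real \<Rightarrow> 'n clifford \<times> real \<Rightarrow> real" where
    "g = (\<lambda>v y. - (real (Suc n) * snd v) * inverse (snd y) ^ Suc (Suc n))"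
  show ?case
  proof (rule Ck_on_SucI[where g = g, OF open_dir_open[OF W(1)]])
    show "continuous_on W (\<lambda>y. inverse (snd y) ^ Suc n)"
      using W(2) by (auto intro!: continuous_intros)
    show "has_pdiff v (\<lambda>y. inverse (snd y) ^ Suc n) y (g v y)" if "y \<in> W" for v y
    proof -
      have "((\<lambda>t. inverse (snd y + t * snd v)) has_real_derivative - (snd v * inverse (snd y) ^ 2)) (at 0)"
        using W(2)[OF that] by (auto intro!: derivative_eq_intros simp: power2_eq_square)
      from DERIV_power_Suc[OF this, of n]
      have "((\<lambda>t. inverse (snd y + t * snd v) ^ Suc n) has_real_derivative g v y) (at 0)"
        by (simp add: g_def power2_eq_square mult_ac)
      then show ?thesis
        by (simp add: has_pdiff_def has_real_derivative_iff_has_vector_derivative)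
    qed
    show "Ck_on (stem_dirs p) k W (g v)" for v
      unfolding g_def
      by (rule Ck_on_bilinear[OF open_dir_open[OF W(1)] bounded_bilinear_mult
            Ck_on_const[OF open_dir_open[OF W(1)]] Suc.IH])
  qed
qed

text \<open>For \<open>j = 0\<close> and a radial derivative as \<open>G\<close>, this is the
  integral in Hadamard's formula for an odd function divided by the radius. Each radial derivative
  brings out another factor \<open>t\<close>, hence the power \<open>t ^ j\<close>.\<close>

lemma Ck_on_radial_average:
  fixes G :: "'n clifford \<times> real \<Rightarrow> 'n clifford"
  assumes W: "open W" "\<And>x r t. (x, r) \<in> W \<Longrightarrow> 0 \<le> t \<Longrightarrow> t \<le> 1 \<Longrightarrow> (x, t * r) \<in> W"
    and G: "Ck_on (stem_dirs p) k W G"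
  shows "Ck_on (stem_dirs p) k W (\<lambda>y. integral (cbox 0 1) (\<lambda>t. t ^ j *\<^sub>R G (fst y, t * snd y)))"
proof (rule Ck_on_integral[where P = "\<lambda>k f. \<exists>j G. Ck_on (stem_dirs p) k W G \<and>
    f = (\<lambda>y t. t ^ j *\<^sub>R G (fst y, t * snd y))", OF W(1)])
  fix k and f :: "'n clifford \<times> real \<Rightarrow> real \<Rightarrow> 'n clifford"
  assume "\<exists>j G. Ck_on (stem_dirs p) k W G \<and> f = (\<lambda>y t. t ^ j *\<^sub>R G (fst y, t * snd y))"
  then obtain j G where G: "Ck_on (stem_dirs p) k W G" and f: "f = (\<lambda>y t. t ^ j *\<^sub>R G (fst y, t * snd y))"
    by blast
  have "continuous_on (W \<times> cbox 0 1) (\<lambda>z. G (fst (fst z), snd z * snd (fst z)))"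
    by (rule continuous_on_compose2[OF Ck_on_continuous[OF G]])
      (intro continuous_intros, use W(2) in auto)
  then show "continuous_on (W \<times> cbox 0 1) (\<lambda>(y, t). f y t)"
    unfolding f split_beta by (intro continuous_intros)
next
  fix k and f :: "'n clifford \<times> real \<Rightarrow> real \<Rightarrow> 'n clifford" and v :: "'n clifford \<times> real"
  assume "\<exists>j G. Ck_on (stem_dirs p) (Suc k) W G \<and> f = (\<lambda>y t. t ^ j *\<^sub>R G (fst y, t * snd y))"
    and v: "v \<in> stem_dirs p"
  then obtain j G where G: "Ck_on (stem_dirs p) (Suc k) W G"
    and f: "f = (\<lambda>y t. t ^ j *\<^sub>R G (fst y, t * snd y))"
    by blast
  have d: "has_pdiff v G (fst y, t * snd y) (pdiff v G (fst y, t * snd y))" if "y \<in> W" "t \<in> cbox 0 1" for y t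
    by (rule Ck_on_has_pdiff[OF G v]) (use W(2)[of "fst y" "snd y" t] that in auto)
  have Gv: "Ck_on (stem_dirs p) k W (pdiff v G)" using G v by simp
  from v consider "snd v = 0" | "v = (0, 1)" by (auto simp: stem_dirs_def)
  \<comment> \<open>\<open>m\<close> counts the factor \<open>t\<close> from the chain rule:
    \<open>0\<close> along the directions of \<open>pspace p\<close>, \<open>1\<close> along the
    radius.\<close>
  then obtain m where m: "\<And>y t. y \<in> W \<Longrightarrow> t \<in> cbox 0 1 \<Longrightarrow>
    has_pdiff v (\<lambda>y. G (fst y, t * snd y)) y (t ^ m *\<^sub>R pdiff v G (fst y, t * snd y))"
  proof cases
    case 1
    have "has_pdiff v (\<lambda>y. G (fst y, t * snd y)) y (t ^ 0 *\<^sub>R pdiff v G (fst y, t * snd y))"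
      if "y \<in> W" "t \<in> cbox 0 1" for y t
    proof -
      have "(\<lambda>y. (fst y, t * snd y)) (y + s *\<^sub>R v) = (\<lambda>y. (fst y, t * snd y)) y + s *\<^sub>R v" for s
        using 1 by (simp add: prod_eq_iff)
      from pdiff_compose_affine(2)[where \<pi> = "\<lambda>y. (fst y, t * snd y)" and F = G, OF this] d[OF that]
      show ?thesis by simp
    qed
    then show ?thesis by (rule that)
  next
    case 2
    have "has_pdiff v (\<lambda>y. G (fst y, t * snd y)) y (t ^ 1 *\<^sub>R pdiff v G (fst y, t * snd y))"
      if "y \<in> W" "t \<in> cbox 0 1" for y t
    proof -
      have "(\<lambda>y. (fst y, t * snd y)) (y + s *\<^sub>R v) = (\<lambda>y. (fst y, t * snd y)) y + s *\<^sub>R (t *\<^sub>R v)" for s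
        using 2 by (simp add: prod_eq_iff algebra_simps)
      from pdiff_compose_affine(2)[where \<pi> = "\<lambda>y. (fst y, t * snd y)" and F = G, OF this] has_pdiff_scale_dir[OF d[OF that], of t]
      show ?thesis by simp
    qed
    then show ?thesis by (rule that)
  qed
  have "has_pdiff v (\<lambda>y. f y t) y (t ^ (j + m) *\<^sub>R pdiff v G (fst y, t * snd y))" if "y \<in> W" "t \<in> cbox 0 1" for y t
    using has_pdiff_linear[OF bounded_linear_scaleR_right m[OF that], of "t ^ j"]
    by (simp add: f power_add)
  with Gv show "\<exists>g. (\<exists>j G. Ck_on (stem_dirs p) k W G \<and> g = (\<lambda>y t. t ^ j *\<^sub>R G (fst y, t * snd y))) \<and>
      (\<forall>y\<in>W. \<forall>t\<in>cbox 0 1. has_pdiff v (\<lambda>y. f y t) y (g y t))"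
    by (intro exI[of _ "\<lambda>y t. t ^ (j + m) *\<^sub>R pdiff v G (fst y, t * snd y)"]) blast
qed (use G in blast)

text \<open>The value at \<open>r = 0\<close> is the continuous continuation when \<open>g\<close> is odd in \<open>r\<close>.\<close>

definition rquot :: "('n clifford \<times> real \<Rightarrow> 'n clifford) \<Rightarrow> 'n clifford \<times> real \<Rightarrow> 'n clifford" where
  "rquot g y = (if snd y = 0 then dr g y else inverse (snd y) *\<^sub>R g y)"

abbreviation rderiv :: "('n clifford \<times> real \<Rightarrow> 'n clifford) \<Rightarrow> 'n clifford \<times> real \<Rightarrow> 'n clifford" where
  "rderiv h \<equiv> rquot (dr h)"

section \<open>Even and odd smooth functions on a reflection-invariant open set\<close>

locale stem_domain =
  fixes p q :: nat and U :: "('n clifford \<times> real) set"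
  assumes dim: "CARD('n) = p + q"
    and open_U: "open U"
    and reflect: "\<And>x r. (x, r) \<in> U \<Longrightarrow> (x, - r) \<in> U"
begin

abbreviation V :: "('n clifford \<times> real) set" where "V \<equiv> stem_dirs p"

text \<open>Only the directions in \<open>V\<close> are tested, since the operators on stem
  functions differentiate along these alone.\<close>

definition smooth :: "('n clifford \<times> real \<Rightarrow> 'n clifford) \<Rightarrow> bool" where
  "smooth h \<longleftrightarrow> (\<forall>k. Ck_on V k U h)"

definition smooth_even :: "('n clifford \<times> real \<Rightarrow> 'n clifford) \<Rightarrow> bool" where
  "smooth_even h \<longleftrightarrow> smooth h \<and> (\<forall>x r. (x, r) \<in> U \<longrightarrow> h (x, - r) = h (x, r))"

definition smooth_odd :: "('n clifford \<times> real \<Rightarrow> 'n clifford) \<Rightarrow> bool" where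
  "smooth_odd h \<longleftrightarrow> smooth h \<and> (\<forall>x r. (x, r) \<in> U \<longrightarrow> h (x, - r) = - h (x, r))"

lemma dir_open_U: "dir_open W U"
  by (rule open_dir_open[OF open_U])

lemma e_in_V: "i \<le> p \<Longrightarrow> (gen i, 0) \<in> V"
  by (auto simp: stem_dirs_def)

lemma r_in_V: "(0, 1) \<in> V"
  by (simp add: stem_dirs_def)

lemma smooth_continuous: "smooth h \<Longrightarrow> continuous_on U h"
  unfolding smooth_def using Ck_on_continuous by blast

lemma smooth_has_pdiff: "smooth h \<Longrightarrow> v \<in> V \<Longrightarrow> y \<in> U \<Longrightarrow> has_pdiff v h y (pdiff v h y)"
  unfolding smooth_def using Ck_on_has_pdiff[of V 0 U h] by blast

lemma smooth_pdiff: "smooth h \<Longrightarrow> v \<in> V \<Longrightarrow> smooth (pdiff v h)"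
  unfolding smooth_def
proof
  fix k assume "\<forall>k. Ck_on V k U h" "v \<in> V"
  then have "Ck_on V (Suc k) U h" by blast
  then show "Ck_on V k U (pdiff v h)" using \<open>v \<in> V\<close> by simp
qed

lemma smooth_commute: "smooth h \<Longrightarrow> v \<in> V \<Longrightarrow> w \<in> V \<Longrightarrow> y \<in> U \<Longrightarrow> pdiff v (pdiff w h) y = pdiff w (pdiff v h) y"
  unfolding smooth_def by (rule pdiff_commute[OF open_U]) auto

lemma smooth_add: "smooth h \<Longrightarrow> smooth g \<Longrightarrow> smooth (\<lambda>y. h y + g y)"
  unfolding smooth_def using Ck_on_add[OF dir_open_U] by blast

lemma smooth_linear: "bounded_linear f \<Longrightarrow> smooth h \<Longrightarrow> smooth (\<lambda>y. f (h y))"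
  unfolding smooth_def using Ck_on_linear[OF dir_open_U] by blast

lemma smooth_sum: "(\<And>i. i \<in> I \<Longrightarrow> smooth (f i)) \<Longrightarrow> smooth (\<lambda>y. \<Sum>i\<in>I. f i y)"
  unfolding smooth_def by (rule allI, rule Ck_on_sum[OF dir_open_U]) simp

lemma bounded_linear_cconj_fst: "bounded_linear (\<lambda>y :: 'n clifford \<times> real. cconj (fst y))"
  by (rule bounded_linear_compose[OF bounded_linear_cconj bounded_linear_fst])

lemma smooth_cconj_mult: "smooth h \<Longrightarrow> smooth (\<lambda>y. cconj (fst y) * h y)"
  unfolding smooth_def
  by (intro allI Ck_on_bilinear[OF dir_open_U bounded_bilinear_clifford_mult
        Ck_on_linear_fun[OF dir_open_U bounded_linear_cconj_fst]]) (rule spec)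

lemma smooth_radius_scale: "smooth h \<Longrightarrow> smooth (\<lambda>y. snd y *\<^sub>R h y)"
  unfolding smooth_def
  by (intro allI Ck_on_bilinear[OF dir_open_U bounded_bilinear_scaleR
        Ck_on_linear_fun[OF dir_open_U bounded_linear_snd]]) (rule spec)

lemma pdiff_cong_U: "v \<in> V \<Longrightarrow> y \<in> U \<Longrightarrow> (\<And>y. y \<in> U \<Longrightarrow> f y = g y) \<Longrightarrow> pdiff v f y = pdiff v g y"
  by (rule pdiff_cong[OF dir_open_U])

lemma odd_at_0: "smooth_odd g \<Longrightarrow> (x, 0) \<in> U \<Longrightarrow> g (x, 0) = 0"
proof -
  assume "smooth_odd g" "(x, 0) \<in> U"
  then have "g (x, - 0) = - g (x, 0)" unfolding smooth_odd_def by blast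
  then have "2 *\<^sub>R g (x, 0) = 0" by (simp add: scaleR_2 eq_neg_iff_add_eq_0)
  then show "g (x, 0) = 0" by simp
qed

lemma smooth_even_dr: assumes "smooth_even h" shows "smooth_odd (dr h)"
  unfolding smooth_odd_def
proof (intro conjI allI impI)
  show "smooth (dr h)" using assms smooth_pdiff r_in_V by (auto simp: smooth_even_def)
  fix x r assume xr: "(x, r) \<in> U"
  have h: "smooth h" using assms by (simp add: smooth_even_def)
  have "has_pdiff (-1 *\<^sub>R (0, 1)) h (x, r) (-1 *\<^sub>R dr h (x, r))"
    by (rule has_pdiff_scale_dir) (rule smooth_has_pdiff[OF h r_in_V xr])
  then have "((\<lambda>t. h (x, r - t)) has_vector_derivative - dr h (x, r)) (at 0)"
    by (simp add: has_pdiff_def)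
  then have 1: "has_pdiff (0, 1) (\<lambda>y. h (fst y, - snd y)) (x, - r) (- dr h (x, r))"
    by (simp add: has_pdiff_def)
  have "has_pdiff (0, 1) h (x, - r) (- dr h (x, r))"
    by (rule has_pdiff_cong[OF 1 dir_open_U r_in_V reflect[OF xr]])
      (use assms reflect in \<open>auto simp: smooth_even_def\<close>)
  then show "dr h (x, - r) = - dr h (x, r)" by (rule has_pdiff_imp_pdiff)
qed

lemma smooth_even_dx: assumes "smooth_even h" "i \<le> p" shows "smooth_even (dx i h)"
  unfolding smooth_even_def
proof (intro conjI allI impI)
  show "smooth (dx i h)" using assms smooth_pdiff e_in_V by (auto simp: smooth_even_def)
  fix x r assume xr: "(x, r) \<in> U"
  have h: "smooth h" using assms by (simp add: smooth_even_def)
  have "has_pdiff (gen i, 0) h (x, r) (dx i h (x, r))"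
    by (rule smooth_has_pdiff[OF h e_in_V[OF assms(2)] xr])
  then have 1: "has_pdiff (gen i, 0) (\<lambda>y. h (fst y, - snd y)) (x, - r) (dx i h (x, r))"
    by (simp add: has_pdiff_def)
  have "has_pdiff (gen i, 0) h (x, - r) (dx i h (x, r))"
    by (rule has_pdiff_cong[OF 1 dir_open_U e_in_V[OF assms(2)] reflect[OF xr]])
      (use assms reflect in \<open>auto simp: smooth_even_def\<close>)
  then show "dx i h (x, - r) = dx i h (x, r)" by (rule has_pdiff_imp_pdiff)
qed

lemma radius_rquot: assumes "smooth_odd g" "y \<in> U" shows "snd y *\<^sub>R rquot g y = g y"
  using odd_at_0[OF assms(1), of "fst y"] assms(2) by (cases y) (auto simp: rquot_def)

text \<open>Away from \<open>r = 0\<close> the quotient is a product of smooth functions. Near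
  \<open>r = 0\<close> it is the average of \<open>dr g\<close> over the radial segment, by the
  fundamental theorem and the vanishing of an odd function at \<open>r = 0\<close>, so no division
  is left.\<close>

lemma smooth_rquot: assumes "smooth_odd g" shows "smooth (rquot g)"
  unfolding smooth_def
proof (rule allI, rule Ck_on_local[OF open_U])
  fix k and y :: "'n clifford \<times> real"
  assume yU: "y \<in> U"
  have g: "\<And>k. Ck_on V k U g" using assms by (simp add: smooth_odd_def smooth_def)
  show "\<exists>W. open W \<and> y \<in> W \<and> Ck_on V k (W \<inter> U) (rquot g)"
  proof (cases "snd y = 0")
    case False
    define W where "W = snd -` (- {0 :: real}) \<inter> U"
    have W: "open W" unfolding W_def
      by (intro open_Int open_U open_vimage continuous_on_snd continuous_on_id) auto
    have "Ck_on V k W (\<lambda>y. inverse (snd y) ^ Suc 0 *\<^sub>R g y)"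
      by (rule Ck_on_bilinear[OF open_dir_open[OF W] bounded_bilinear_scaleR
            Ck_on_inverse_snd[OF W] Ck_on_subset[OF g]]) (auto simp: W_def)
    then have "Ck_on V k W (rquot g)"
      by (rule Ck_on_cong[OF _ open_dir_open[OF W]]) (auto simp: rquot_def W_def)
    moreover have "W \<inter> U = W" by (auto simp: W_def)
    ultimately show ?thesis using W False yU by (intro exI[of _ W]) (auto simp: W_def)
  next
    case True
    then obtain x where y: "y = (x, 0)" by (cases y) auto
    obtain e where e: "e > 0" "ball (x, 0) e \<subseteq> U"
      using open_U yU y open_contains_ball by metis
    \<comment> \<open>A ball centred at radius \<open>0\<close> contains with each point its radial
      segment, as \<open>Ck_on_radial_average\<close> requires.\<close>
    define W where "W = ball (x, 0 :: real) e"
    have W: "open W" "W \<subseteq> U" using e by (auto simp: W_def)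
    have star: "(x', t * r) \<in> W" if "(x', r) \<in> W" "0 \<le> t" "t \<le> 1" for x' r t
    proof -
      have "\<bar>t * r\<bar> \<le> 1 * \<bar>r\<bar>" unfolding abs_mult using that by (intro mult_right_mono) auto
      then have "(t * r)\<^sup>2 \<le> r\<^sup>2" by (simp only: abs_le_square_iff mult_1)
      then have "norm (x - x', - (t * r)) \<le> norm (x - x', - r)"
        by (simp add: norm_prod_def)
      then show ?thesis using that(1) by (simp add: W_def dist_norm)
    qed
    have "Ck_on V (Suc k) W g" by (rule Ck_on_subset[OF g W(2)])
    then have drg: "Ck_on V k W (dr g)" using r_in_V by simp
    have "Ck_on V k W (\<lambda>y. integral (cbox 0 1) (\<lambda>t. t ^ 0 *\<^sub>R dr g (fst y, t * snd y)))"
      by (rule Ck_on_radial_average[where G = "dr g" and j = 0, OF W(1) _ drg]) (rule star)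
    then have "Ck_on V k W (rquot g)"
    proof (rule Ck_on_cong[OF _ open_dir_open[OF W(1)]])
      fix z assume zW: "z \<in> W"
      obtain x' r where z: "z = (x', r)" by (cases z)
      have inU: "(x', t * r) \<in> U" if "t \<in> {0..1}" for t
        using star[of x' r t] zW that W(2) by (auto simp: z)
      have "((\<lambda>t. r *\<^sub>R dr g (x', t * r)) has_integral g (x', 1 * r) - g (x', 0 * r)) {0..1}"
      proof (rule fundamental_theorem_of_calculus)
        fix t :: real assume t: "t \<in> {0..1}"
        have "has_pdiff (0, 1) g (x', t * r) (dr g (x', t * r))"
          by (rule Ck_on_has_pdiff[OF g[of "Suc 0"] r_in_V inU[OF t]])
        then have "has_pdiff (0, r) g (x', t * r) (r *\<^sub>R dr g (x', t * r))"
          using has_pdiff_scale_dir[of "(0, 1)" g "(x', t * r)" _ r] by simp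
        then have "has_pdiff (0, r) g ((x', 0) + t *\<^sub>R (0, r)) (r *\<^sub>R dr g (x', t * r))"
          by simp
        then have "((\<lambda>t. g (x', t * r)) has_vector_derivative r *\<^sub>R dr g (x', t * r)) (at t)"
          unfolding has_pdiff_shift by simp
        then show "((\<lambda>t. g (x', t * r)) has_vector_derivative r *\<^sub>R dr g (x', t * r)) (at t within {0..1})"
          by (rule has_vector_derivative_at_within)
      qed simp
      from integral_unique[OF this]
      have "integral {0..1} (\<lambda>t. r *\<^sub>R dr g (x', t * r)) = g (x', r)"
        using odd_at_0[OF assms, of x'] inU[of 0] by (simp del: integral_cmul)
      then have "r *\<^sub>R integral {0..1} (\<lambda>t. dr g (x', t * r)) = g (x', r)"
        by (simp add: integral_cmul)
      \<comment> \<open>For \<open>r = 0\<close> the average is \<open>dr g\<close> itself, the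
        value that \<open>rquot\<close> prescribes there.\<close>
      from this[symmetric]
      show "integral (cbox 0 1) (\<lambda>t. t ^ 0 *\<^sub>R dr g (fst z, t * snd z)) = rquot g z"
        by (auto simp: z rquot_def)
    qed
    moreover have "W \<inter> U = W" using W by blast
    ultimately show ?thesis using W e by (intro exI[of _ W]) (auto simp: W_def y)
  qed
qed

lemma smooth_even_rquot: assumes "smooth_odd g" shows "smooth_even (rquot g)"
  using assms smooth_rquot[OF assms]
  by (auto simp: smooth_even_def smooth_odd_def rquot_def)

lemma smooth_even_rderiv: "smooth_even h \<Longrightarrow> smooth_even (rderiv h)"
  by (intro smooth_even_rquot smooth_even_dr)

lemma radius_rderiv: "smooth_even h \<Longrightarrow> y \<in> U \<Longrightarrow> dr h y = snd y *\<^sub>R rderiv h y"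
  using radius_rquot[OF smooth_even_dr] by simp

text \<open>Where the radius is nonzero the factor cancels. A point of radius \<open>0\<close> is a
  limit of such points along the radial direction, and continuity carries the equation over.\<close>

lemma cancel_radius:
  assumes "continuous_on U u" "continuous_on U v"
    and eq: "\<And>y. y \<in> U \<Longrightarrow> snd y *\<^sub>R u y = snd y *\<^sub>R (v y :: 'b :: real_normed_vector)" and y: "y \<in> U"
  shows "u y = v y"
proof (cases "snd y = 0")
  case False
  then show ?thesis using eq[OF y] by simp
next
  case True
  have lim: "((\<lambda>t. y + t *\<^sub>R (0, 1)) \<longlongrightarrow> y + 0 *\<^sub>R (0, 1)) (at (0::real))"
    by (intro tendsto_intros)
  then have lim: "((\<lambda>t. y + t *\<^sub>R (0, 1)) \<longlongrightarrow> y) (at (0::real))"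
    by (simp only: scaleR_zero_left add_0_right)
  have "isCont u y" "isCont v y"
    using assms(1,2) y open_U continuous_on_eq_continuous_at by blast+
  then have lims: "((\<lambda>t. u (y + t *\<^sub>R (0, 1))) \<longlongrightarrow> u y) (at 0)" "((\<lambda>t. v (y + t *\<^sub>R (0, 1))) \<longlongrightarrow> v y) (at 0)"
    using isCont_tendsto_compose[OF _ lim] by blast+
  have eq': "\<forall>\<^sub>F t in at 0. u (y + t *\<^sub>R (0, 1)) = v (y + t *\<^sub>R (0, 1))"
  proof -
    have "\<forall>\<^sub>F t in at 0. y + t *\<^sub>R (0, 1) \<in> U"
      using topological_tendstoD[OF lim open_U y] .
    moreover have "\<forall>\<^sub>F t in at (0::real). t \<noteq> 0" by (simp add: eventually_at_filter)
    ultimately show ?thesis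
    proof eventually_elim
      case (elim t)
      then show ?case using eq[OF elim(1)] True by simp
    qed
  qed
  have "((\<lambda>t. v (y + t *\<^sub>R (0, 1))) \<longlongrightarrow> u y) (at 0)"
    using lims(1) tendsto_cong[OF eq'] by simp
  then show ?thesis using tendsto_unique[OF at_neq_bot _ lims(2)] by blast
qed

end

section \<open>Radial derivatives of harmonic stem functions\<close>

context stem_domain
begin

definition stem_lap :: "('n clifford \<times> real \<Rightarrow> 'n clifford) \<Rightarrow> 'n clifford \<times> real \<Rightarrow> 'n clifford" where
  "stem_lap h y = (\<Sum>i=0..p. dx i (dx i h) y) + dr (dr h) y"

definition dbar :: "('n clifford \<times> real \<Rightarrow> 'n clifford) \<Rightarrow> 'n clifford \<times> real \<Rightarrow> 'n clifford" where
  "dbar h y = (\<Sum>i=0..p. cconj (gen i) * dx i h y)"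

lemma smooth_dbar: "smooth h \<Longrightarrow> smooth (dbar h)"
  unfolding dbar_def
  by (intro smooth_sum smooth_linear[OF bounded_linear_clifford_mult_right] smooth_pdiff e_in_V) auto

lemma smooth_stem_lap: "smooth h \<Longrightarrow> smooth (stem_lap h)"
  unfolding stem_lap_def by (intro smooth_add smooth_sum smooth_pdiff e_in_V r_in_V) auto

lemma pdiff_radius_scale:
  assumes "smooth h" "v \<in> V" "y \<in> U"
  shows "pdiff v (\<lambda>y. snd y *\<^sub>R h y) y = snd y *\<^sub>R pdiff v h y + snd v *\<^sub>R h y"
  by (rule has_pdiff_imp_pdiff, rule has_pdiff_bilinear[OF bounded_bilinear_scaleR
        has_pdiff_linear_fun[OF bounded_linear_snd] smooth_has_pdiff[OF assms]])

lemma dbar_cong: "y \<in> U \<Longrightarrow> (\<And>y. y \<in> U \<Longrightarrow> f y = g y) \<Longrightarrow> dbar f y = dbar g y"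
  unfolding dbar_def by (intro sum.cong refl arg_cong2[where f = "(*)"] pdiff_cong_U e_in_V) auto

lemma stem_lap_cong:
  assumes y: "y \<in> U" and eq: "\<And>y. y \<in> U \<Longrightarrow> f y = g y"
  shows "stem_lap f y = stem_lap g y"
proof -
  have "pdiff v (pdiff v f) y = pdiff v (pdiff v g) y" if "v \<in> V" for v
    by (rule pdiff_cong_U[OF that y]) (rule pdiff_cong_U[OF that _ eq])
  then show ?thesis unfolding stem_lap_def using e_in_V r_in_V by auto
qed

lemma dbar_radius_scale:
  assumes "smooth h" "y \<in> U" shows "dbar (\<lambda>y. snd y *\<^sub>R h y) y = snd y *\<^sub>R dbar h y"
  unfolding dbar_def scaleR_sum_right
  by (intro sum.cong refl) (simp add: pdiff_radius_scale[OF assms(1) e_in_V assms(2)])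

text \<open>Only radial derivatives see the factor \<open>snd y\<close>; the product rule for the
  second one leaves twice \<open>dr h\<close>.\<close>

lemma stem_lap_radius_scale:
  assumes h: "smooth h" and y: "y \<in> U"
  shows "stem_lap (\<lambda>y. snd y *\<^sub>R h y) y = snd y *\<^sub>R stem_lap h y + 2 *\<^sub>R dr h y"
proof -
  have e: "dx i (dx i (\<lambda>y. snd y *\<^sub>R h y)) y = snd y *\<^sub>R dx i (dx i h) y" if i: "i \<le> p" for i
  proof -
    have "dx i (dx i (\<lambda>y. snd y *\<^sub>R h y)) y = dx i (\<lambda>y. snd y *\<^sub>R dx i h y) y"
      by (rule pdiff_cong_U[OF e_in_V[OF i] y]) (simp add: pdiff_radius_scale[OF h e_in_V[OF i]])
    also have "\<dots> = snd y *\<^sub>R dx i (dx i h) y"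
      by (simp add: pdiff_radius_scale[OF smooth_pdiff[OF h e_in_V[OF i]] e_in_V[OF i] y])
    finally show ?thesis .
  qed
  have "dr (dr (\<lambda>y. snd y *\<^sub>R h y)) y = dr (\<lambda>y. snd y *\<^sub>R dr h y + h y) y"
    by (rule pdiff_cong_U[OF r_in_V y]) (simp add: pdiff_radius_scale[OF h r_in_V])
  also have "\<dots> = (snd y *\<^sub>R dr (dr h) y + dr h y) + dr h y"
  proof (rule has_pdiff_imp_pdiff, rule has_pdiff_add)
    show "has_pdiff (0, 1) (\<lambda>y. snd y *\<^sub>R dr h y) y (snd y *\<^sub>R dr (dr h) y + dr h y)"
      using pdiff_radius_scale[OF smooth_pdiff[OF h r_in_V] r_in_V y]
        smooth_has_pdiff[OF smooth_radius_scale[OF smooth_pdiff[OF h r_in_V]] r_in_V y] by simp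
  qed (rule smooth_has_pdiff[OF h r_in_V y])
  finally show ?thesis
    unfolding stem_lap_def using e by (simp add: scaleR_sum_right scaleR_add_right scaleR_2)
qed

lemma dr_dbar: assumes h: "smooth h" and y: "y \<in> U" shows "dr (dbar h) y = dbar (dr h) y"
proof -
  have "has_pdiff (0, 1) (dbar h) y (\<Sum>i=0..p. cconj (gen i) * dr (dx i h) y)"
    unfolding dbar_def
    by (rule has_pdiff_sum_mult) (intro smooth_has_pdiff smooth_pdiff h y e_in_V r_in_V, auto)
  then show ?thesis
    using has_pdiff_imp_pdiff smooth_commute[OF h r_in_V e_in_V y] by (simp add: dbar_def)
qed

lemma dr_stem_lap: assumes h: "smooth h" and y: "y \<in> U" shows "dr (stem_lap h) y = stem_lap (dr h) y"
proof -
  have e: "dr (dx i (dx i h)) y = dx i (dx i (dr h)) y" if i: "i \<le> p" for i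
  proof -
    have "dr (dx i (dx i h)) y = dx i (dr (dx i h)) y"
      by (rule smooth_commute[OF smooth_pdiff[OF h e_in_V[OF i]] r_in_V e_in_V[OF i] y])
    also have "\<dots> = dx i (dx i (dr h)) y"
      by (rule pdiff_cong_U[OF e_in_V[OF i] y]) (rule smooth_commute[OF h r_in_V e_in_V[OF i]])
    finally show ?thesis .
  qed
  have "has_pdiff (0, 1) (stem_lap h) y ((\<Sum>i=0..p. dr (dx i (dx i h)) y) + dr (dr (dr h)) y)"
    unfolding stem_lap_def
    by (intro has_pdiff_add has_pdiff_sum smooth_has_pdiff smooth_pdiff h y e_in_V r_in_V) auto
  then show ?thesis using has_pdiff_imp_pdiff e by (simp add: stem_lap_def)
qed

lemma smooth_even_smooth: "smooth_even h \<Longrightarrow> smooth h" and smooth_odd_smooth: "smooth_odd h \<Longrightarrow> smooth h"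
  by (simp_all add: smooth_even_def smooth_odd_def)

text \<open>Since \<open>g\<close> is the radius times \<open>rquot g\<close>, the product rule
  turns its vanishing Laplacian into an equation with a common factor \<open>snd y\<close>, which
  \<open>cancel_radius\<close> removes.\<close>

lemma stem_lap_rquot:
  assumes g: "smooth_odd g" and harm: "\<And>y. y \<in> U \<Longrightarrow> stem_lap g y = 0" and y: "y \<in> U"
  shows "stem_lap (rquot g) y = - 2 *\<^sub>R rderiv (rquot g) y"
proof (rule cancel_radius[OF _ _ _ y])
  note e = smooth_even_rquot[OF g]
  note s = smooth_even_smooth[OF e]
  show "continuous_on U (stem_lap (rquot g))" by (rule smooth_continuous[OF smooth_stem_lap[OF s]])
  show "continuous_on U (\<lambda>y. - 2 *\<^sub>R rderiv (rquot g) y)"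
    by (intro continuous_intros smooth_continuous smooth_even_smooth smooth_even_rderiv e)
  fix y assume y: "y \<in> U"
  have "0 = stem_lap (\<lambda>y. snd y *\<^sub>R rquot g y) y"
    using harm[OF y] stem_lap_cong[OF y, of "\<lambda>y. snd y *\<^sub>R rquot g y" g] radius_rquot[OF g] by simp
  then show "snd y *\<^sub>R stem_lap (rquot g) y = snd y *\<^sub>R - 2 *\<^sub>R rderiv (rquot g) y"
    unfolding stem_lap_radius_scale[OF s y] radius_rderiv[OF e y]
    by (simp add: eq_neg_iff_add_eq_0 mult.commute)
qed

text \<open>Differentiating the hypothesis in \<open>r\<close> gives the Laplacian of
  \<open>dr h\<close>, which is the radius times \<open>rderiv h\<close>. The cross term of the
  product rule raises the constant by \<open>2\<close>.\<close>

lemma stem_lap_rderiv: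
  assumes h: "smooth_even h" and harm: "\<And>y. y \<in> U \<Longrightarrow> stem_lap h y = - c *\<^sub>R rderiv h y" and y: "y \<in> U"
  shows "stem_lap (rderiv h) y = - (c + 2) *\<^sub>R rderiv (rderiv h) y"
proof (rule cancel_radius[OF _ _ _ y])
  note e = smooth_even_rderiv[OF h]
  note s = smooth_even_smooth[OF e]
  show "continuous_on U (stem_lap (rderiv h))" by (rule smooth_continuous[OF smooth_stem_lap[OF s]])
  show "continuous_on U (\<lambda>y. - (c + 2) *\<^sub>R rderiv (rderiv h) y)"
    by (intro continuous_intros smooth_continuous smooth_even_smooth smooth_even_rderiv h)
  fix y assume y: "y \<in> U"
  have "stem_lap (\<lambda>y. snd y *\<^sub>R rderiv h y) y = stem_lap (dr h) y"
    by (rule stem_lap_cong[OF y]) (simp add: radius_rderiv[OF h])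
  also have "\<dots> = dr (stem_lap h) y" by (rule dr_stem_lap[OF smooth_even_smooth[OF h] y, symmetric])
  also have "\<dots> = dr (\<lambda>y. - c *\<^sub>R rderiv h y) y" by (rule pdiff_cong_U[OF r_in_V y harm])
  also have "\<dots> = - c *\<^sub>R dr (rderiv h) y"
    by (rule has_pdiff_imp_pdiff, rule has_pdiff_linear[OF bounded_linear_scaleR_right])
      (rule smooth_has_pdiff[OF s r_in_V y])
  finally show "snd y *\<^sub>R stem_lap (rderiv h) y = snd y *\<^sub>R - (c + 2) *\<^sub>R rderiv (rderiv h) y"
    unfolding stem_lap_radius_scale[OF s y] radius_rderiv[OF e y]
    by (simp add: algebra_simps eq_neg_iff_add_eq_0)
qed

lemma dbar_rquot:
  assumes g: "smooth_odd g" and h: "smooth_even h"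
    and CR: "\<And>y. y \<in> U \<Longrightarrow> dbar g y = - dr h y" and y: "y \<in> U"
  shows "dbar (rquot g) y = - rderiv h y"
proof (rule cancel_radius[OF _ _ _ y])
  note s = smooth_even_smooth[OF smooth_even_rquot[OF g]]
  show "continuous_on U (dbar (rquot g))" by (rule smooth_continuous[OF smooth_dbar[OF s]])
  show "continuous_on U (\<lambda>y. - rderiv h y)"
    by (intro continuous_intros smooth_continuous smooth_even_smooth smooth_even_rderiv h)
  fix y assume y: "y \<in> U"
  have "dbar (\<lambda>y. snd y *\<^sub>R rquot g y) y = dbar g y"
    by (rule dbar_cong[OF y]) (rule radius_rquot[OF g])
  then show "snd y *\<^sub>R dbar (rquot g) y = snd y *\<^sub>R - rderiv h y"
    unfolding dbar_radius_scale[OF s y] CR[OF y] radius_rderiv[OF h y] by simp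
qed

text \<open>Since \<open>rderiv g\<close> is \<open>rquot (dr g)\<close>, this is
  \<open>dbar_rquot\<close> for the odd function \<open>dr g\<close>, once the hypothesis is
  differentiated in \<open>r\<close>.\<close>

lemma dbar_rderiv:
  assumes g: "smooth_even g" and h: "smooth_even h"
    and CR: "\<And>y. y \<in> U \<Longrightarrow> dbar g y = - rderiv h y" and y: "y \<in> U"
  shows "dbar (rderiv g) y = - rderiv (rderiv h) y"
proof (rule dbar_rquot[OF smooth_even_dr[OF g] smooth_even_rderiv[OF h] _ y])
  fix y assume y: "y \<in> U"
  have "dbar (dr g) y = dr (dbar g) y" by (rule dr_dbar[OF smooth_even_smooth[OF g] y, symmetric])
  also have "\<dots> = dr (\<lambda>y. - rderiv h y) y" by (rule pdiff_cong_U[OF r_in_V y CR])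
  also have "\<dots> = - dr (rderiv h) y"
    by (rule has_pdiff_imp_pdiff, rule has_pdiff_linear[OF bounded_linear_minus[OF bounded_linear_ident]])
      (rule smooth_has_pdiff[OF smooth_even_smooth[OF smooth_even_rderiv[OF h]] r_in_V y])
  finally show "dbar (dr g) y = - dr (rderiv h) y" .
qed

section \<open>Partially radial functions\<close>

text \<open>Coordinates beyond the paravectors are unrestricted, which makes the set open in the
  whole algebra; in the application it contains the completion.\<close>

definition lift_dom :: "'n clifford set" where
  "lift_dom = {x. (ppart p x, norm (qpart p q x)) \<in> U}"

definition lift :: "('n clifford \<times> real \<Rightarrow> 'n clifford) \<Rightarrow> 'n clifford \<Rightarrow> 'n clifford" where
  "lift h x = h (ppart p x, norm (qpart p q x))"

lemma open_lift_dom: "open lift_dom"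
proof -
  have "continuous_on UNIV (\<lambda>x :: 'n clifford. (ppart p x, norm (qpart p q x)))"
    by (intro continuous_intros)
  then have "open ((\<lambda>x. (ppart p x, norm (qpart p q x))) -` U)" by (rule open_vimage[OF open_U])
  then show ?thesis by (simp add: lift_dom_def vimage_def)
qed

lemma continuous_on_lift: assumes "continuous_on U h" shows "continuous_on lift_dom (lift h)"
  unfolding lift_def
  by (rule continuous_on_compose2[OF assms]) (intro continuous_intros, auto simp: lift_dom_def)

lemma has_pdiff_lift_p:
  assumes h: "smooth h" and i: "i \<le> p" and x: "x \<in> lift_dom"
  shows "has_pdiff (gen i) (lift h) x (lift (dx i h) x)"
proof -
  have eq: "(ppart p (x + t *\<^sub>R gen i), norm (qpart p q (x + t *\<^sub>R gen i))) =
      (ppart p x, norm (qpart p q x)) + t *\<^sub>R (gen i, 0)" for t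
    using i dim by (simp add: ppart_simps qpart_simps ppart_gen qpart_gen)
  have "has_pdiff (gen i, 0) h (ppart p x, norm (qpart p q x)) (lift (dx i h) x)"
    unfolding lift_def by (rule smooth_has_pdiff[OF h e_in_V[OF i]]) (use x in \<open>simp add: lift_dom_def\<close>)
  then show ?thesis
    unfolding has_pdiff_def lift_def eq .
qed

lemma inner_qpart_gen:
  assumes "p < i" "i \<le> p + q"
  shows "inner (qpart p q x) (gen i) = inner x (gen i :: 'n clifford)"
proof -
  have "inner (qpart p q x) (gen i) = (\<Sum>j=p+1..p+q. if j = i then inner x (gen i) else 0)"
    unfolding qpart_def inner_sum_left
    by (intro sum.cong refl) (use assms dim in \<open>simp add: inner_gen_gen\<close>)
  then show ?thesis using assms by simp
qed

lemma norm_qpart: "(\<Sum>i=p+1..p+q. (inner x (gen i))\<^sup>2) = (norm (qpart p q x :: 'n clifford))\<^sup>2"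
proof -
  have "(norm (qpart p q x))\<^sup>2 = inner (qpart p q x) (\<Sum>i=p+1..p+q. inner x (gen i) *\<^sub>R gen i)"
    by (simp add: power2_norm_eq_inner qpart_def)
  also have "\<dots> = (\<Sum>i=p+1..p+q. (inner x (gen i))\<^sup>2)"
    unfolding inner_sum_right
    by (intro sum.cong refl) (simp add: inner_qpart_gen power2_eq_square)
  finally show ?thesis by simp
qed

text \<open>Where \<open>qpart p q x\<close> is nonzero this is the chain rule, the factor
  \<open>1 / r\<close> from the norm cancelling the \<open>r\<close> in \<open>dr h\<close>.
  Elsewhere the norm is not differentiable, but evenness of \<open>h\<close> allows replacing it by
  the signed parameter, and both sides vanish.\<close>

lemma has_pdiff_lift_q:
  assumes h: "smooth_even h" and i: "p < i" "i \<le> p + q" and x: "x \<in> lift_dom"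
  shows "has_pdiff (gen i) (lift h) x (inner x (gen i) *\<^sub>R lift (rderiv h) x)"
proof -
  let ?e = "gen i :: 'n clifford"
  define r where "r = norm (qpart p q x)"
  have yU: "(ppart p x, r) \<in> U" using x by (simp add: lift_dom_def r_def)
  have eq: "(\<lambda>t. lift h (x + t *\<^sub>R ?e)) = (\<lambda>t. h (ppart p x, norm (qpart p q x + t *\<^sub>R ?e)))"
    using i dim by (simp add: lift_def ppart_simps qpart_simps ppart_gen qpart_gen fun_eq_iff)
  have d: "has_pdiff (0, 1) h (ppart p x, r) (r *\<^sub>R lift (rderiv h) x)"
    using smooth_has_pdiff[OF smooth_even_smooth[OF h] r_in_V yU] radius_rderiv[OF h yU]
    by (simp add: lift_def r_def)
  show ?thesis
  proof (cases "qpart p q x = 0")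
    case True
    then have r0: "r = 0" by (simp add: r_def)
    have xe: "inner x ?e = 0" using inner_qpart_gen[OF i, of x] True by simp
    have ne: "norm ?e = 1" using inner_gen_gen[where 'n = 'n, of i i] i dim by (simp add: norm_eq_sqrt_inner)
    have "has_pdiff (0, 1) h (ppart p x, 0) 0" using d r0 by simp
    then have 1: "((\<lambda>t. h (ppart p x, t)) has_vector_derivative 0) (at 0)"
      by (simp add: has_pdiff_def)
    have "\<forall>\<^sub>F t in nhds (0::real). (ppart p x, 0) + t *\<^sub>R (0, 1) \<in> U"
      using dir_openD[OF dir_open_U, of "(ppart p x, 0)" "(0, 1)" UNIV] yU r0 by simp
    then have ev: "\<forall>\<^sub>F t in nhds (0::real). (ppart p x, t) \<in> U" by simp
    have "has_pdiff 1 (\<lambda>t. h (ppart p x, \<bar>t\<bar>)) 0 0"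
    proof (rule has_pdiff_transform)
      show "has_pdiff 1 (\<lambda>t. h (ppart p x, t)) 0 0" using 1 by (simp add: has_pdiff_def)
      show "\<forall>\<^sub>F t in nhds 0. h (ppart p x, 0 + t *\<^sub>R 1) = h (ppart p x, \<bar>0 + t *\<^sub>R 1\<bar>)"
        using ev
      proof eventually_elim
        case (elim t)
        then show ?case using h by (cases "t \<ge> 0") (auto simp: smooth_even_def)
      qed
    qed
    then show ?thesis
      unfolding has_pdiff_def eq using True xe ne by simp
  next
    case False
    then have r: "r > 0" by (simp add: r_def)
    have "((\<lambda>t. norm (qpart p q x + t *\<^sub>R ?e)) has_real_derivative inner x ?e / r) (at 0)"
    proof -
      have "((\<lambda>t. inner (qpart p q x + t *\<^sub>R ?e) (qpart p q x + t *\<^sub>R ?e)) has_real_derivative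
          2 * inner (qpart p q x) ?e) (at 0)"
        unfolding inner_add_left inner_add_right inner_scaleR_left inner_scaleR_right
        by (auto intro!: derivative_eq_intros simp: inner_commute)
      moreover have "(sqrt has_real_derivative inverse (sqrt (inner (qpart p q x) (qpart p q x))) / 2)
          (at (inner (qpart p q x + 0 *\<^sub>R ?e) (qpart p q x + 0 *\<^sub>R ?e)))"
        using DERIV_real_sqrt[of "inner (qpart p q x) (qpart p q x)"] False by simp
      ultimately have "((\<lambda>t. sqrt (inner (qpart p q x + t *\<^sub>R ?e) (qpart p q x + t *\<^sub>R ?e))) has_real_derivative
          inverse (sqrt (inner (qpart p q x) (qpart p q x))) / 2 * (2 * inner (qpart p q x) ?e)) (at 0)"
        by (rule DERIV_chain2[rotated])
      then show ?thesis
        using inner_qpart_gen[OF i, of x] by (simp add: norm_eq_sqrt_inner r_def field_simps)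
    qed
    moreover have "((\<lambda>s. h (ppart p x, s)) has_vector_derivative r *\<^sub>R lift (rderiv h) x)
        (at (norm (qpart p q x + 0 *\<^sub>R ?e)))"
      using d has_pdiff_shift[of "(0, 1)" h "(ppart p x, 0)" r] by (simp add: r_def)
    ultimately have "(((\<lambda>s. h (ppart p x, s)) \<circ> (\<lambda>t. norm (qpart p q x + t *\<^sub>R ?e))) has_vector_derivative
        (inner x ?e / r) *\<^sub>R r *\<^sub>R lift (rderiv h) x) (at 0)"
      unfolding has_real_derivative_iff_has_vector_derivative by (rule vector_diff_chain_at)
    then show ?thesis
      unfolding has_pdiff_def eq using r by (simp add: o_def)
  qed
qed

abbreviation G :: "'n clifford set" where "G \<equiv> gen ` {0..p + q}"

lemma dir_open_lift_dom: "dir_open W lift_dom"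
  by (rule open_dir_open[OF open_lift_dom])

text \<open>Up to a coordinate factor, the partial derivatives of a lift are again lifts of smooth
  even functions, so the induction ranges over all such \<open>h\<close>. This is where
  \<open>rderiv h\<close> is preferable to \<open>dr h\<close>, which is odd.\<close>

lemma Ck_on_lift: "smooth_even h \<Longrightarrow> Ck_on G k lift_dom (lift h)"
proof (induction k arbitrary: h)
  case 0
  then show ?case using continuous_on_lift[OF smooth_continuous[OF smooth_even_smooth]] by simp
next
  case (Suc k)
  have "\<exists>g. (\<forall>x\<in>lift_dom. has_pdiff v (lift h) x (g x)) \<and> Ck_on G k lift_dom g" if v: "v \<in> G" for v
  proof -
    obtain i where i: "i \<le> p + q" and v: "v = gen i" using v by auto
    show ?thesis
    proof (cases "i \<le> p")
      case True
      show ?thesis unfolding v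
        using has_pdiff_lift_p[OF smooth_even_smooth[OF Suc.prems] True]
          Suc.IH[OF smooth_even_dx[OF Suc.prems True]] by blast
    next
      case False
      have "Ck_on G k lift_dom (\<lambda>x. inner x (gen i) *\<^sub>R lift (rderiv h) x)"
        by (intro Ck_on_bilinear[OF dir_open_lift_dom bounded_bilinear_scaleR] Suc.IH
            smooth_even_rderiv Suc.prems Ck_on_linear_fun[OF dir_open_lift_dom] bounded_linear_inner_left)
      moreover have "has_pdiff (gen i) (lift h) x (inner x (gen i) *\<^sub>R lift (rderiv h) x)" if "x \<in> lift_dom" for x
        using has_pdiff_lift_q[OF Suc.prems _ i that] False by simp
      ultimately show ?thesis unfolding v
        by (intro exI[of _ "\<lambda>x. inner x (gen i) *\<^sub>R lift (rderiv h) x"] conjI ballI)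
    qed
  qed
  then have "\<forall>v\<in>G. \<exists>g. (\<forall>x\<in>lift_dom. has_pdiff v (lift h) x (g x)) \<and> Ck_on G k lift_dom g" by blast
  from bchoice[OF this] obtain g where g:
    "\<And>v x. v \<in> G \<Longrightarrow> x \<in> lift_dom \<Longrightarrow> has_pdiff v (lift h) x (g v x)"
    "\<And>v. v \<in> G \<Longrightarrow> Ck_on G k lift_dom (g v)" by blast
  show ?case
    by (rule Ck_on_SucI[OF dir_open_lift_dom _ g])
      (rule continuous_on_lift[OF smooth_continuous[OF smooth_even_smooth[OF Suc.prems]]])
qed

text \<open>Each of the \<open>q\<close> directions contributes one \<open>rderiv h\<close>, and the
  squared coordinates add up to \<open>r\<^sup>2\<close> times \<open>rderiv (rderiv h)\<close>. The
  radial part \<open>dr (dr h)\<close> of \<open>stem_lap\<close> already holds the latter and one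
  \<open>rderiv h\<close>, which leaves \<open>q - 1\<close> copies.\<close>

lemma laplacian_lift:
  assumes h: "smooth_even h" and x: "x \<in> lift_dom"
  shows "laplacian p q (lift h) x = lift (\<lambda>y. stem_lap h y + (real q - 1) *\<^sub>R rderiv h y) x"
proof -
  define y where "y = (ppart p x, norm (qpart p q x))"
  have y: "y \<in> U" using x by (simp add: lift_dom_def y_def)
  note h1 = smooth_even_rderiv[OF h]
  note h2 = smooth_even_rderiv[OF h1]
  have P: "pdiff (gen i) (pdiff (gen i) (lift h)) x = dx i (dx i h) y" if i: "i \<le> p" for i
  proof -
    have "pdiff (gen i) (pdiff (gen i) (lift h)) x = pdiff (gen i) (lift (dx i h)) x"
      by (rule pdiff_cong[OF dir_open_lift_dom UNIV_I x])
        (rule has_pdiff_imp_pdiff[OF has_pdiff_lift_p[OF smooth_even_smooth[OF h] i]])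
    also have "\<dots> = lift (dx i (dx i h)) x"
      by (rule has_pdiff_imp_pdiff[OF has_pdiff_lift_p[OF smooth_even_smooth[OF smooth_even_dx[OF h i]] i x]])
    finally show ?thesis by (simp add: lift_def y_def)
  qed
  have Q: "pdiff (gen i) (pdiff (gen i) (lift h)) x =
      (inner x (gen i))\<^sup>2 *\<^sub>R rderiv (rderiv h) y + rderiv h y" if i: "p < i" "i \<le> p + q" for i
  proof -
    have "pdiff (gen i) (pdiff (gen i) (lift h)) x = pdiff (gen i) (\<lambda>x. inner x (gen i) *\<^sub>R lift (rderiv h) x) x"
      by (rule pdiff_cong[OF dir_open_lift_dom UNIV_I x])
        (rule has_pdiff_imp_pdiff[OF has_pdiff_lift_q[OF h i]])
    also have "\<dots> = inner x (gen i) *\<^sub>R (inner x (gen i) *\<^sub>R lift (rderiv (rderiv h)) x)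
        + inner (gen i) (gen i :: 'n clifford) *\<^sub>R lift (rderiv h) x"
      by (rule has_pdiff_imp_pdiff, rule has_pdiff_bilinear[OF bounded_bilinear_scaleR
            has_pdiff_linear_fun[OF bounded_linear_inner_left] has_pdiff_lift_q[OF h1 i x]])
    finally show ?thesis
      using i dim by (simp add: lift_def y_def inner_gen_gen power2_eq_square)
  qed
  have "dr (dr h) y = dr (\<lambda>y. snd y *\<^sub>R rderiv h y) y"
    by (rule pdiff_cong_U[OF r_in_V y radius_rderiv[OF h]])
  also have "\<dots> = snd y *\<^sub>R (snd y *\<^sub>R rderiv (rderiv h) y) + rderiv h y"
    by (simp add: pdiff_radius_scale[OF smooth_even_smooth[OF h1] r_in_V y] radius_rderiv[OF h1 y])
  finally have R: "dr (dr h) y = (norm (qpart p q x))\<^sup>2 *\<^sub>R rderiv (rderiv h) y + rderiv h y"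
    by (simp add: y_def power2_eq_square)
  have "laplacian p q (lift h) x = (\<Sum>i=0..p. pdiff (gen i) (pdiff (gen i) (lift h)) x)
      + (\<Sum>i=p+1..p+q. pdiff (gen i) (pdiff (gen i) (lift h)) x)"
    unfolding laplacian_def using sum.ub_add_nat[of 0 p "\<lambda>i. pdiff (gen i) (pdiff (gen i) (lift h)) x" q]
    by simp
  also have "\<dots> = (\<Sum>i=0..p. dx i (dx i h) y)
      + (\<Sum>i=p+1..p+q. (inner x (gen i))\<^sup>2 *\<^sub>R rderiv (rderiv h) y + rderiv h y)"
    using P Q by (intro arg_cong2[where f = "(+)"] sum.cong refl) auto
  also have "\<dots> = (\<Sum>i=0..p. dx i (dx i h) y) + ((norm (qpart p q x))\<^sup>2 *\<^sub>R rderiv (rderiv h) y + real q *\<^sub>R rderiv h y)"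
    by (simp add: sum.distrib scaleR_sum_left[symmetric] norm_qpart[simplified] sum_constant_scaleR
        del: sum_constant)
  also have "\<dots> = stem_lap h y + (real q - 1) *\<^sub>R rderiv h y"
    unfolding stem_lap_def R by (simp add: algebra_simps)
  finally show ?thesis by (simp add: lift_def y_def)
qed

lemma laplacian_cong:
  assumes "\<And>x. x \<in> lift_dom \<Longrightarrow> f x = g x" "x \<in> lift_dom"
  shows "laplacian p q f x = laplacian p q g x"
  unfolding laplacian_def
  by (intro sum.cong refl pdiff_cong[OF dir_open_lift_dom UNIV_I] assms)

lemma laplacian_scaleR:
  assumes f: "Ck_on G 2 lift_dom f" and x: "x \<in> lift_dom"
  shows "laplacian p q (\<lambda>x. c *\<^sub>R f x) x = c *\<^sub>R laplacian p q f x"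
proof -
  have f1: "Ck_on G (Suc (Suc 0)) lift_dom f" using f by (simp only: numeral_2_eq_2)
  have "pdiff v (pdiff v (\<lambda>x. c *\<^sub>R f x)) x = c *\<^sub>R pdiff v (pdiff v f) x" if v: "v \<in> G" for v
  proof -
    have "pdiff v (pdiff v (\<lambda>x. c *\<^sub>R f x)) x = pdiff v (\<lambda>x. c *\<^sub>R pdiff v f x) x"
      by (rule pdiff_cong[OF dir_open_lift_dom UNIV_I x], rule has_pdiff_imp_pdiff)
        (rule has_pdiff_linear[OF bounded_linear_scaleR_right Ck_on_has_pdiff[OF f1 v]])
    also have "\<dots> = c *\<^sub>R pdiff v (pdiff v f) x"
    proof -
      from has_pdiff_linear[OF bounded_linear_scaleR_right Ck_on_has_pdiff[OF Ck_on_pdiff[OF f1 v] v x]]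
      show ?thesis by (rule has_pdiff_imp_pdiff)
    qed
    finally show ?thesis .
  qed
  then show ?thesis unfolding laplacian_def scaleR_sum_right by (intro sum.cong refl) auto
qed

text \<open>The relation \<open>step\<close> holds only on the open set \<open>lift_dom\<close>, so
  each iteration first replaces the inner function by a multiple of a lift through
  \<open>laplacian_cong\<close> and then pulls out the constant.\<close>

lemma laplacian_power_lift:
  assumes S: "\<And>k. smooth_even (S k)"
    and step: "\<And>k x. x \<in> lift_dom \<Longrightarrow> laplacian p q (lift (S k)) x = c k *\<^sub>R lift (S (Suc k)) x"
    and x: "x \<in> lift_dom"
  shows "(laplacian p q ^^ j) (lift (S 0)) x = (\<Prod>k<j. c k) *\<^sub>R lift (S j) x"
  using x
proof (induction j arbitrary: x)
  case (Suc j)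
  have "(laplacian p q ^^ Suc j) (lift (S 0)) x = laplacian p q (\<lambda>x. (\<Prod>k<j. c k) *\<^sub>R lift (S j) x) x"
    using laplacian_cong[OF Suc.IH Suc.prems] by simp
  also have "\<dots> = (\<Prod>k<j. c k) *\<^sub>R (c j *\<^sub>R lift (S (Suc j)) x)"
    unfolding laplacian_scaleR[OF Ck_on_lift[OF S] Suc.prems] step[OF Suc.prems] ..
  finally show ?case by simp
qed simp

section \<open>Polyharmonicity\<close>

lemma smooth_even_cconj_mult: "smooth_even g \<Longrightarrow> smooth_even (\<lambda>y. cconj (fst y) * g y)"
  using smooth_cconj_mult by (auto simp: smooth_even_def)

lemma smooth_even_add: "smooth_even g \<Longrightarrow> smooth_even h \<Longrightarrow> smooth_even (\<lambda>y. g y + h y)"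
  using smooth_add by (auto simp: smooth_even_def)

lemma pdiff_cconj_mult:
  assumes "smooth g" "v \<in> V" "y \<in> U"
  shows "has_pdiff v (\<lambda>y. cconj (fst y) * g y) y (cconj (fst y) * pdiff v g y + cconj (fst v) * g y)"
  by (rule has_pdiff_bilinear[OF bounded_bilinear_clifford_mult
        has_pdiff_linear_fun[OF bounded_linear_cconj_fst] smooth_has_pdiff[OF assms]])

lemma cconj_0: "cconj (0 :: 'n clifford) = 0"
  by (rule linear_0[OF cconj_linear])

text \<open>The factor \<open>cconj (fst y)\<close> is linear, so besides the main term only cross
  terms appear; they add up to twice \<open>dbar g\<close>. The radial direction has none, its first
  component being zero.\<close>

lemma stem_lap_cconj_mult:
  assumes g: "smooth g" and y: "y \<in> U"
  shows "stem_lap (\<lambda>y. cconj (fst y) * g y) y = cconj (fst y) * stem_lap g y + 2 *\<^sub>R dbar g y"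
proof -
  have e: "pdiff v (pdiff v (\<lambda>y. cconj (fst y) * g y)) y =
      cconj (fst y) * pdiff v (pdiff v g) y + 2 *\<^sub>R (cconj (fst v) * pdiff v g y)" if v: "v \<in> V" for v
  proof -
    have "pdiff v (pdiff v (\<lambda>y. cconj (fst y) * g y)) y = pdiff v (\<lambda>y. cconj (fst y) * pdiff v g y + cconj (fst v) * g y) y"
      by (rule pdiff_cong_U[OF v y]) (rule has_pdiff_imp_pdiff[OF pdiff_cconj_mult[OF g v]])
    also have "\<dots> = (cconj (fst y) * pdiff v (pdiff v g) y + cconj (fst v) * pdiff v g y) + cconj (fst v) * pdiff v g y"
      by (rule has_pdiff_imp_pdiff, rule has_pdiff_add[OF pdiff_cconj_mult[OF smooth_pdiff[OF g v] v y]])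
        (rule has_pdiff_linear[OF bounded_linear_clifford_mult_right smooth_has_pdiff[OF g v y]])
    finally show ?thesis by (simp add: scaleR_2)
  qed
  have "(\<Sum>i=0..p. dx i (dx i (\<lambda>y. cconj (fst y) * g y)) y) =
    (\<Sum>i=0..p. cconj (fst y) * dx i (dx i g) y + 2 *\<^sub>R (cconj (gen i) * dx i g y))"
    by (intro sum.cong refl) (simp add: e[OF e_in_V])
  then show ?thesis
    unfolding stem_lap_def e[OF r_in_V] dbar_def
    by (simp add: sum.distrib sum_distrib_left scaleR_sum_right distrib_left cconj_0 add_ac)
qed

text \<open>The factor \<open>cconj (fst y)\<close> does not depend on the radius, so
  \<open>dr\<close> passes by it, and cancelling the radius extends this to
  \<open>rderiv\<close>.\<close>

lemma rderiv_add_cconj_mult: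
  assumes h: "smooth_even h" and g: "smooth_even g" and y: "y \<in> U"
  shows "rderiv (\<lambda>y. h y + cconj (fst y) * g y) y = rderiv h y + cconj (fst y) * rderiv g y"
proof (rule cancel_radius[OF _ _ _ y])
  let ?a = "\<lambda>y. h y + cconj (fst y) * g y"
  have a: "smooth_even ?a" by (intro smooth_even_add smooth_even_cconj_mult h g)
  show "continuous_on U (rderiv ?a)"
    by (rule smooth_continuous[OF smooth_even_smooth[OF smooth_even_rderiv[OF a]]])
  show "continuous_on U (\<lambda>y. rderiv h y + cconj (fst y) * rderiv g y)"
    by (intro smooth_continuous smooth_even_smooth smooth_even_add smooth_even_cconj_mult smooth_even_rderiv h g)
  fix y assume y: "y \<in> U"
  have "dr ?a y = dr h y + (cconj (fst y) * dr g y + cconj (fst (0, 1 :: real)) * g y)"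
    by (rule has_pdiff_imp_pdiff, rule has_pdiff_add[OF smooth_has_pdiff[OF smooth_even_smooth[OF h] r_in_V y]])
      (rule pdiff_cconj_mult[OF smooth_even_smooth[OF g] r_in_V y])
  then show "snd y *\<^sub>R rderiv ?a y = snd y *\<^sub>R (rderiv h y + cconj (fst y) * rderiv g y)"
    using radius_rderiv[OF a y] radius_rderiv[OF h y] radius_rderiv[OF g y]
    by (simp add: cconj_0 scaleR_add_right)
qed

lemma polyharmonic_lift:
  assumes F1: "smooth_even F1" and F2: "smooth_odd F2"
    and harm: "\<And>y. y \<in> U \<Longrightarrow> stem_lap F1 y = 0" "\<And>y. y \<in> U \<Longrightarrow> stem_lap F2 y = 0"
    and CR: "\<And>y. y \<in> U \<Longrightarrow> dbar F2 y = - dr F1 y"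
    and m: "q = 2 * m + 1" "m \<ge> 1" and x: "x \<in> lift_dom"
  shows "(laplacian p q ^^ m) (lift (rquot F2)) x = 0"
    and "(laplacian p q ^^ m) (lift (\<lambda>y. F1 y + cconj (fst y) * rquot F2 y)) x = 0"
proof -
  define H where "H = (\<lambda>k. (rderiv ^^ k) F1)"
  define K where "K = (\<lambda>k. (rderiv ^^ k) (rquot F2))"
  \<comment> \<open>The value is \<open>(q - 1) - (2 k + 2)\<close>: lifting contributes
    \<open>q - 1\<close>, and the stem Laplacians of \<open>K k\<close> and of \<open>A k\<close>
    below contribute \<open>- (2 k + 2)\<close>.\<close>
  define c where "c = (\<lambda>k. real q - 3 - 2 * real k)"
  have S: "H (Suc k) = rderiv (H k)" "K (Suc k) = rderiv (K k)" for k by (simp_all add: H_def K_def)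
  have eH: "smooth_even (H k)" for k
    by (induction k) (use F1 smooth_even_rderiv in \<open>simp_all add: H_def\<close>)
  have eK: "smooth_even (K k)" for k
    by (induction k) (use smooth_even_rquot[OF F2] smooth_even_rderiv in \<open>simp_all add: K_def\<close>)
  have LH: "stem_lap (H k) y = - (2 * real k) *\<^sub>R rderiv (H k) y" if "y \<in> U" for k y
    using that
  proof (induction k arbitrary: y)
    case 0
    then show ?case using harm(1) by (simp add: H_def)
  next
    case (Suc k)
    show ?case using stem_lap_rderiv[OF eH Suc.IH Suc.prems] by (simp add: S algebra_simps)
  qed
  have LK: "stem_lap (K k) y = - (2 * real k + 2) *\<^sub>R rderiv (K k) y" if "y \<in> U" for k y
    using that
  proof (induction k arbitrary: y)
    case 0
    then show ?case using stem_lap_rquot[OF F2 harm(2)] by (simp add: K_def)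
  next
    case (Suc k)
    show ?case using stem_lap_rderiv[OF eK Suc.IH Suc.prems] by (simp add: S algebra_simps)
  qed
  have DK: "dbar (K k) y = - rderiv (H k) y" if "y \<in> U" for k y
    using that
  proof (induction k arbitrary: y)
    case 0
    then show ?case using dbar_rquot[OF F2 F1 CR] by (simp add: K_def H_def)
  next
    case (Suc k)
    show ?case using dbar_rderiv[OF eK eH Suc.IH Suc.prems] by (simp add: S)
  qed
  have comb: "- (2 * real k + 2) *\<^sub>R z + (real q - 1) *\<^sub>R z = c k *\<^sub>R z" for k and z :: "'n clifford"
    by (simp only: scaleR_left_distrib[symmetric]) (simp add: c_def)
  \<comment> \<open>For \<open>k = m - 1\<close> the factor is \<open>q - 2 m - 1\<close>, which is
    zero.\<close>
  have prod0: "(\<Prod>k<m. c k) = 0"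
    by (rule prod_zero) (use m in \<open>auto simp: c_def intro!: bexI[of _ "m - 1"]\<close>)
  have yU: "(ppart p x, norm (qpart p q x)) \<in> U" if "x \<in> lift_dom" for x
    using that by (simp add: lift_dom_def)
  have "(laplacian p q ^^ m) (lift (K 0)) x = (\<Prod>k<m. c k) *\<^sub>R lift (K m) x"
  proof (rule laplacian_power_lift[OF eK _ x])
    fix k x assume x: "x \<in> lift_dom"
    show "laplacian p q (lift (K k)) x = c k *\<^sub>R lift (K (Suc k)) x"
      unfolding laplacian_lift[OF eK x] by (simp only: lift_def LK[OF yU[OF x]] S comb)
  qed
  then show "(laplacian p q ^^ m) (lift (rquot F2)) x = 0"
    by (simp add: K_def prod0)
  define A where "A = (\<lambda>k y. H k y + cconj (fst y) * K k y)"
  have eA: "smooth_even (A k)" for k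
    unfolding A_def by (intro smooth_even_add smooth_even_cconj_mult eH eK)
  have "(laplacian p q ^^ m) (lift (A 0)) x = (\<Prod>k<m. c k) *\<^sub>R lift (A m) x"
  proof (rule laplacian_power_lift[OF eA _ x])
    fix k x assume x: "x \<in> lift_dom"
    define y where "y = (ppart p x, norm (qpart p q x))"
    have y: "y \<in> U" using yU[OF x] by (simp add: y_def)
    have "stem_lap (A k) y = stem_lap (H k) y + stem_lap (\<lambda>y. cconj (fst y) * K k y) y"
    proof -
      have "pdiff v (pdiff v (A k)) y = pdiff v (pdiff v (H k)) y + pdiff v (pdiff v (\<lambda>y. cconj (fst y) * K k y)) y"
        if v: "v \<in> V" for v
      proof -
        note s = smooth_even_smooth[OF eH[of k]] smooth_cconj_mult[OF smooth_even_smooth[OF eK[of k]]]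
        have "pdiff v (pdiff v (A k)) y = pdiff v (\<lambda>y. pdiff v (H k) y + pdiff v (\<lambda>y. cconj (fst y) * K k y) y) y"
          unfolding A_def
          by (rule pdiff_cong_U[OF v y], rule has_pdiff_imp_pdiff, rule has_pdiff_add)
            (rule smooth_has_pdiff[OF s(1) v] smooth_has_pdiff[OF s(2) v], assumption)+
        also have "\<dots> = pdiff v (pdiff v (H k)) y + pdiff v (pdiff v (\<lambda>y. cconj (fst y) * K k y)) y"
          by (rule has_pdiff_imp_pdiff, rule has_pdiff_add)
            (rule smooth_has_pdiff[OF smooth_pdiff[OF s(1) v] v y] smooth_has_pdiff[OF smooth_pdiff[OF s(2) v] v y])+
        finally show ?thesis .
      qed
      then show ?thesis
        unfolding stem_lap_def using e_in_V r_in_V by (simp add: sum.distrib)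
    qed
    \<comment> \<open>The cross term, twice \<open>dbar (K k)\<close>, is \<open>- 2\<close> times
      \<open>rderiv (H k)\<close>. It changes the coefficient of \<open>rderiv (H k)\<close> from
      \<open>- 2 k\<close> to \<open>- (2 k + 2)\<close>, which matches that of
      \<open>rderiv (K k)\<close>.\<close>
    also have "\<dots> = - (2 * real k + 2) *\<^sub>R (rderiv (H k) y + cconj (fst y) * rderiv (K k) y)"
      unfolding stem_lap_cconj_mult[OF smooth_even_smooth[OF eK] y] LH[OF y] LK[OF y] DK[OF y]
    proof -
      have "- (2 * real k) *\<^sub>R a + (b * - (2 * real k + 2) *\<^sub>R d + 2 *\<^sub>R - a) = - (2 * real k + 2) *\<^sub>R (a + b * d)"
        for a b d :: "'n clifford"
      proof -
        have "- (t - 2) *\<^sub>R a + (b * - t *\<^sub>R d + 2 *\<^sub>R - a) = - t *\<^sub>R (a + b * d)" for t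
          by (simp add: scaleR_left_diff_distrib scaleR_right_distrib)
        from this[of "2 * real k + 2"] show ?thesis by simp
      qed
      then show "- (2 * real k) *\<^sub>R rderiv (H k) y + (cconj (fst y) * - (2 * real k + 2) *\<^sub>R rderiv (K k) y
          + 2 *\<^sub>R - rderiv (H k) y) = - (2 * real k + 2) *\<^sub>R (rderiv (H k) y + cconj (fst y) * rderiv (K k) y)" .
    qed
    also have "rderiv (H k) y + cconj (fst y) * rderiv (K k) y = A (Suc k) y"
      by (simp add: A_def S)
    finally have L: "stem_lap (A k) y = - (2 * real k + 2) *\<^sub>R A (Suc k) y" .
    have "rderiv (A k) y = A (Suc k) y"
      unfolding A_def S by (rule rderiv_add_cconj_mult[OF eH eK y])
    then have "stem_lap (A k) y + (real q - 1) *\<^sub>R rderiv (A k) y = c k *\<^sub>R A (Suc k) y"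
      by (simp only: L comb)
    then show "laplacian p q (lift (A k)) x = c k *\<^sub>R lift (A (Suc k)) x"
      unfolding laplacian_lift[OF eA x] by (simp add: lift_def y_def)
  qed
  then show "(laplacian p q ^^ m) (lift (\<lambda>y. F1 y + cconj (fst y) * rquot F2 y)) x = 0"
    by (simp add: A_def H_def K_def prod0)
qed

end

section \<open>Partially symmetric completions\<close>

text \<open>The sign from conjugating a blade and the sign from squaring it cancel. This links the
  algebraic condition on \<open>unit_sphere\<close> with the Euclidean norm.\<close>

lemma inner_eq_coef: "inner x y = coef (cconj x * y) {}"
proof -
  have "coef (cconj x * y) {} =
      (\<Sum>A\<in>Pow {1..CARD('a)}. (blade_sign A A * blade_sign A A) * (coef x A * coef y A))"
    unfolding times_clifford.rep_eq cconj.rep_eq by (intro sum.cong refl) simp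
  then show ?thesis by (simp add: blade_sign_square inner_clifford_def)
qed

lemma cconj_qspace:
  assumes "w \<in> qspace p q" shows "cconj w = - w"
  using assms unfolding qspace_def
proof (induction rule: span_induct_alt)
  case base
  show ?case by (simp add: linear_0[OF cconj_linear])
next
  case (step c x y)
  then show ?case
    by (auto simp: linear_add[OF cconj_linear] linear_scale[OF cconj_linear] cconj_gen(2))
qed

text \<open>Conjugation negates \<open>w\<close>, so \<open>cconj w * w = 1\<close>, and the scalar
  part of this is the squared norm.\<close>

lemma unit_sphereD:
  fixes w :: "'n clifford"
  assumes "w \<in> unit_sphere p q"
  shows "w \<in> qspace p q" "w * w = - 1" "cconj w = - w" "norm w = 1" "- w \<in> unit_sphere p q"
proof -
  show w: "w \<in> qspace p q" and ww: "w * w = - 1"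
    using assms by (auto simp: unit_sphere_def power2_eq_square)
  show cw: "cconj w = - w" by (rule cconj_qspace[OF w])
  have "inner w w = coef (1 :: 'n clifford) {}" by (simp add: inner_eq_coef cw ww)
  then show "norm w = 1" by (simp add: norm_eq_sqrt_inner one_clifford.rep_eq)
  show "- w \<in> unit_sphere p q"
    using assms unfolding unit_sphere_def qspace_def by (auto intro: span_neg)
qed

lemma dir_open_openin:
  assumes D: "openin (top_of_set S) D" and S: "\<And>x v t. x \<in> S \<Longrightarrow> v \<in> V \<Longrightarrow> x + t *\<^sub>R v \<in> S"
  shows "dir_open V D"
proof -
  obtain T where T: "open T" "D = S \<inter> T" using D by (auto simp: openin_open)
  show ?thesis
    unfolding dir_open_def
  proof (intro ballI)
    fix x v assume "x \<in> D" "v \<in> V"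
    then have "\<forall>\<^sub>F t in nhds 0. x + t *\<^sub>R v \<in> T"
      using T dir_openD[OF open_dir_open[OF T(1)], of x v V] by blast
    then show "\<forall>\<^sub>F t in nhds 0. x + t *\<^sub>R v \<in> D"
      by (rule eventually_mono) (use T S \<open>x \<in> D\<close> \<open>v \<in> V\<close> in blast)
  qed
qed

section \<open>Stem functions and symmetric functions on the completion\<close>

locale slice_domain =
  fixes p q :: nat and D :: "('n clifford \<times> real) set"
  assumes dim: "CARD('n) = p + q" and q_pos: "q > 0"
    and openin_D: "openin (top_of_set (pspace p \<times> UNIV)) D"
    and reflect_D: "\<And>x r. (x, r) \<in> D \<Longrightarrow> (x, - r) \<in> D"
begin

abbreviation S :: "'n clifford set" where "S \<equiv> unit_sphere p q"
abbreviation \<Omega> :: "'n clifford set" where "\<Omega> \<equiv> sym_completion p q D"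
abbreviation e\<^sub>q :: "'n clifford" where "e\<^sub>q \<equiv> gen (p + 1)"

lemma D_pspace: "(x, r) \<in> D \<Longrightarrow> x \<in> pspace p"
  using openin_subset[OF openin_D] by auto

lemma ppart_D: "(x, r) \<in> D \<Longrightarrow> ppart p x = x"
  using ppart_pspace[of p x, OF _ D_pspace] dim by simp

lemma dir_open_D: "dir_open (stem_dirs p) D"
proof (rule dir_open_openin[OF openin_D])
  fix y v :: "'n clifford \<times> real" and t :: real
  assume y: "y \<in> pspace p \<times> UNIV" and v: "v \<in> stem_dirs p"
  have "fst v \<in> pspace p"
    using v by (auto simp: stem_dirs_def pspace_def intro: span_base span_zero)
  then have "fst y + t *\<^sub>R fst v \<in> pspace p"
    using y unfolding pspace_def by (auto intro: span_add span_scale)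
  then show "y + t *\<^sub>R v \<in> pspace p \<times> UNIV" by (auto simp: mem_Times_iff)
qed

lemma e_in_S: "e\<^sub>q \<in> S"
proof -
  have "e\<^sub>q \<in> qspace p q" unfolding qspace_def by (rule span_base) (use q_pos in auto)
  moreover have "e\<^sub>q * e\<^sub>q + e\<^sub>q * e\<^sub>q = (if p + 1 = p + 1 then - 2 else 0)"
    by (rule gen_anticommute) (use dim q_pos in auto)
  then have "2 *\<^sub>R (e\<^sub>q * e\<^sub>q) = 2 *\<^sub>R (- 1)" by (simp add: scaleR_2)
  then have "e\<^sub>q * e\<^sub>q = - 1" by (simp only: scaleR_cancel_left) simp
  ultimately show ?thesis by (simp add: unit_sphere_def power2_eq_square)
qed

lemma parts:
  assumes "x \<in> pspace p" "w \<in> S"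
  shows "ppart p (x + r *\<^sub>R w) = x" "qpart p q (x + r *\<^sub>R w) = r *\<^sub>R w"
    "norm (qpart p q (x + r *\<^sub>R w)) = \<bar>r\<bar>" "cconj (x + r *\<^sub>R w) = cconj x - r *\<^sub>R w"
  using assms unit_sphereD[OF assms(2)] dim ppart_qspace[of p q w] qpart_qspace[of p q w]
  by (simp_all add: ppart_simps qpart_simps ppart_pspace qpart_pspace
      linear_add[OF cconj_linear] linear_scale[OF cconj_linear])

lemma in_completion:
  assumes "(x, r) \<in> D" "w \<in> S" shows "x + r *\<^sub>R w \<in> \<Omega>"
proof (cases "r \<ge> 0")
  case True
  then show ?thesis using assms unfolding sym_completion_def by blast
next
  case False
  then have "x + (- r) *\<^sub>R (- w) \<in> \<Omega>"
    using reflect_D[OF assms(1)] unit_sphereD(5)[OF assms(2)] unfolding sym_completion_def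
    by (intro CollectI exI[of _ x] exI[of _ "- r"] exI[of _ "- w"]) auto
  then show ?thesis by simp
qed

lemma completionE:
  assumes "x \<in> \<Omega>"
  obtains y r w where "x = y + r *\<^sub>R w" "w \<in> S" "r \<ge> 0" "(y, r) \<in> D"
  using assms unfolding sym_completion_def by blast

text \<open>The definition of symmetry involves nonnegative radii only; for negative
  \<open>r\<close> it is applied to the opposite units \<open>- I\<close> and
  \<open>- J\<close>.\<close>

lemma symmetric_onD:
  assumes h: "symmetric_on p q \<Omega> h" and D: "(x, r) \<in> D" and I: "I \<in> S" and J: "J \<in> S"
  shows "h (x + r *\<^sub>R I) = h (x + r *\<^sub>R J)"
proof (cases "r \<ge> 0")
  case True
  then show ?thesis
    using h in_completion[OF D I] I J unfolding symmetric_on_def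
    by (metis D D_pspace abs_of_nonneg parts(1,3))
next
  case False
  have "h (ppart p (x + r *\<^sub>R I) + norm (qpart p q (x + r *\<^sub>R I)) *\<^sub>R (- I)) =
      h (ppart p (x + r *\<^sub>R I) + norm (qpart p q (x + r *\<^sub>R I)) *\<^sub>R (- J))"
    using h in_completion[OF D I] unit_sphereD(5)[OF I] unit_sphereD(5)[OF J]
    unfolding symmetric_on_def by blast
  then show ?thesis
    using False by (simp add: parts[OF D_pspace[OF D] I] unit_sphereD(4)[OF I])
qed

lemma stem_of_eq:
  assumes "symmetric_on p q \<Omega> h" "(x, r) \<in> D" "w \<in> S"
  shows "stem_of p q h (x, r) = h (x + r *\<^sub>R w)"
proof -
  have "(SOME w. w \<in> S) \<in> S" using e_in_S by (rule someI)
  then show ?thesis using symmetric_onD[OF assms(1,2) _ assms(3)] by (simp add: stem_of_def)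
qed

lemma stem_of_even:
  assumes "symmetric_on p q \<Omega> h" "(x, r) \<in> D"
  shows "stem_of p q h (x, - r) = stem_of p q h (x, r)"
  using stem_of_eq[OF assms(1) reflect_D[OF assms(2)] unit_sphereD(5)[OF e_in_S]]
    stem_of_eq[OF assms e_in_S] by simp

text \<open>By symmetry the arbitrary unit in \<open>stem_of\<close> may be taken to be the
  generator \<open>e\<^sub>q\<close>. The stem is then \<open>h\<close> composed with an embedding
  that maps stem directions to coordinate directions.\<close>

lemma Ck_on_stem_of:
  assumes h: "symmetric_on p q \<Omega> h" and C: "C_class p q k \<Omega> h"
  shows "Ck_on (stem_dirs p) k D (stem_of p q h)"
proof (rule Ck_on_cong[OF _ dir_open_D])
  let ?\<sigma> = "\<lambda>v :: 'n clifford \<times> real. fst v + snd v *\<^sub>R e\<^sub>q"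
  show "Ck_on (stem_dirs p) k D (\<lambda>y. h (fst y + snd y *\<^sub>R e\<^sub>q))"
  proof (rule Ck_on_compose_affine[where \<sigma> = ?\<sigma> and \<pi> = "\<lambda>y. fst y + snd y *\<^sub>R e\<^sub>q", OF _ _ _ _
        C[unfolded C_class_def]])
    show "continuous_on D (\<lambda>y. fst y + snd y *\<^sub>R e\<^sub>q)" by (intro continuous_intros)
    show "(\<lambda>y. fst y + snd y *\<^sub>R e\<^sub>q) ` D \<subseteq> \<Omega>" using in_completion[OF _ e_in_S] by auto
    show "?\<sigma> v \<in> gen ` {0..p + q}" if "v \<in> stem_dirs p" for v
      using that q_pos by (auto simp: stem_dirs_def)
  qed (simp add: algebra_simps)
  show "h (fst y + snd y *\<^sub>R e\<^sub>q) = stem_of p q h y" if "y \<in> D" for y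
    using stem_of_eq[OF h _ e_in_S, of "fst y" "snd y"] that by simp
qed

text \<open>The opposite units \<open>e\<^sub>q\<close> and \<open>- e\<^sub>q\<close> separate the
  two components, \<open>e\<^sub>q\<close> being invertible, and parity covers negative radii. So
  the stem functions in the definition of regularity are determined on \<open>D\<close>.\<close>

lemma stem_unique:
  assumes F: "parity_conditions D F1 F2" "induced_by p q D f F1 F2"
    and H: "parity_conditions D H1 H2" "induced_by p q D f H1 H2" and y: "y \<in> D"
  shows "F1 y = H1 y \<and> F2 y = H2 y"
proof -
  have nonneg: "F1 (x, r) = H1 (x, r) \<and> F2 (x, r) = H2 (x, r)" if D: "(x, r) \<in> D" and r: "r \<ge> 0" for x r
  proof -
    define a b where "a = F1 (x, r) - H1 (x, r)" and "b = F2 (x, r) - H2 (x, r)"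
    have eq: "a + w * b = 0" if "w \<in> S" for w
    proof -
      have "F1 (x, r) + w * F2 (x, r) = H1 (x, r) + w * H2 (x, r)"
        using F(2) H(2) D r that unfolding induced_by_def by metis
      then show ?thesis by (simp add: a_def b_def algebra_simps)
    qed
    have 1: "a + e\<^sub>q * b = 0" "a - e\<^sub>q * b = 0"
      using eq[OF e_in_S] eq[OF unit_sphereD(5)[OF e_in_S]] by simp_all
    then have "2 *\<^sub>R a = 0" by (simp add: scaleR_2 eq_neg_iff_add_eq_0 algebra_simps)
    then have a: "a = 0" by simp
    then have "e\<^sub>q * (e\<^sub>q * b) = 0" using 1 by simp
    then have "b = 0" unfolding mult.assoc[symmetric] unit_sphereD(2)[OF e_in_S] by simp
    with a show ?thesis by (simp add: a_def b_def)
  qed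
  obtain x r where y': "y = (x, r)" by (cases y)
  show ?thesis
  proof (cases "r \<ge> 0")
    case True
    then show ?thesis using nonneg y y' by blast
  next
    case False
    have "F1 (x, - r) = H1 (x, - r) \<and> F2 (x, - r) = H2 (x, - r)"
      using nonneg[OF reflect_D] y y' False by simp
    then show ?thesis
      using F(1) H(1) y unfolding parity_conditions_def y' by fastforce
  qed
qed

text \<open>Meant for the difference of two decompositions: \<open>a\<close> and \<open>b\<close>
  are the differences of the respective components.\<close>

lemma decomposition_unique:
  assumes c: "continuous_on \<Omega> b" and sym: "symmetric_on p q \<Omega> a" "symmetric_on p q \<Omega> b"
    and eq: "\<And>x. x \<in> \<Omega> \<Longrightarrow> a x = cconj x * b x" and x: "x \<in> \<Omega>"
  shows "a x = 0 \<and> b x = 0"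
proof -
  have pos: "b (y + r *\<^sub>R w) = 0" if "(y, r) \<in> D" "r > 0" "w \<in> S" for y r w
  proof -
    note y = D_pspace[OF that(1)] and w' = unit_sphereD(5)[OF that(3)]
    have "a (y + r *\<^sub>R w) = (cconj y - r *\<^sub>R w) * b (y + r *\<^sub>R w)"
      using eq[OF in_completion[OF that(1,3)]] by (simp only: parts(4)[OF y that(3)])
    moreover have "a (y + r *\<^sub>R w) = (cconj y - r *\<^sub>R (- w)) * b (y + r *\<^sub>R w)"
      using eq[OF in_completion[OF that(1) w']] symmetric_onD[OF sym(1) that(1) w' that(3)]
        symmetric_onD[OF sym(2) that(1) w' that(3)]
      by (simp only: parts(4)[OF y w'])
    \<comment> \<open>\<open>a\<close> and \<open>b\<close> take equal values at the points
      belonging to \<open>w\<close> and \<open>- w\<close>, so subtracting the two equations leaves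
      only the term with the invertible factor \<open>w\<close>.\<close>
    ultimately have "r *\<^sub>R (w * b (y + r *\<^sub>R w)) + r *\<^sub>R (w * b (y + r *\<^sub>R w)) = 0"
      by (simp add: algebra_simps)
    then have "2 *\<^sub>R r *\<^sub>R (w * b (y + r *\<^sub>R w)) = 0" by (simp only: scaleR_2)
    then have "w * (w * b (y + r *\<^sub>R w)) = 0" using that(2) by simp
    then show ?thesis unfolding mult.assoc[symmetric] unit_sphereD(2)[OF that(3)] by simp
  qed
  obtain y r w where y: "x = y + r *\<^sub>R w" "w \<in> S" "r \<ge> 0" "(y, r) \<in> D"
    using completionE[OF x] by metis
  have "b x = 0"
  proof (cases "r > 0")
    case True
    then show ?thesis using pos y by simp
  next
    case False
    \<comment> \<open>At radius \<open>0\<close> the two points coincide. The value is reached by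
      continuity along \<open>w\<close> with \<open>t\<close> tending to \<open>0\<close> from the
      right, as \<open>D\<close> has room in the radial direction.\<close>
    then have y0: "(y, 0) \<in> D" "x = y" using y by auto
    have "\<forall>\<^sub>F t in nhds (0::real). (y, 0) + t *\<^sub>R (0, 1) \<in> D"
      by (rule dir_openD[OF dir_open_D y0(1)]) (simp add: stem_dirs_def)
    then obtain d where d: "d > 0" "\<And>t. \<bar>t\<bar> < d \<Longrightarrow> (y, t) \<in> D"
      unfolding eventually_nhds_metric by (auto simp: dist_real_def)
    define T where "T = {0..d / 2}"
    have TD: "(y, t) \<in> D" if "t \<in> T" for t using d that by (auto simp: T_def)
    have "continuous_on T (\<lambda>t. b (y + t *\<^sub>R w))"
      by (rule continuous_on_compose2[OF c]) (intro continuous_intros, use in_completion[OF TD y(2)] in auto)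
    moreover have "0 \<in> T" using d by (simp add: T_def)
    ultimately have "((\<lambda>t. b (y + t *\<^sub>R w)) \<longlongrightarrow> b (y + 0 *\<^sub>R w)) (at 0 within T)"
      unfolding continuous_on_def by blast
    moreover have "at 0 within T = at_right 0"
      unfolding T_def by (rule at_within_Icc_at_right) (use d in simp)
    ultimately have lim: "((\<lambda>t. b (y + t *\<^sub>R w)) \<longlongrightarrow> b x) (at_right 0)" using y0 by simp
    have "\<forall>\<^sub>F t in at_right 0. b (y + t *\<^sub>R w) = 0"
      unfolding eventually_at_right_field
      by (rule exI[of _ "d / 2"]) (use d pos[OF TD _ y(2)] in \<open>auto simp: T_def\<close>)
    then have "((\<lambda>t. b (y + t *\<^sub>R w)) \<longlongrightarrow> 0) (at_right 0)" by (rule tendsto_eventually)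
    with lim show ?thesis using tendsto_unique trivial_limit_at_right_real by blast
  qed
  then show ?thesis using eq[OF x] by simp
qed

section \<open>The Cauchy-Riemann system in terms of the components of the decomposition\<close>

lemma gen_mult_cconj_gen:
  assumes "i \<le> p" shows "gen i * cconj (gen i) = (1 :: 'n clifford)"
proof -
  have "2 *\<^sub>R (gen i * cconj (gen i)) = 2 *\<^sub>R (1 :: 'n clifford)"
    using cconj_gen_mult_gen(2)[where 'n = 'n, of i i] assms dim by (simp add: scaleR_2)
  then show ?thesis by (simp only: scaleR_cancel_left) simp
qed

text \<open>The conjugate of \<open>x + r w\<close> is \<open>cconj x - r w\<close>, which makes
  \<open>F1\<close> and \<open>F2\<close> the stem components of the combination. The product rule
  gives \<open>gen i * cconj (gen i) * B = B\<close> for each of \<open>p + 1\<close> indices, and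
  \<open>dr F2\<close> gives one more, hence \<open>p + 2\<close>.\<close>

lemma cauchy_riemann_iff_AB:
  fixes A B :: "'n clifford \<times> real \<Rightarrow> 'n clifford"
  assumes A: "Ck_on (stem_dirs p) 1 D A" and B: "Ck_on (stem_dirs p) 1 D B" and y: "(x, r) \<in> D"
  defines "F1 \<equiv> (\<lambda>y. A y - cconj (fst y) * B y)" and "F2 \<equiv> (\<lambda>y. snd y *\<^sub>R B y)"
  shows "Dp p F1 (x, r) - dr F2 (x, r) = 0 \<and> Dp_bar p F2 (x, r) + dr F1 (x, r) = 0 \<longleftrightarrow>
    Dp p A (x, r) - (\<Sum>i=0..p. gen i * cconj x * dx i B (x, r)) - r *\<^sub>R dr B (x, r)
      = real (p + 2) *\<^sub>R B (x, r) \<and>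
    dr A (x, r) - cconj x * dr B (x, r) + r *\<^sub>R Dp_bar p B (x, r) = 0"
proof -
  let ?V = "stem_dirs p :: ('n clifford \<times> real) set"
  have e: "(gen i, 0) \<in> ?V" if "i \<le> p" for i using that by (auto simp: stem_dirs_def)
  have \<rho>: "(0, 1) \<in> ?V" by (simp add: stem_dirs_def)
  have bl: "bounded_linear (\<lambda>y :: 'n clifford \<times> real. cconj (fst y))"
    by (rule bounded_linear_compose[OF bounded_linear_cconj bounded_linear_fst])
  have dA: "has_pdiff v A (x, r) (pdiff v A (x, r))" and dB: "has_pdiff v B (x, r) (pdiff v B (x, r))"
    if "v \<in> ?V" for v
    using Ck_on_has_pdiff[of ?V 0 D, OF _ that y] A B by simp_all
  have d1: "pdiff v F1 (x, r) = pdiff v A (x, r) - (cconj x * pdiff v B (x, r) + cconj (fst v) * B (x, r))"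
    if v: "v \<in> ?V" for v
    unfolding F1_def
    using has_pdiff_imp_pdiff[OF has_pdiff_diff[OF dA[OF v] has_pdiff_bilinear[OF bounded_bilinear_clifford_mult
          has_pdiff_linear_fun[OF bl] dB[OF v]]]] by simp
  have d2: "pdiff v F2 (x, r) = r *\<^sub>R pdiff v B (x, r) + snd v *\<^sub>R B (x, r)" if v: "v \<in> ?V" for v
    unfolding F2_def
    using has_pdiff_imp_pdiff[OF has_pdiff_bilinear[OF bounded_bilinear_scaleR
          has_pdiff_linear_fun[OF bounded_linear_snd] dB[OF v]]] by simp
  have "Dp p F1 (x, r) = (\<Sum>i=0..p. gen i * dx i A (x, r) - gen i * cconj x * dx i B (x, r) - B (x, r))"
    unfolding Dp_def
  proof (intro sum.cong refl)
    fix i assume "i \<in> {0..p}"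
    then have i: "i \<le> p" by simp
    have "gen i * (cconj (gen i) * B (x, r)) = B (x, r)"
      unfolding mult.assoc[symmetric] gen_mult_cconj_gen[OF i] by simp
    then show "gen i * dx i F1 (x, r) = gen i * dx i A (x, r) - gen i * cconj x * dx i B (x, r) - B (x, r)"
      by (simp add: d1[OF e[OF i]] algebra_simps)
  qed
  also have "\<dots> = Dp p A (x, r) - (\<Sum>i=0..p. gen i * cconj x * dx i B (x, r)) - real (p + 1) *\<^sub>R B (x, r)"
    unfolding Dp_def sum_subtractf by (simp add: sum_constant_scaleR del: sum_constant)
  finally have 1: "Dp p F1 (x, r) - dr F2 (x, r) =
      Dp p A (x, r) - (\<Sum>i=0..p. gen i * cconj x * dx i B (x, r)) - r *\<^sub>R dr B (x, r) - real (p + 2) *\<^sub>R B (x, r)"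
    by (simp add: d2[OF \<rho>] scaleR_left_distrib scaleR_2)
  have "Dp_bar p F2 (x, r) = r *\<^sub>R Dp_bar p B (x, r)"
    unfolding Dp_bar_eq scaleR_sum_right by (intro sum.cong refl) (simp add: d2[OF e])
  then have 2: "Dp_bar p F2 (x, r) + dr F1 (x, r) =
      dr A (x, r) - cconj x * dr B (x, r) + r *\<^sub>R Dp_bar p B (x, r)"
    by (simp add: d1[OF \<rho>] linear_0[OF cconj_linear])
  show ?thesis unfolding 1 2 by simp
qed

lemma converse_part:
  fixes A B :: "'n clifford \<Rightarrow> 'n clifford"
  assumes A: "C_class p q 1 \<Omega> A" "symmetric_on p q \<Omega> A" and B: "C_class p q 1 \<Omega> B" "symmetric_on p q \<Omega> B"
  shows "gen_partial_slice p q D (\<lambda>x. A x - cconj x * B x)"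
    and "gen_partial_slice_regular p q D (\<lambda>x. A x - cconj x * B x) \<longleftrightarrow>
      AB_system p D (stem_of p q A) (stem_of p q B)"
proof -
  let ?g = "\<lambda>x. A x - cconj x * B x"
  define a b where "a = stem_of p q A" and "b = stem_of p q B"
  define F1 where "F1 = (\<lambda>y. a y - cconj (fst y) * b y)"
  define F2 where "F2 = (\<lambda>y. snd y *\<^sub>R b y)"
  have Ca: "Ck_on (stem_dirs p) 1 D a" and Cb: "Ck_on (stem_dirs p) 1 D b"
    unfolding a_def b_def by (rule Ck_on_stem_of[OF A(2,1)], rule Ck_on_stem_of[OF B(2,1)])
  have par: "parity_conditions D F1 F2"
    unfolding parity_conditions_def F1_def F2_def a_def b_def
    using stem_of_even[OF A(2)] stem_of_even[OF B(2)] by auto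
  have ind: "induced_by p q D ?g F1 F2"
    unfolding induced_by_def
  proof (intro allI impI, elim conjE)
    fix x r w assume D: "(x, r) \<in> D" "w \<in> S"
    show "A (x + r *\<^sub>R w) - cconj (x + r *\<^sub>R w) * B (x + r *\<^sub>R w) = F1 (x, r) + w * F2 (x, r)"
      unfolding parts(4)[OF D_pspace[OF D(1)] D(2)] F1_def F2_def a_def b_def
        stem_of_eq[OF A(2) D] stem_of_eq[OF B(2) D] fst_conv snd_conv
      by (simp add: algebra_simps)
  qed
  show "gen_partial_slice p q D ?g" unfolding gen_partial_slice_def using par ind by blast
  have bl: "bounded_linear (\<lambda>y :: 'n clifford \<times> real. cconj (fst y))"
    by (rule bounded_linear_compose[OF bounded_linear_cconj bounded_linear_fst])
  have C1: "Ck_on (stem_dirs p) 1 D F1"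
    unfolding F1_def
    by (intro Ck_on_diff[OF dir_open_D] Ca Ck_on_bilinear[OF dir_open_D bounded_bilinear_clifford_mult] Cb
        Ck_on_linear_fun[OF dir_open_D bl])
  have C2: "Ck_on (stem_dirs p) 1 D F2"
    unfolding F2_def
    by (intro Ck_on_bilinear[OF dir_open_D bounded_bilinear_scaleR] Cb
        Ck_on_linear_fun[OF dir_open_D bounded_linear_snd])
  have AB: "AB_system p D a b \<longleftrightarrow> (\<forall>y\<in>D. Dp p F1 y - dr F2 y = 0 \<and> Dp_bar p F2 y + dr F1 y = 0)"
    unfolding AB_system_def using cauchy_riemann_iff_AB[OF Ca Cb, folded F1_def F2_def] by force
  show "gen_partial_slice_regular p q D ?g \<longleftrightarrow> AB_system p D (stem_of p q A) (stem_of p q B)"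
    unfolding a_def[symmetric] b_def[symmetric] AB
  proof
    assume "\<forall>y\<in>D. Dp p F1 y - dr F2 y = 0 \<and> Dp_bar p F2 y + dr F1 y = 0"
    then show "gen_partial_slice_regular p q D ?g"
      unfolding gen_partial_slice_regular_def using par ind C1 C2 by blast
  next
    assume "gen_partial_slice_regular p q D ?g"
    then obtain H1 H2 where H: "parity_conditions D H1 H2" "induced_by p q D ?g H1 H2"
      "\<And>y. y \<in> D \<Longrightarrow> Dp p H1 y - dr H2 y = 0 \<and> Dp_bar p H2 y + dr H1 y = 0"
      unfolding gen_partial_slice_regular_def by blast
    \<comment> \<open>Regularity only supplies some stem functions \<open>H1\<close> and
      \<open>H2\<close>; by uniqueness they agree with \<open>F1\<close> and \<open>F2\<close> on
      \<open>D\<close>, hence so do their derivatives along stem directions.\<close>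
    have eq: "pdiff v H1 y = pdiff v F1 y" "pdiff v H2 y = pdiff v F2 y" if "v \<in> stem_dirs p" "y \<in> D" for v y
      by (rule pdiff_cong[OF dir_open_D that], use stem_unique[OF H(1,2) par ind] in blast)+
    show "\<forall>y\<in>D. Dp p F1 y - dr F2 y = 0 \<and> Dp_bar p F2 y + dr F1 y = 0"
    proof
      fix y assume y: "y \<in> D"
      have "Dp p H1 y = Dp p F1 y" "Dp_bar p H2 y = Dp_bar p F2 y"
        unfolding Dp_def Dp_bar_eq
        by (intro sum.cong refl, subst eq[OF _ y], auto simp: stem_dirs_def)+
      moreover have "dr H1 y = dr F1 y" "dr H2 y = dr F2 y"
        by (rule eq[OF _ y], simp add: stem_dirs_def)+
      ultimately show "Dp p F1 y - dr F2 y = 0 \<and> Dp_bar p F2 y + dr F1 y = 0" using H(3)[OF y] by simp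
    qed
  qed
qed

section \<open>Existence of the polyharmonic decomposition\<close>

lemma regular_decomposition:
  assumes f: "gen_partial_slice_regular p q D f" and m: "q = 2 * m + 1" "m \<ge> 1"
  obtains A B where "polyharmonic_on p q m \<Omega> A" "symmetric_on p q \<Omega> A"
    "polyharmonic_on p q m \<Omega> B" "symmetric_on p q \<Omega> B"
    "\<And>x. x \<in> \<Omega> \<Longrightarrow> f x = A x - cconj x * B x"
proof -
  let ?V = "stem_dirs p :: ('n clifford \<times> real) set"
  obtain F1 F2 where F: "parity_conditions D F1 F2" "induced_by p q D f F1 F2"
    "Ck_on ?V 1 D F1" "Ck_on ?V 1 D F2"
    "\<And>y. y \<in> D \<Longrightarrow> Dp p F1 y - dr F2 y = 0 \<and> Dp_bar p F2 y + dr F1 y = 0"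
    using f unfolding gen_partial_slice_regular_def by blast
  \<comment> \<open>Composing with this projection extends the stem functions, and the preimage
    \<open>U\<close> is open in the ambient space although \<open>D\<close> is open only relative to
    a subspace.\<close>
  define \<pi> where "\<pi> = (\<lambda>y :: 'n clifford \<times> real. (ppart p (fst y), snd y))"
  define U where "U = \<pi> -` D"
  define E1 E2 where "E1 = (\<lambda>y. F1 (\<pi> y))" and "E2 = (\<lambda>y. F2 (\<pi> y))"
  have p: "p \<le> CARD('n)" using dim by simp
  have c\<pi>: "continuous_on X \<pi>" for X unfolding \<pi>_def by (intro continuous_intros)
  obtain T where T: "open T" "D = (pspace p \<times> UNIV) \<inter> T" using openin_D by (auto simp: openin_open)
  have "U = \<pi> -` T" unfolding U_def T by (auto simp: \<pi>_def ppart_in_pspace)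
  then have oU: "open U" using open_vimage[OF T(1) c\<pi>] by simp
  interpret stem_domain p q U
  proof
    show "(x, - r) \<in> U" if "(x, r) \<in> U" for x r using that reflect_D by (simp add: U_def \<pi>_def)
  qed (use dim oU in auto)
  have aff: "\<pi> (y + t *\<^sub>R v) = \<pi> y + t *\<^sub>R v" if v: "v \<in> ?V" for v y t
  proof -
    have "ppart p (fst v) = fst v"
      using v ppart_gen[OF p] p by (auto simp: stem_dirs_def ppart_simps)
    then show ?thesis by (simp add: \<pi>_def ppart_simps prod_eq_iff)
  qed
  have pd: "pdiff v E1 y = pdiff v F1 (\<pi> y)" "pdiff v E2 y = pdiff v F2 (\<pi> y)" if "v \<in> ?V" for v y
    unfolding E1_def E2_def by (rule pdiff_compose_affine(1)[OF aff[OF that]])+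
  have C1: "Ck_on ?V 1 U E1" "Ck_on ?V 1 U E2"
    unfolding E1_def E2_def
    by (rule Ck_on_compose_affine[where \<sigma> = "\<lambda>v. v", OF c\<pi> _ aff _ F(3)]; simp add: U_def)
      (rule Ck_on_compose_affine[where \<sigma> = "\<lambda>v. v", OF c\<pi> _ aff _ F(4)]; simp add: U_def)
  have CR: "Dp p E1 y - dr E2 y = 0 \<and> Dp_bar p E2 y + dr E1 y = 0" if "y \<in> U" for y
  proof -
    have "Dp p E1 y = Dp p F1 (\<pi> y)" "Dp_bar p E2 y = Dp_bar p F2 (\<pi> y)"
      unfolding Dp_def Dp_bar_eq by (intro sum.cong refl, subst pd, auto simp: stem_dirs_def)+
    moreover have "dr E1 y = dr F1 (\<pi> y)" "dr E2 y = dr F2 (\<pi> y)" by (rule pd[OF r_in_V])+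
    ultimately show ?thesis using F(5)[of "\<pi> y"] that by (simp add: U_def)
  qed
  \<comment> \<open>A basis direction outside the stem directions is orthogonal to
    \<open>pspace p\<close> and has no radial component, so \<open>\<pi>\<close> is constant along
    it.\<close>
  have triv: "has_pdiff b E1 y 0 \<and> has_pdiff b E2 y 0" if b: "b \<in> Basis - ?V" for b y
  proof -
    have "snd b = 0 \<and> fst b \<in> Basis \<and> fst b \<notin> gen ` {0..p}"
      using b by (auto simp: Basis_prod_def stem_dirs_def)
    then have sb: "snd b = 0" and fb: "fst b \<in> Basis" "fst b \<notin> gen ` {0..p}" by auto
    have "inner (fst b) (gen i) = 0" if "i \<in> {0..p}" for i
      using fb gen_in_Basis[where 'n = 'n, of i] that p by (intro inner_not_same_Basis) auto
    then have "ppart p (fst b) = 0" by (simp add: ppart_def)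
    then have "\<pi> (y + t *\<^sub>R b) = \<pi> y" for t by (simp add: \<pi>_def ppart_simps sb)
    then show ?thesis by (simp add: has_pdiff_def E1_def E2_def)
  qed
  have sm: "smooth E1" "smooth E2"
    unfolding smooth_def using cauchy_riemann_smooth[OF p oU C1 triv CR] by auto
  have par: "F1 (x, - r) = F1 (x, r) \<and> F2 (x, - r) = - F2 (x, r)" if "(x, r) \<in> D" for x r
    using F(1) that unfolding parity_conditions_def by fastforce
  have "E1 (x, - r) = E1 (x, r)" "E2 (x, - r) = - E2 (x, r)" if "(x, r) \<in> U" for x r
    using par[of "ppart p x" r] that by (simp_all add: E1_def E2_def U_def \<pi>_def)
  then have ev: "smooth_even E1" and od: "smooth_odd E2"
    using sm by (simp_all add: smooth_even_def smooth_odd_def)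
  have C2: "Ck_on ?V 2 U E1" "Ck_on ?V 2 U E2" using sm by (auto simp: smooth_def)
  have harm: "stem_lap E1 y = 0" "stem_lap E2 y = 0" if "y \<in> U" for y
    unfolding stem_lap_def using cauchy_riemann_harmonic[OF p oU that C2 CR] by auto
  have db: "dbar E2 y = - dr E1 y" if "y \<in> U" for y
    unfolding dbar_def by (rule CR[OF that, unfolded cauchy_riemann_iff, THEN conjunct2])
  define K where "K = rquot E2"
  \<comment> \<open>At \<open>x = y + r w\<close> the conjugate is \<open>cconj y - r w\<close>, so
    the lift of \<open>J\<close> minus \<open>cconj x\<close> times the lift of \<open>K\<close> is
    \<open>F1 + r w K = F1 + w F2\<close>.\<close>
  define J where "J = (\<lambda>y. E1 y + cconj (fst y) * K y)"
  have eK: "smooth_even K" unfolding K_def by (rule smooth_even_rquot[OF od])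
  have eJ: "smooth_even J" unfolding J_def by (intro smooth_even_add smooth_even_cconj_mult ev eK)
  have lift_eq: "lift h (x + r *\<^sub>R w) = h (x, \<bar>r\<bar>)" if "x \<in> pspace p" "w \<in> S" for h x r w
    unfolding lift_def parts(1,3)[OF that] ..
  have sub: "\<Omega> \<subseteq> lift_dom"
  proof
    fix x assume "x \<in> \<Omega>"
    then obtain y r w where y: "x = y + r *\<^sub>R w" "w \<in> S" "r \<ge> 0" "(y, r) \<in> D" by (rule completionE)
    have "(y, r) \<in> U" using ppart_D[OF y(4)] y(4) by (simp add: U_def \<pi>_def)
    then show "x \<in> lift_dom"
      using parts(1,3)[OF D_pspace[OF y(4)] y(2)] y(3) by (simp add: lift_dom_def y(1))
  qed
  have C: "C_class p q (2 * m) \<Omega> (lift h)" if "smooth_even h" for h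
    unfolding C_class_def by (rule Ck_on_subset[OF Ck_on_lift[OF that] sub])
  have sym: "symmetric_on p q \<Omega> (lift h)" for h
    unfolding symmetric_on_def using lift_eq[OF ppart_in_pspace] by simp
  note ph = polyharmonic_lift[OF ev od harm db m]
  show thesis
  proof (rule that[of "lift J" "lift K"])
    show "polyharmonic_on p q m \<Omega> (lift J)" "polyharmonic_on p q m \<Omega> (lift K)"
      unfolding polyharmonic_on_def using C[OF eJ] C[OF eK] ph sub by (auto simp: J_def K_def)
    fix x assume "x \<in> \<Omega>"
    then obtain y r w where y: "x = y + r *\<^sub>R w" "w \<in> S" "r \<ge> 0" "(y, r) \<in> D" by (rule completionE)
    have \<pi>y: "\<pi> (y, r) = (y, r)" using ppart_D[OF y(4)] by (simp add: \<pi>_def)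
    then have yU: "(y, r) \<in> U" using y by (simp add: U_def)
    have "F2 (y, r) = r *\<^sub>R K (y, r)"
      using radius_rquot[OF od yU] by (simp add: K_def E2_def \<pi>y)
    moreover have "f x = F1 (y, r) + w * F2 (y, r)"
      using F(2) y unfolding induced_by_def by blast
    moreover have "lift h x = h (y, r)" for h
      using lift_eq[OF D_pspace[OF y(4)] y(2)] y(1,3) by simp
    moreover have "cconj x = cconj y - r *\<^sub>R w"
      unfolding y(1) by (rule parts(4)[OF D_pspace[OF y(4)] y(2)])
    ultimately show "f x = lift J x - cconj x * lift K x"
      by (simp add: J_def E1_def \<pi>y left_diff_distrib)
  qed (rule sym)+
qed

end

theorem theorem3p11:
  fixes p q m :: nat and D :: "('n clifford \<times> real) set"
  assumes dim: "CARD('n) = p + q"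
    and q: "q = 2 * m + 1" "q \<ge> 3"
    and D: "domain_in_stem_space p D"
    and reflection: "\<forall>(xp, r)\<in>D. (xp, - r) \<in> D"
  shows
    "(\<forall>f :: 'n clifford \<Rightarrow> 'n clifford. gen_partial_slice_regular p q D f \<longrightarrow>
       (let P = (\<lambda>A B.
          polyharmonic_on p q m (sym_completion p q D) A \<and> symmetric_on p q (sym_completion p q D) A \<and>
          polyharmonic_on p q m (sym_completion p q D) B \<and> symmetric_on p q (sym_completion p q D) B \<and>
          (\<forall>x\<in>sym_completion p q D. f x = A x - cconj x * B x))
        in \<exists>A B. P A B \<and>
             (\<forall>A' B'. P A' B' \<longrightarrow> (\<forall>x\<in>sym_completion p q D. A' x = A x \<and> B' x = B x))))
     \<and>
     (\<forall>A B :: 'n clifford \<Rightarrow> 'n clifford.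
       C_class p q 1 (sym_completion p q D) A \<and> symmetric_on p q (sym_completion p q D) A \<and>
       C_class p q 1 (sym_completion p q D) B \<and> symmetric_on p q (sym_completion p q D) B \<longrightarrow>
       (let g = (\<lambda>x. A x - cconj x * B x)
        in gen_partial_slice p q D g \<and>
           (gen_partial_slice_regular p q D g \<longleftrightarrow>
             AB_system p D (stem_of p q A) (stem_of p q B))))"
proof -
  interpret slice_domain p q D
    using dim q D reflection by unfold_locales (auto simp: domain_in_stem_space_def)
  have unique: "A' x = A x \<and> B' x = B x"
    if A: "symmetric_on p q \<Omega> A" "symmetric_on p q \<Omega> A'" and B: "symmetric_on p q \<Omega> B" "symmetric_on p q \<Omega> B'"
      and ph: "polyharmonic_on p q m \<Omega> B" "polyharmonic_on p q m \<Omega> B'"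
      and eq: "\<forall>x\<in>\<Omega>. f x = A x - cconj x * B x" "\<forall>x\<in>\<Omega>. f x = A' x - cconj x * B' x"
      and x: "x \<in> \<Omega>"
    for f A B A' B' and x :: "'n clifford"
  proof -
    \<comment> \<open>The differences of two decompositions form a decomposition of zero and inherit
      symmetry; the continuity needed at radius \<open>0\<close> is part of polyharmonicity.\<close>
    have "(\<lambda>x. A' x - A x) x = 0 \<and> (\<lambda>x. B' x - B x) x = 0"
    proof (rule decomposition_unique[OF _ _ _ _ x])
      have "continuous_on \<Omega> B" "continuous_on \<Omega> B'"
        using ph Ck_on_continuous unfolding polyharmonic_on_def C_class_def by blast+
      then show "continuous_on \<Omega> (\<lambda>x. B' x - B x)" by (intro continuous_on_diff)
      show "symmetric_on p q \<Omega> (\<lambda>x. A' x - A x)" "symmetric_on p q \<Omega> (\<lambda>x. B' x - B x)"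
        using A B unfolding symmetric_on_def by metis+
      show "A' x - A x = cconj x * (B' x - B x)" if "x \<in> \<Omega>" for x
      proof -
        have "A x - cconj x * B x = A' x - cconj x * B' x" using eq that by metis
        then show ?thesis by (simp add: algebra_simps)
      qed
    qed
    then show ?thesis by simp
  qed
  have m: "m \<ge> 1" using q by simp
  show ?thesis
    unfolding Let_def
  proof (intro conjI allI impI, goal_cases)
    case (1 f)
    obtain A B where AB: "polyharmonic_on p q m \<Omega> A" "symmetric_on p q \<Omega> A"
      "polyharmonic_on p q m \<Omega> B" "symmetric_on p q \<Omega> B" "\<forall>x\<in>\<Omega>. f x = A x - cconj x * B x"
      using regular_decomposition[OF 1 q(1) m] by metis
    show ?case
      by (intro exI[of _ A] exI[of _ B] conjI AB allI impI ballI)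
        (use unique[OF AB(2) _ AB(4) _ AB(3) _ AB(5)] in blast)+
  next
    case (2 A B)
    then show ?case using converse_part(1)[of A B] by blast
  next
    case (3 A B)
    then show ?case using converse_part(2)[of A B] by blast
  qed
qed

end
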